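(* Assume (A1)-(A5), and suppose that $\{\Lambda(x,i;t)\}_{t\ge0}$ and $\sigma(x,i)$ are $x$-independent (write $\Lambda(i;t)$ and $\sigma(i)$). Assume also that $\{\Lambda(i;t)\}_{t\ge0}$ is irreducible and let $\lambda=(\lambda_i)_{i\in\mathbb S}$ be its invariant probability measure. Further, let $f,\psi:[0,+\infty)\to[0,+\infty)$ be such that (i) $f$ is bounded, concave, non-decreasing, absolutely continuous on $[u_0,u_1]$ for all $0<u_0<u_1<+\infty$, and $f(u)=0$ if, and only if, $u=0$; (ii) $\psi$ is convex and $\psi(u)=0$ if, and only if, $u=0$; (iii) there are $\{\Gamma_i\}_{i\in\mathbb S}\subset(-\infty,0]$ such that, for every $i\in\mathbb S$, $$f'(|x-y|)\,\langle x-y,\mathrm b(x,i)-\mathrm b(y,i)\rangle\le\Gamma_i\,|x-y|\,\psi\bigl(f(|x-y|)\bigr)$$ a.e. on $\mathbb R^d$ (in $x$ and $y$); (iv) $\sum_{i\in\mathbb S}\Gamma_i\lambda_i<0$. Then, for $\rho((x,i),(y,j))=\mathbb 1_{\{i\ne j\}}+f(|x-y|)$, all $p\ge1$ and all $(x,i),(y,j)\in\mathbb R^d\times\mathbb S$, $$\lim_{t\to\infty}\mathcal W_{f,p}\bigl(\delta_{(x,i)}\mathcal P_t,\delta_{(y,j)}\mathcal P_t\bigr)=0.$$ Additionally, if $\psi(u)=u^q$ for some $q>1$, then $$\limsup_{t\to\infty}t^{1/(q-1)}\,\mathcal W_{f,p}\bigl(\delta_{(x,i)}\mathcal P_t,\delta_{(y,j)}\mathcal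 P_t\bigr)\le\Bigl(\frac{1-q}{2}\sum_{i\in\mathbb S}\Gamma_i\lambda_i\Bigr)^{1/(1-q)}.$$ If $\psi(u)=\kappa u$ for some $\kappa>0$, then $$\lim_{t\to\infty}e^{\alpha t/2}\,\mathcal W_{f,p}\bigl(\delta_{(x,i)}\mathcal P_t,\delta_{(y,j)}\mathcal P_t\bigr)=0$$ for all $0<\alpha<\min\{\vartheta/p,\,-\kappa\sum_{i\in\mathbb S}\Gamma_i\lambda_i\}$.
   Context: Setting. $\mathbb S$ is a finite set, $\{\mathsf B(t)\}_{t\ge0}$ is a standard $n$-dimensional Brownian motion starting from the origin, $\mathrm b:\mathbb R^d\times\mathbb S\to\mathbb R^d$ and $\sigma:\mathbb R^d\times\mathbb S\to\mathbb R^{d\times n}$. The regime-switching diffusion process $\{(\mathsf X(x,i;t),\Lambda(x,i;t))\}_{t\ge0}$, $(x,i)\in\mathbb R^d\times\mathbb S$, has first component given by $$\mathrm d\mathsf X(x,i;t)=\mathrm b(\mathsf X(x,i;t),\Lambda(x,i;t))\,\mathrm dt+\sigma(\mathsf X(x,i;t),\Lambda(x,i;t))\,\mathrm d\mathsf B(t),\quad \mathsf X(x,i;0)=x,\ \Lambda(x,i;0)=i,\qquad( * )$$ and second component a right-continuous temporally-homogeneous Markov chain with state space $\mathbb S$; $\mathsf B$ and $\Lambda$ are defined on a stochastic basis $(\Omega,\mathcal F,\{\mathcal F_t\}_{t\ge0},\mathbb P)$ satisfying the usual conditions. Spaces of functions on $\mathbb R^d\times\mathbb S$ (such as $\mathcal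 B_b$, $\mathcal C_b$, $\mathcal C^2$: bounded Borel, bounded continuous, twice continuously differentiable) are understood as conditions on $x\mapsto f(x,i)$ for every $i\in\mathbb S$. $\mathscr B_r(x)$ is the open ball, $\|M\|_{\mathrm{HS}}^2=\mathrm{Tr}\,MM^T$. Assumptions: (A1) for any $r>0$, $i\in\mathbb S$: $\sup_{x\in\mathscr B_r(0)}(|\mathrm b(x,i)|+\|\sigma(x,i)\|_{\mathrm{HS}})<\infty$. (A2) for each $(x,i)$ equation $( * )$ admits a unique nonexplosive strong solution with continuous sample paths. (A3) $\{(\mathsf X(x,i;t),\Lambda(x,i;t))\}_{t\ge0}$ is a temporally-homogeneous strong Markov process with transition kernel $\mathsf p(t,(x,i),\mathrm dy\times\{j\})=\mathbb P((\mathsf X(x,i;t),\Lambda(x,i;t))\in\mathrm dy\times\{j\})$. (A4) the semigroup $\mathcal P_tf(x,i)=\int_{\mathbb R^d\times\mathbb S}f(y,j)\,\mathsf p(t,(x,i),\mathrm dy\times\{j\})$, $f\in\mathcal B_b(\mathbb R^d\times\mathbb S)$, is $\mathcal C_b$-Feller: $\mathcal P_t(\mathcal C_b(\mathbb R^d\times\mathbb S))\subseteq\mathcal C_b(\mathbb R^d\times\mathbb S)$ for all $t\ge0$. (A5) for any $(x,i)$ and $f\in\mathcal C^2(\mathbb R^d\times\mathbb S)$ the process $f(\mathsf X(x,i;t),\Lambda(x,i;t))-f(x,i)-\int_0^t\mathcal Lf(\mathsf X(x,i;s),\Lambda(x,i;s))\,\mathrm ds$, $t\ge0$, is a $\mathbb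 P$-local martingale, where $\mathcal Lf(x,i)=\mathcal L_if(x,i)+\mathcal Q(x)f(x,i)$, $$\mathcal L_if(x)=\langle\mathrm b(x,i),\nabla f(x)\rangle+\tfrac12\mathrm{Tr}\bigl(\sigma(x,i)\sigma(x,i)^T\nabla^2f(x)\bigr),\quad f\in\mathcal C^2(\mathbb R^d),$$ and $\mathcal Q(x)=(\mathrm q_{ij}(x))_{i,j\in\mathbb S}$ is the infinitesimal generator of $\Lambda$: $\mathcal Q(x)f(i)=\sum_{j}f(j)\mathrm q_{ij}(x)$ with $\mathrm q_{ij}(x)=\lim_{t\to0}\mathbb P(\Lambda(x,i;t)=j)/t$ for $i\ne j$ and $\mathrm q_{ii}(x)=-\sum_{j\ne i}\mathrm q_{ij}(x)$. When $\Lambda$ is $x$-independent, $\mathcal Q=(\mathrm q_{ij})$ is constant; the chain is irreducible if for any $i\ne j$ there are $m\in\mathbb N$ and $k_0=i,k_1,\dots,k_m=j$ with $k_l\ne k_{l+1}$ and $\mathrm q_{k_lk_{l+1}}>0$ for $l=0,\dots,m-1$. Constant $\vartheta$: $\zeta=\inf_{i,j\in\mathbb S}\mathbb P(\Lambda(i;1)=j)$ (with $0<\zeta<1$) and $\vartheta=-\log(1-\zeta)$. Wasserstein distance: for probability measures $\mu,\nu$ on $\mathbb R^d\times\mathbb S$ and $p\ge1$, with $\rho((x,i),(y,j))=\mathbb 1_{\{i\ne j\}}+f(|x-y|)$, $$\mathcal W_{f,p}(\mu,\nu)=\inf_{\Pi\in\mathcal C(\mu,\nu)}\Bigl(\int\rho((x,i),(y,j))^p\,\Pi(\mathrm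 dx\times\{i\},\mathrm dy\times\{j\})\Bigr)^{1/p},$$ $\mathcal C(\mu,\nu)$ being the set of couplings of $\mu$ and $\nu$. $\delta_{(x,i)}\mathcal P_t=\mathsf p(t,(x,i),\cdot)$.
   Formalization: In (iii), "a.e. in x and y" is read as: for all x,y whose distance |x-y| lies outside a Lebesgue-null set of distances; with an arbitrary null set of pairs (x,y) the claim fails, e.g. for degenerate σ and a drift b that is discontinuous across a line. *)

theory Defs
  imports "HOL-Probability.Probability"
begin

text \<open>
  Time is \<open>real\<close>, and only times \<open>t \<ge> 0\<close> are ever used; a filtration indexed by the half-line
  is extended to negative times arbitrarily (e.g. by \<open>F 0\<close>). The finite set of regimes is the
  type \<open>'s::finite\<close>, and an \<open>\<real>\<^sup>d \<times> \<real>\<^sup>n\<close>-matrix has type \<open>real ^ 'n ^ 'd\<close>.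
\<close>

section \<open>Stochastic basis, martingales, Brownian motion\<close>

locale stochastic_basis = prob_space M + filtration "space M" F + complete_measure M
  for M :: "'w measure" and F :: "real \<Rightarrow> 'w measure" +
  assumes subalg: "subalgebra M (F t)"
    and right_cont: "0 \<le> t \<Longrightarrow> sets (F t) = (\<Inter>s\<in>{t<..}. sets (F s))"
    and null_sets_F0: "null_sets M \<subseteq> sets (F 0)"

definition adapted :: "(real \<Rightarrow> 'w measure) \<Rightarrow> 'v measure \<Rightarrow> (real \<Rightarrow> 'w \<Rightarrow> 'v) \<Rightarrow> bool" where
  "adapted F N Z \<longleftrightarrow> (\<forall>t\<ge>0. Z t \<in> F t \<rightarrow>\<^sub>M N)"

definition progressive :: "(real \<Rightarrow> 'w measure) \<Rightarrow> 'v measure \<Rightarrow> (real \<Rightarrow> 'w \<Rightarrow> 'v) \<Rightarrow> bool" where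
  "progressive F N Z \<longleftrightarrow>
     (\<forall>T\<ge>0. (\<lambda>(t, \<omega>). Z t \<omega>) \<in> (restrict_space borel {0..T} \<Otimes>\<^sub>M F T) \<rightarrow>\<^sub>M N)"

definition martingale :: "'w measure \<Rightarrow> (real \<Rightarrow> 'w measure) \<Rightarrow> (real \<Rightarrow> 'w \<Rightarrow> real) \<Rightarrow> bool" where
  "martingale M F Z \<longleftrightarrow> adapted F borel Z \<and> (\<forall>t\<ge>0. integrable M (Z t)) \<and>
     (\<forall>s t. 0 \<le> s \<longrightarrow> s \<le> t \<longrightarrow> (AE \<omega> in M. real_cond_exp M (F s) (Z t) \<omega> = Z s \<omega>))"

text \<open>
  Localizing times are taken finite, which is no restriction: replace \<open>T\<^sub>k\<close> by \<open>min T\<^sub>k k\<close>.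
\<close>
definition local_martingale ::
    "'w measure \<Rightarrow> (real \<Rightarrow> 'w measure) \<Rightarrow> (real \<Rightarrow> 'w \<Rightarrow> real) \<Rightarrow> bool" where
  "local_martingale M F Z \<longleftrightarrow> adapted F borel Z \<and>
     (\<exists>T :: nat \<Rightarrow> 'w \<Rightarrow> real.
        (\<forall>k. stopping_time F (T k) \<and> (\<forall>\<omega>\<in>space M. 0 \<le> T k \<omega>)) \<and>
        (AE \<omega> in M. incseq (\<lambda>k. T k \<omega>) \<and> filterlim (\<lambda>k. T k \<omega>) at_top sequentially) \<and>
        (\<forall>k. martingale M F (\<lambda>t \<omega>. Z (min t (T k \<omega>)) \<omega>)))"

definition brownian_motion ::
    "'w measure \<Rightarrow> (real \<Rightarrow> 'w measure) \<Rightarrow> (real \<Rightarrow> 'w \<Rightarrow> real ^ 'n) \<Rightarrow> bool" where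
  "brownian_motion M F B \<longleftrightarrow> adapted F borel B \<and>
     (\<forall>\<omega>\<in>space M. B 0 \<omega> = 0 \<and> continuous_on {0..} (\<lambda>t. B t \<omega>)) \<and>
     (\<forall>s t. 0 \<le> s \<longrightarrow> s < t \<longrightarrow>
        prob_space.indep_set M (sets (F s))
          (sets (vimage_algebra (space M) (\<lambda>\<omega>. B t \<omega> - B s \<omega>) borel)) \<and>
        distributed M lborel (\<lambda>\<omega>. B t \<omega> - B s \<omega>)
          (\<lambda>x. ennreal (\<Prod>k\<in>UNIV. normal_density 0 (sqrt (t - s)) (x $ k))))"

section \<open>The Ito integral\<close>

definition hs_norm :: "real ^ 'n ^ 'd \<Rightarrow> real" where
  "hs_norm A = sqrt (trace (A ** transpose A))"

text \<open>
  A simple process \<open>(m, \<tau>, \<xi>)\<close> takes the value \<open>\<xi> k\<close> on \<open>(\<tau> k, \<tau> (k+1)]\<close> for \<open>k < m\<close>,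
  and is zero elsewhere.
\<close>
type_synonym ('w, 'v) simple_proc = "nat \<times> (nat \<Rightarrow> real) \<times> (nat \<Rightarrow> 'w \<Rightarrow> 'v)"

definition is_simple_proc ::
    "'w measure \<Rightarrow> (real \<Rightarrow> 'w measure) \<Rightarrow> ('w, real ^ 'n ^ 'd) simple_proc \<Rightarrow> bool" where
  "is_simple_proc M F = (\<lambda>(m, \<tau>, \<xi>). 0 \<le> \<tau> 0 \<and> mono \<tau> \<and>
     (\<forall>k<m. \<xi> k \<in> borel_measurable (F (\<tau> k)) \<and> bounded (\<xi> k ` space M)))"

definition simple_val ::
    "('w, real ^ 'n ^ 'd) simple_proc \<Rightarrow> real \<Rightarrow> 'w \<Rightarrow> real ^ 'n ^ 'd" where
  "simple_val = (\<lambda>(m, \<tau>, \<xi>) t \<omega>. \<Sum>k<m. indicat_real {\<tau> k<..\<tau> (Suc k)} t *\<^sub>R \<xi> k \<omega>)"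

definition simple_int ::
    "(real \<Rightarrow> 'w \<Rightarrow> real ^ 'n) \<Rightarrow> ('w, real ^ 'n ^ 'd) simple_proc \<Rightarrow> real \<Rightarrow> 'w \<Rightarrow> real ^ 'd" where
  "simple_int B = (\<lambda>(m, \<tau>, \<xi>) t \<omega>.
     \<Sum>k<m. \<xi> k \<omega> *v (B (min t (\<tau> (Suc k))) \<omega> - B (min t (\<tau> k)) \<omega>))"

definition approximates ::
    "'w measure \<Rightarrow> (real \<Rightarrow> 'w measure) \<Rightarrow> (real \<Rightarrow> 'w \<Rightarrow> real ^ 'n ^ 'd) \<Rightarrow>
      (nat \<Rightarrow> ('w, real ^ 'n ^ 'd) simple_proc) \<Rightarrow> bool" where
  "approximates M F \<phi> S \<longleftrightarrow> (\<forall>k. is_simple_proc M F (S k)) \<and>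
     (\<forall>T\<ge>0. \<forall>\<epsilon>>0. (\<lambda>k. measure M {\<omega> \<in> space M.
         ennreal \<epsilon> < (\<integral>\<^sup>+s\<in>{0..T}. ennreal ((hs_norm (simple_val (S k) s \<omega> - \<phi> s \<omega>))\<^sup>2) \<partial>lborel)})
       \<longlonglongrightarrow> 0)"

text \<open>
  \<open>I\<close> is the integral \<open>\<integral>\<phi> dB\<close>, as a process: the continuous adapted process which is the limit,
  uniformly on compact time intervals in probability, of the integrals of any sequence of simple
  processes approximating the progressive, pathwise locally square integrable integrand \<open>\<phi>\<close>.
\<close>
definition ito_integral ::
    "'w measure \<Rightarrow> (real \<Rightarrow> 'w measure) \<Rightarrow> (real \<Rightarrow> 'w \<Rightarrow> real ^ 'n) \<Rightarrow>
      (real \<Rightarrow> 'w \<Rightarrow> real ^ 'n ^ 'd) \<Rightarrow> (real \<Rightarrow> 'w \<Rightarrow> real ^ 'd) \<Rightarrow> bool" where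
  "ito_integral M F B \<phi> I \<longleftrightarrow>
     progressive F borel \<phi> \<and>
     (AE \<omega> in M. \<forall>T\<ge>0. (\<integral>\<^sup>+s\<in>{0..T}. ennreal ((hs_norm (\<phi> s \<omega>))\<^sup>2) \<partial>lborel) < \<infinity>) \<and>
     adapted F borel I \<and> (\<forall>\<omega>\<in>space M. continuous_on {0..} (\<lambda>t. I t \<omega>)) \<and>
     (\<exists>S. approximates M F \<phi> S) \<and>
     (\<forall>S. approximates M F \<phi> S \<longrightarrow> (\<forall>T\<ge>0. \<forall>\<epsilon>>0.
        (\<lambda>k. measure M {\<omega> \<in> space M. \<exists>t\<in>{0..T}. \<epsilon> < norm (simple_int B (S k) t \<omega> - I t \<omega>)})
          \<longlonglongrightarrow> 0))"

section \<open>Markov chains on the set of regimes\<close>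

text \<open>\<open>L i\<close> is the chain started at \<open>i\<close>.\<close>

definition trans_prob ::
    "'w measure \<Rightarrow> ('s \<Rightarrow> real \<Rightarrow> 'w \<Rightarrow> 's) \<Rightarrow> real \<Rightarrow> 's \<Rightarrow> 's \<Rightarrow> real" where
  "trans_prob M L t i j = measure M {\<omega> \<in> space M. L i t \<omega> = j}"

definition rate :: "'w measure \<Rightarrow> ('s::finite \<Rightarrow> real \<Rightarrow> 'w \<Rightarrow> 's) \<Rightarrow> 's \<Rightarrow> 's \<Rightarrow> real" where
  "rate M L i j =
     (let q = (\<lambda>k. Lim (at_right 0) (\<lambda>t. trans_prob M L t i k / t))
      in if i \<noteq> j then q j else - (\<Sum>k\<in>UNIV - {i}. q k))"

text \<open>
  The path properties of the second component of a regime-switching diffusion, and existence of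
  the limits in \<^const>\<open>rate\<close>. Right-continuity is with respect to the discrete topology.
\<close>
definition switching_process ::
    "'w measure \<Rightarrow> (real \<Rightarrow> 'w measure) \<Rightarrow> ('s::finite \<Rightarrow> real \<Rightarrow> 'w \<Rightarrow> 's) \<Rightarrow> bool" where
  "switching_process M F L \<longleftrightarrow>
     (\<forall>i. adapted F (count_space UNIV) (L i)) \<and>
     (\<forall>i. \<forall>\<omega>\<in>space M. L i 0 \<omega> = i \<and> (\<forall>t\<ge>0. \<forall>\<^sub>F s in at_right t. L i s \<omega> = L i t \<omega>)) \<and>
     (\<forall>i j. i \<noteq> j \<longrightarrow> (\<exists>l. ((\<lambda>t. trans_prob M L t i j / t) \<longlongrightarrow> l) (at_right 0)))"

definition homogeneous_markov_chain ::
    "'w measure \<Rightarrow> (real \<Rightarrow> 'w measure) \<Rightarrow> ('s::finite \<Rightarrow> real \<Rightarrow> 'w \<Rightarrow> 's) \<Rightarrow> bool" where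
  "homogeneous_markov_chain M F L \<longleftrightarrow> switching_process M F L \<and>
     (\<forall>i j s t. 0 \<le> s \<longrightarrow> 0 \<le> t \<longrightarrow>
        (AE \<omega> in M. real_cond_exp M (F s) (\<lambda>\<omega>. indicator {j} (L i (s + t) \<omega>)) \<omega>
           = trans_prob M L t (L i s \<omega>) j))"

definition irreducible_rates :: "('s \<Rightarrow> 's \<Rightarrow> real) \<Rightarrow> bool" where
  "irreducible_rates q \<longleftrightarrow>
     (\<forall>i j. i \<noteq> j \<longrightarrow> (\<exists>(m::nat) k. k 0 = i \<and> k m = j \<and>
        (\<forall>l<m. k l \<noteq> k (Suc l) \<and> 0 < q (k l) (k (Suc l)))))"

definition invariant_prob ::
    "'w measure \<Rightarrow> ('s::finite \<Rightarrow> real \<Rightarrow> 'w \<Rightarrow> 's) \<Rightarrow> ('s \<Rightarrow> real) \<Rightarrow> bool" where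
  "invariant_prob M L l \<longleftrightarrow> (\<forall>i. 0 \<le> l i) \<and> (\<Sum>i\<in>UNIV. l i) = 1 \<and>
     (\<forall>t\<ge>0. \<forall>j. (\<Sum>i\<in>UNIV. l i * trans_prob M L t i j) = l j)"

text \<open>
  If there is only one regime then \<open>zeta = 1\<close>, and \<open>vartheta\<close> has the junk value \<open>- ln 0 = 0\<close>;
  the constant is meaningful for \<open>0 < zeta < 1\<close> only.
\<close>
definition zeta :: "'w measure \<Rightarrow> ('s::finite \<Rightarrow> real \<Rightarrow> 'w \<Rightarrow> 's) \<Rightarrow> real" where
  "zeta M L = (INF (i, j)\<in>UNIV. trans_prob M L 1 i j)"

definition vartheta :: "'w measure \<Rightarrow> ('s::finite \<Rightarrow> real \<Rightarrow> 'w \<Rightarrow> 's) \<Rightarrow> real" where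
  "vartheta M L = - ln (1 - zeta M L)"

section \<open>Regime-switching diffusions\<close>

definition locally_bounded_coeffs ::
    "(real ^ 'd \<Rightarrow> 's \<Rightarrow> real ^ 'd) \<Rightarrow> (real ^ 'd \<Rightarrow> 's \<Rightarrow> real ^ 'n ^ 'd) \<Rightarrow> bool" where
  "locally_bounded_coeffs b \<sigma> \<longleftrightarrow>
     (\<forall>r>0. \<forall>i. bdd_above ((\<lambda>x. norm (b x i) + hs_norm (\<sigma> x i)) ` ball 0 r))"

text \<open>
  The filtration generated by the driving processes \<open>B\<close> and \<open>\<Lambda>\<close>, augmented by the null sets; a
  strong solution is one adapted to it.
\<close>
definition noise_algebra ::
    "'w measure \<Rightarrow> (real \<Rightarrow> 'w \<Rightarrow> real ^ 'n) \<Rightarrow> (real \<Rightarrow> 'w \<Rightarrow> 's) \<Rightarrow> real \<Rightarrow> 'w measure" where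
  "noise_algebra M B \<Lambda> t = sigma (space M)
     ({B s -` A \<inter> space M | s A. 0 \<le> s \<and> s \<le> t \<and> A \<in> sets borel} \<union>
      {\<Lambda> s -` A \<inter> space M | s A. 0 \<le> s \<and> s \<le> t} \<union> null_sets M)"

text \<open>Nonexplosion is built in: \<open>X\<close> takes values in \<open>\<real>\<^sup>d\<close> at all times.\<close>
definition strong_solution ::
    "'w measure \<Rightarrow> (real \<Rightarrow> 'w measure) \<Rightarrow> (real \<Rightarrow> 'w \<Rightarrow> real ^ 'n) \<Rightarrow>
      (real ^ 'd \<Rightarrow> 's \<Rightarrow> real ^ 'd) \<Rightarrow> (real ^ 'd \<Rightarrow> 's \<Rightarrow> real ^ 'n ^ 'd) \<Rightarrow>
      (real \<Rightarrow> 'w \<Rightarrow> 's) \<Rightarrow> real ^ 'd \<Rightarrow> (real \<Rightarrow> 'w \<Rightarrow> real ^ 'd) \<Rightarrow> bool" where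
  "strong_solution M F B b \<sigma> \<Lambda> x X \<longleftrightarrow>
     adapted (noise_algebra M B \<Lambda>) borel X \<and>
     (\<forall>\<omega>\<in>space M. X 0 \<omega> = x \<and> continuous_on {0..} (\<lambda>t. X t \<omega>)) \<and>
     (AE \<omega> in M. \<forall>t\<ge>0. set_integrable lborel {0..t} (\<lambda>s. b (X s \<omega>) (\<Lambda> s \<omega>))) \<and>
     (\<exists>I. ito_integral M F B (\<lambda>s \<omega>. \<sigma> (X s \<omega>) (\<Lambda> s \<omega>)) I \<and>
        (AE \<omega> in M. \<forall>t\<ge>0. X t \<omega> = x + (LINT s:{0..t}|lborel. b (X s \<omega>) (\<Lambda> s \<omega>)) + I t \<omega>))"

definition sde_well_posed ::
    "'w measure \<Rightarrow> (real \<Rightarrow> 'w measure) \<Rightarrow> (real \<Rightarrow> 'w \<Rightarrow> real ^ 'n) \<Rightarrow>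
      (real ^ 'd \<Rightarrow> 's \<Rightarrow> real ^ 'd) \<Rightarrow> (real ^ 'd \<Rightarrow> 's \<Rightarrow> real ^ 'n ^ 'd) \<Rightarrow>
      (real ^ 'd \<Rightarrow> 's \<Rightarrow> real \<Rightarrow> 'w \<Rightarrow> real ^ 'd) \<Rightarrow> (real ^ 'd \<Rightarrow> 's \<Rightarrow> real \<Rightarrow> 'w \<Rightarrow> 's) \<Rightarrow> bool" where
  "sde_well_posed M F B b \<sigma> X \<Lambda> \<longleftrightarrow>
     (\<forall>x i. strong_solution M F B b \<sigma> (\<Lambda> x i) x (X x i) \<and>
        (\<forall>Y. strong_solution M F B b \<sigma> (\<Lambda> x i) x Y \<longrightarrow>
           (AE \<omega> in M. \<forall>t\<ge>0. Y t \<omega> = X x i t \<omega>)))"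

abbreviation state_algebra :: "((real ^ 'd) \<times> 's) measure" where
  "state_algebra \<equiv> borel \<Otimes>\<^sub>M count_space UNIV"

definition trans_kernel ::
    "'w measure \<Rightarrow> (real ^ 'd \<Rightarrow> 's \<Rightarrow> real \<Rightarrow> 'w \<Rightarrow> real ^ 'd) \<Rightarrow>
      (real ^ 'd \<Rightarrow> 's \<Rightarrow> real \<Rightarrow> 'w \<Rightarrow> 's) \<Rightarrow> real \<Rightarrow> (real ^ 'd) \<times> 's \<Rightarrow> ((real ^ 'd) \<times> 's) measure" where
  "trans_kernel M X \<Lambda> t = (\<lambda>(x, i). distr M state_algebra (\<lambda>\<omega>. (X x i t \<omega>, \<Lambda> x i t \<omega>)))"

definition strong_markov ::
    "'w measure \<Rightarrow> (real \<Rightarrow> 'w measure) \<Rightarrow> (real ^ 'd \<Rightarrow> 's \<Rightarrow> real \<Rightarrow> 'w \<Rightarrow> real ^ 'd) \<Rightarrow>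
      (real ^ 'd \<Rightarrow> 's \<Rightarrow> real \<Rightarrow> 'w \<Rightarrow> 's) \<Rightarrow> bool" where
  "strong_markov M F X \<Lambda> \<longleftrightarrow>
     (\<forall>t\<ge>0. trans_kernel M X \<Lambda> t \<in> state_algebra \<rightarrow>\<^sub>M prob_algebra state_algebra) \<and>
     (\<forall>x i T t A. stopping_time F T \<longrightarrow> (\<forall>\<omega>\<in>space M. 0 \<le> T \<omega>) \<longrightarrow> 0 \<le> t \<longrightarrow>
        A \<in> sets state_algebra \<longrightarrow>
        (AE \<omega> in M. real_cond_exp M (filtration.pre_sigma (space M) F T)
            (\<lambda>\<omega>. indicator A (X x i (T \<omega> + t) \<omega>, \<Lambda> x i (T \<omega> + t) \<omega>)) \<omega>
          = measure (trans_kernel M X \<Lambda> t (X x i (T \<omega>) \<omega>, \<Lambda> x i (T \<omega>) \<omega>)) A))"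

definition semigroup ::
    "'w measure \<Rightarrow> (real ^ 'd \<Rightarrow> 's \<Rightarrow> real \<Rightarrow> 'w \<Rightarrow> real ^ 'd) \<Rightarrow>
      (real ^ 'd \<Rightarrow> 's \<Rightarrow> real \<Rightarrow> 'w \<Rightarrow> 's) \<Rightarrow> real \<Rightarrow> ((real ^ 'd) \<times> 's \<Rightarrow> real) \<Rightarrow> (real ^ 'd) \<times> 's \<Rightarrow> real" where
  "semigroup M X \<Lambda> t g z = (\<integral>w. g w \<partial>trans_kernel M X \<Lambda> t z)"

definition bounded_continuous :: "((real ^ 'd) \<times> 's \<Rightarrow> real) \<Rightarrow> bool" where
  "bounded_continuous g \<longleftrightarrow>
     (\<forall>i. bounded (range (\<lambda>x. g (x, i))) \<and> continuous_on UNIV (\<lambda>x. g (x, i)))"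

definition Cb_feller ::
    "'w measure \<Rightarrow> (real ^ 'd \<Rightarrow> 's \<Rightarrow> real \<Rightarrow> 'w \<Rightarrow> real ^ 'd) \<Rightarrow>
      (real ^ 'd \<Rightarrow> 's \<Rightarrow> real \<Rightarrow> 'w \<Rightarrow> 's) \<Rightarrow> bool" where
  "Cb_feller M X \<Lambda> \<longleftrightarrow>
     (\<forall>t\<ge>0. \<forall>g. bounded_continuous g \<longrightarrow> bounded_continuous (semigroup M X \<Lambda> t g))"

text \<open>\<open>g\<close> is twice continuously differentiable with gradient \<open>D\<close> and Hessian \<open>H\<close>.\<close>
definition C2_with ::
    "(real ^ 'd \<Rightarrow> real) \<Rightarrow> (real ^ 'd \<Rightarrow> real ^ 'd) \<Rightarrow> (real ^ 'd \<Rightarrow> real ^ 'd ^ 'd) \<Rightarrow> bool" where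
  "C2_with g D H \<longleftrightarrow>
     (\<forall>x. (g has_derivative (\<lambda>h. D x \<bullet> h)) (at x)) \<and>
     (\<forall>x. (D has_derivative (\<lambda>h. H x *v h)) (at x)) \<and> continuous_on UNIV H"

definition generator ::
    "(real ^ 'd \<Rightarrow> 's::finite \<Rightarrow> real ^ 'd) \<Rightarrow> (real ^ 'd \<Rightarrow> 's \<Rightarrow> real ^ 'n ^ 'd) \<Rightarrow>
      (real ^ 'd \<Rightarrow> 's \<Rightarrow> 's \<Rightarrow> real) \<Rightarrow> ('s \<Rightarrow> real ^ 'd \<Rightarrow> real) \<Rightarrow> ('s \<Rightarrow> real ^ 'd \<Rightarrow> real ^ 'd) \<Rightarrow>
      ('s \<Rightarrow> real ^ 'd \<Rightarrow> real ^ 'd ^ 'd) \<Rightarrow> real ^ 'd \<Rightarrow> 's \<Rightarrow> real" where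
  "generator b \<sigma> q g D H x i =
     b x i \<bullet> D i x + 1 / 2 * trace (\<sigma> x i ** transpose (\<sigma> x i) ** H i x) +
     (\<Sum>j\<in>UNIV. g j x * q x i j)"

definition martingale_problem ::
    "'w measure \<Rightarrow> (real \<Rightarrow> 'w measure) \<Rightarrow>
      (real ^ 'd \<Rightarrow> 's::finite \<Rightarrow> real ^ 'd) \<Rightarrow> (real ^ 'd \<Rightarrow> 's \<Rightarrow> real ^ 'n ^ 'd) \<Rightarrow>
      (real ^ 'd \<Rightarrow> 's \<Rightarrow> real \<Rightarrow> 'w \<Rightarrow> real ^ 'd) \<Rightarrow> (real ^ 'd \<Rightarrow> 's \<Rightarrow> real \<Rightarrow> 'w \<Rightarrow> 's) \<Rightarrow> bool" where
  "martingale_problem M F b \<sigma> X \<Lambda> \<longleftrightarrow>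
     (\<forall>x i g D H. (\<forall>j. C2_with (g j) (D j) (H j)) \<longrightarrow>
        local_martingale M F (\<lambda>t \<omega>. g (\<Lambda> x i t \<omega>) (X x i t \<omega>) - g i x -
          (LINT s:{0..t}|lborel.
             generator b \<sigma> (\<lambda>y. rate M (\<Lambda> y)) g D H (X x i s \<omega>) (\<Lambda> x i s \<omega>))))"

section \<open>Conditions on the drift, and the Wasserstein distance\<close>

definition absolutely_continuous_on_interval :: "real \<Rightarrow> real \<Rightarrow> (real \<Rightarrow> real) \<Rightarrow> bool" where
  "absolutely_continuous_on_interval a b f \<longleftrightarrow>
     (\<forall>\<epsilon>>0. \<exists>\<delta>>0. \<forall>P. finite P \<longrightarrow> (\<forall>(u, v)\<in>P. a \<le> u \<and> u \<le> v \<and> v \<le> b) \<longrightarrow>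
        disjoint_family_on (\<lambda>(u, v). {u<..<v}) P \<longrightarrow> (\<Sum>(u, v)\<in>P. v - u) < \<delta> \<longrightarrow>
        (\<Sum>(u, v)\<in>P. \<bar>f v - f u\<bar>) < \<epsilon>)"

text \<open>
  The inequality
  \<open>f'(|x-y|) \<langle>x-y, b x - b y\<rangle> \<le> \<Gamma> |x-y| \<psi>(f(|x-y|))\<close>
  is required "almost everywhere" because \<open>f'\<close> exists only almost everywhere: it holds for all
  \<open>x, y\<close> whose distance \<open>u\<close> lies outside a Lebesgue null set. An arbitrary Lebesgue null set
  of pairs \<open>(x, y)\<close> must not be discarded: \<open>\<sigma>\<close> may vanish, so paths may spend all their time in
  a null set. For instance, in the plane with \<open>\<sigma> = 0\<close> the drift
  \<open>b x = - (|x|\<^sup>2 + 1) x - (0, sgn x\<^sub>2)\<close> off the axis \<open>x\<^sub>2 = 0\<close> and \<open>b (x\<^sub>1, 0) = (x\<^sub>1, 0)\<close> on it has a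
  unique continuous flow, is strongly dissipative for almost all pairs, and its solutions reach
  the axis in finite time and then separate exponentially.
\<close>
definition dissipative ::
    "(real \<Rightarrow> real) \<Rightarrow> (real \<Rightarrow> real) \<Rightarrow> real \<Rightarrow> (real ^ 'd \<Rightarrow> real ^ 'd) \<Rightarrow> bool" where
  "dissipative f \<psi> \<Gamma> b \<longleftrightarrow>
     (AE u in lborel. 0 < u \<longrightarrow>
        (\<forall>x y. norm (x - y) = u \<longrightarrow>
           deriv f (norm (x - y)) * ((x - y) \<bullet> (b x - b y)) \<le> \<Gamma> * norm (x - y) * \<psi> (f (norm (x - y)))))"

definition rho :: "(real \<Rightarrow> real) \<Rightarrow> (real ^ 'd) \<times> 's \<Rightarrow> (real ^ 'd) \<times> 's \<Rightarrow> real" where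
  "rho f = (\<lambda>(x, i) (y, j). of_bool (i \<noteq> j) + f (norm (x - y)))"

definition couplings :: "'a measure \<Rightarrow> 'b measure \<Rightarrow> ('a \<times> 'b) measure set" where
  "couplings \<mu> \<nu> =
     {\<pi>. sets \<pi> = sets (\<mu> \<Otimes>\<^sub>M \<nu>) \<and> distr \<pi> \<mu> fst = \<mu> \<and> distr \<pi> \<nu> snd = \<nu>}"

text \<open>
  Meant for bounded nonnegative measurable \<open>f\<close>, when all integrals below are finite.
\<close>
definition wasserstein ::
    "(real \<Rightarrow> real) \<Rightarrow> real \<Rightarrow> ((real ^ 'd) \<times> 's) measure \<Rightarrow> ((real ^ 'd) \<times> 's) measure \<Rightarrow> real" where
  "wasserstein f p \<mu> \<nu> =
     (INF \<pi>\<in>couplings \<mu> \<nu>. (\<integral>(z, w). rho f z w powr p \<partial>\<pi>) powr (1 / p))"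

end

theory Submission
  imports Defs
begin

text \<open>
  Because \<open>\<sigma>\<close> does not depend on \<open>x\<close>, two solutions driven by the same Brownian motion and the same
  chain differ by a Lipschitz path. Along it \<open>f(|X - Y|)\<close> decays at the rate \<open>|\<Gamma>\<^sub>i| \<psi>(f(|X - Y|))\<close>, so it is
  controlled by the random clock \<open>\<integral>\<^sub>0\<^sup>t |\<Gamma>| ds\<close> evaluated along the chain. Solutions started in
  different regimes are run independently until the regimes agree at an integer time, and
  synchronously afterwards; each unit of time before the meeting costs a factor \<open>1 - \<zeta>\<close>.

  Exponential moments of the clock come from a supersolution \<open>1 + \<theta> g\<close>, where \<open>g\<close> solves the
  Poisson equation \<open>Q g = |\<Gamma>| - \<Sum> |\<Gamma>| \<lambda>\<close>. For the exponential rate with the constant \<open>\<vartheta>\<close> one needs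
  the sharp bound \<open>g \<le> (\<Sum> |\<Gamma>| \<lambda>) / \<vartheta>\<close>, i.e. that no expected hitting time of the chain exceeds
  \<open>1 / \<vartheta>\<close>; an almost sure ergodic theorem for the clock would not control its exponential moments.
\<close>

section \<open>Concave functions and dissipativity\<close>

text \<open>A path may stay at a distance where \<open>f\<close> has a corner, so there is no chain
  rule for \<open>f (|X - Y|)\<close>. The left derivative, which a concave function has at every
  positive point, therefore replaces \<open>deriv f\<close>, and increments over partitions replace
  differentiation. The coupling is built from transition kernels. The given basis supplies one
  driving noise, so the independent phase is a product of kernels, and meeting only at integer times
  turns the concatenation into a finite recursion governed by Chapman-Kolmogorov. The price is
  measurability of the synchronous phase in its pair of starting points. Positions at the meeting
  are uncontrolled; boundedness of \<open>f\<close> makes all later estimates uniform in them. The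
  factor 1/2 has two sources. In the power rate it leaves room for the time spent waiting and for a
  clock that lags behind its mean. In the exponential rate it comes from the fluctuations of the
  clock, whose exponential moments may decay more slowly than its mean suggests.\<close>

definition left_slope :: "(real \<Rightarrow> real) \<Rightarrow> real \<Rightarrow> real" where
  "left_slope f u = (INF v\<in>{0<..<u}. (f u - f v) / (u - v))"

locale concave_mono =
  fixes f :: "real \<Rightarrow> real"
  assumes concave: "concave_on {0..} f" and mono: "mono_on {0..} f"
begin

lemma slope_mono:
  assumes "0 \<le> v" "v < w" "w < u"
  shows "(f u - f w) / (u - w) \<le> (f u - f v) / (u - v)"
    and "(f u - f v) / (u - v) \<le> (f w - f v) / (w - v)"
proof -
  have c: "convex_on {0..} (\<lambda>x. - f x)"
    using concave by (simp add: concave_on_def)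
  have "(- f v - - f w) / (v - w) \<le> (- f v - - f u) / (v - u)"
       "(- f v - - f u) / (v - u) \<le> (- f w - - f u) / (w - u)"
    using convex_on_slope_le[OF c, of v u w] assms by auto
  moreover have "(- f a - - f b) / (a - b) = - ((f b - f a) / (b - a))" for a b
    by (metis minus_diff_eq minus_divide_right diff_minus_eq_add uminus_add_conv_diff)
  ultimately show "(f u - f w) / (u - w) \<le> (f u - f v) / (u - v)"
    and "(f u - f v) / (u - v) \<le> (f w - f v) / (w - v)"
    by simp_all
qed

lemma slope_nonneg: "0 \<le> v \<Longrightarrow> v \<le> u \<Longrightarrow> 0 \<le> (f u - f v) / (u - v)"
  using mono by (auto simp: mono_on_def)

text \<open>Chord slopes towards \<open>u\<close> decrease as the other end approaches
  \<open>u\<close>, so the infimum is the left derivative. It is taken over positive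
  \<open>v\<close> only; the midpoint \<open>w\<close> also covers \<open>v = 0\<close>, where
  \<open>f\<close> may jump.\<close>

lemma left_slope_le:
  assumes "0 \<le> v" "v < u"
  shows "left_slope f u \<le> (f u - f v) / (u - v)"
proof -
  have bdd: "bdd_below ((\<lambda>v. (f u - f v) / (u - v)) ` {0<..<u})"
    using slope_nonneg by (intro bdd_belowI2[of _ 0]) auto
  define w where "w = (u + v) / 2"
  have w: "v < w" "w < u" "0 < w"
    using assms by (auto simp: w_def)
  have "left_slope f u \<le> (f u - f w) / (u - w)"
    unfolding left_slope_def using w by (intro cINF_lower[OF bdd]) auto
  also have "\<dots> \<le> (f u - f v) / (u - v)"
    using slope_mono(1)[of v w u] w assms by auto
  finally show ?thesis .
qed

lemma left_slope_greatest:
  assumes "0 < u" "\<And>v. 0 < v \<Longrightarrow> v < u \<Longrightarrow> c \<le> (f u - f v) / (u - v)"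
  shows "c \<le> left_slope f u"
  unfolding left_slope_def using assms by (intro cINF_greatest) auto

lemma slope_le_left_slope:
  assumes "0 < v" "v < u"
  shows "(f u - f v) / (u - v) \<le> left_slope f v"
proof (rule left_slope_greatest)
  fix w assume w: "0 < w" "w < v"
  show "(f u - f v) / (u - v) \<le> (f v - f w) / (v - w)"
    using slope_mono[of w v u] w assms by linarith
qed (use assms in auto)

lemma left_slope_antimono: "0 < v \<Longrightarrow> v \<le> u \<Longrightarrow> left_slope f u \<le> left_slope f v"
  using left_slope_le[of v u] slope_le_left_slope[of v u] by (cases "v = u") auto

lemma left_slope_nonneg: "0 < u \<Longrightarrow> 0 \<le> left_slope f u"
  using slope_nonneg by (intro left_slope_greatest) auto

lemma diff_ge_left_slope: "0 \<le> v \<Longrightarrow> v \<le> u \<Longrightarrow> left_slope f u * (u - v) \<le> f u - f v"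
  using left_slope_le[of v u] by (cases "v = u") (auto simp: field_simps)

lemma continuous_pos: "continuous_on {0<..} f"
proof -
  have "convex_on {0<..} (\<lambda>x. - f x)"
    using concave unfolding concave_on_def by (rule convex_on_subset) auto
  then have "continuous_on {0<..} (\<lambda>x. - f x)"
    by (intro convex_on_continuous) auto
  then show ?thesis
    using continuous_on_minus by fastforce
qed

lemma isCont_pos: "0 < u \<Longrightarrow> isCont f u"
  using continuous_pos by (simp add: continuous_on_eq_continuous_at)

lemma AE_isCont_left_slope: "AE u in lborel. 0 < u \<longrightarrow> isCont (left_slope f) u"
proof -
  have "countable {a\<in>{0<..}. \<not> isCont (\<lambda>u. - left_slope f u) a}"
    by (intro mono_on_ctble_discont_open) (auto simp: mono_on_def intro!: left_slope_antimono)
  then have "{a\<in>{0<..}. \<not> isCont (\<lambda>u. - left_slope f u) a} \<in> null_sets lborel"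
    by (rule countable_imp_null_set_lborel)
  moreover have "isCont (\<lambda>u. - left_slope f u) a \<Longrightarrow> isCont (left_slope f) a" for a
    using isCont_minus[of a "\<lambda>u. - left_slope f u"] by simp
  ultimately show ?thesis
    by (intro AE_I'[of "{a\<in>{0<..}. \<not> isCont (\<lambda>u. - left_slope f u) a}"]) auto
qed

text \<open>Difference quotients at \<open>u\<close> lie between the left slopes at \<open>u\<close>
  and at \<open>u + h\<close>, so continuity of the left slope turns it into a two-sided
  derivative.\<close>

lemma DERIV_left_slope:
  assumes u: "0 < u" and c: "isCont (left_slope f) u"
  shows "DERIV f u :> left_slope f u"
proof -
  have bound: "norm ((f (u + h) - f u) / h - left_slope f u) \<le> norm (left_slope f (u + h) - left_slope f u)"
    if h: "h \<noteq> 0" "\<bar>h\<bar> < u" for h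
  proof (cases "h > 0")
    case True
    have "left_slope f (u + h) \<le> (f (u + h) - f u) / h"
      using left_slope_le[of u "u + h"] u True by simp
    moreover have "(f (u + h) - f u) / h \<le> left_slope f u"
      using slope_le_left_slope[of u "u + h"] u True by simp
    ultimately show ?thesis by simp
  next
    case False
    have eq: "(f u - f (u + h)) / (- h) = (f (u + h) - f u) / h"
      by (metis minus_diff_eq minus_divide_divide minus_minus)
    have "left_slope f u \<le> (f (u + h) - f u) / h"
      using left_slope_le[of "u + h" u] u False h eq by auto
    moreover have "(f (u + h) - f u) / h \<le> left_slope f (u + h)"
      using slope_le_left_slope[of "u + h" u] u False h eq by auto
    ultimately show ?thesis by simp
  qed
  have "((\<lambda>h. left_slope f (u + h) - left_slope f u) \<longlongrightarrow> 0) (at 0)"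
    using c unfolding isCont_iff by (rule LIM_zero)
  then have g: "((\<lambda>h. norm (left_slope f (u + h) - left_slope f u)) \<longlongrightarrow> 0) (at 0)"
    by (rule tendsto_norm_zero)
  have "\<forall>\<^sub>F h in at 0. norm ((f (u + h) - f u) / h - left_slope f u)
      \<le> norm (left_slope f (u + h) - left_slope f u)"
    unfolding eventually_at using u bound by (intro exI[of _ u]) auto
  from Lim_null_comparison[OF this g] show ?thesis
    unfolding DERIV_def by (rule LIM_zero_cancel)
qed

lemma AE_deriv_eq: "AE u in lborel. 0 < u \<longrightarrow> deriv f u = left_slope f u"
  using AE_isCont_left_slope by eventually_elim (auto intro: DERIV_imp_deriv DERIV_left_slope)

end

section \<open>From almost every distance to every distance\<close>

lemma convex_zero_mono:
  fixes \<psi> :: "real \<Rightarrow> real"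
  assumes "convex_on {0..} \<psi>" "\<psi> 0 = 0" "\<And>u. 0 \<le> u \<Longrightarrow> 0 \<le> \<psi> u" "0 \<le> u" "u \<le> v"
  shows "\<psi> u \<le> \<psi> v"
proof (cases "v = 0")
  case False
  then have v: "0 < v" using assms by simp
  have "\<psi> ((1 - u / v) *\<^sub>R 0 + (u / v) *\<^sub>R v) \<le> (1 - u / v) * \<psi> 0 + (u / v) * \<psi> v"
    using assms v by (intro convex_onD[OF assms(1)]) auto
  then have "\<psi> u \<le> (u / v) * \<psi> v" using v assms(2) by simp
  also have "\<dots> \<le> 1 * \<psi> v"
    using assms v by (intro mult_right_mono) auto
  finally show ?thesis by simp
qed (use assms in auto)

lemma convex_isCont_pos:
  fixes \<psi> :: "real \<Rightarrow> real"
  assumes "convex_on {0..} \<psi>" "0 < u"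
  shows "isCont \<psi> u"
proof -
  have "continuous_on {0<..} \<psi>"
    using assms(1) by (intro convex_on_continuous convex_on_subset[OF assms(1)]) auto
  with assms(2) show ?thesis by (simp add: continuous_on_eq_continuous_at)
qed

text \<open>The reflection of \<open>v\<close> to \<open>u - v\<close> preserves Lebesgue measure,
  so almost every \<open>v\<close> is generic together with \<open>u - v\<close>; and no interval
  ending at \<open>u\<close> is a null set.\<close>

lemma frequently_at_left_AE:
  fixes u :: real
  assumes P: "AE v in lborel. 0 < v \<longrightarrow> P v" and u: "0 < u"
  shows "\<exists>\<^sub>F v in at_left u. 0 < v \<and> P v \<and> P (u - v)"
proof -
  have "distr lborel borel (\<lambda>v. u + - 1 * v) = (lborel :: real measure)"
    using lborel_real_affine[of "-1" u] by (simp add: density_1)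
  then have "AE v in distr lborel borel (\<lambda>v. u + - 1 * v). 0 < v \<longrightarrow> P v"
    using P by (simp only:)
  then have 1: "AE v in lborel. 0 < u - v \<longrightarrow> P (u - v)"
    by (auto dest!: AE_distrD[rotated])
  have 2: "AE v in lborel. (0 < v \<longrightarrow> P v) \<and> (0 < u - v \<longrightarrow> P (u - v))"
    using P 1 by eventually_elim auto
  show ?thesis
    unfolding frequently_def
  proof
    assume "\<forall>\<^sub>F v in at_left u. \<not> (0 < v \<and> P v \<and> P (u - v))"
    moreover have "\<forall>\<^sub>F v in at_left u. 0 < v"
      using u by (intro eventually_at_leftI[of 0]) auto
    ultimately have "\<forall>\<^sub>F v in at_left u. \<not> (P v \<and> P (u - v)) \<and> 0 < v"
      by eventually_elim auto
    then obtain a where a: "a < u" "\<And>v. a < v \<Longrightarrow> v < u \<Longrightarrow> \<not> (P v \<and> P (u - v)) \<and> 0 < v"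
      unfolding eventually_at_left_field by auto
    have "AE v in lborel. v \<notin> {a<..<u}"
      using 2 by eventually_elim (use a in force)
    then have "emeasure lborel {a<..<u} = 0"
      by (subst (asm) AE_iff_measurable[where N="{a<..<u}"]) auto
    with a show False by simp
  qed
qed


context concave_mono
begin

text \<open>
  Exceptional distances cannot be discarded, since a path may spend a set of times of positive measure
  at one of them. They are reached by splitting the segment from \<open>x\<close> to \<open>y\<close> at a point whose distances
  \<open>v\<close> and \<open>u - v\<close> to the end points are both generic, and letting \<open>v\<close> increase to \<open>u\<close>.
\<close>
lemma dissipative_left_slope:
  fixes b :: "real ^ 'd \<Rightarrow> real ^ 'd"
  assumes diss: "dissipative f \<psi> \<Gamma> b" and \<Gamma>: "\<Gamma> \<le> 0"
    and f_pos: "\<And>u. 0 < u \<Longrightarrow> 0 < f u"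
    and \<psi>: "convex_on {0..} \<psi>" and \<psi>_nonneg: "\<And>u. 0 \<le> u \<Longrightarrow> 0 \<le> \<psi> u"
    and slope_pos: "\<And>u. 0 < u \<Longrightarrow> 0 < left_slope f u"
    and xy: "x \<noteq> y"
  shows "left_slope f (norm (x - y)) * ((x - y) \<bullet> (b x - b y)) \<le> \<Gamma> * norm (x - y) * \<psi> (f (norm (x - y)))"
proof -
  define P where "P u \<longleftrightarrow> (\<forall>x y. norm (x - y) = u \<longrightarrow>
      left_slope f u * ((x - y) \<bullet> (b x - b y)) \<le> \<Gamma> * u * \<psi> (f u))" for u
  have P: "AE u in lborel. 0 < u \<longrightarrow> P u"
    using diss AE_deriv_eq unfolding dissipative_def by eventually_elim (auto simp: P_def)
  define u where "u = norm (x - y)"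
  have u: "0 < u" using xy by (simp add: u_def)
  define e where "e = (x - y) \<bullet> (b x - b y) / u"
  \<comment> \<open>Only the piece of length \<open>v\<close> next to \<open>x\<close> contributes
    to the bound. Of the other piece just the sign is used, which can be read off because its left
    slope is positive.\<close>
  have split: "left_slope f v * e \<le> \<Gamma> * \<psi> (f v)" if v: "0 < v" "v < u" "P v" "P (u - v)" for v
  proof -
    define w where "w = x - (v / u) *\<^sub>R (x - y)"
    have xw: "x - w = (v / u) *\<^sub>R (x - y)" and wy: "w - y = ((u - v) / u) *\<^sub>R (x - y)"
      using u by (auto simp: w_def algebra_simps diff_divide_distrib)
    have n: "norm (x - w) = v" "norm (w - y) = u - v"
      unfolding xw wy using u v by (auto simp: u_def[symmetric])
    have 1: "left_slope f v * ((x - w) \<bullet> (b x - b w)) \<le> \<Gamma> * v * \<psi> (f v)"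
      using v n unfolding P_def by auto
    have "left_slope f (u - v) * ((w - y) \<bullet> (b w - b y)) \<le> \<Gamma> * (u - v) * \<psi> (f (u - v))"
      using v n unfolding P_def by auto
    also have "\<dots> \<le> 0"
      using v \<Gamma> \<psi>_nonneg[of "f (u - v)"] f_pos[of "u - v"]
      by (auto intro!: mult_nonpos_nonneg)
    finally have "(w - y) \<bullet> (b w - b y) \<le> 0"
      using slope_pos[of "u - v"] v by (simp add: mult_le_0_iff)
    then have 2: "(x - y) \<bullet> (b w - b y) \<le> 0"
      unfolding wy using u v by (simp add: divide_le_0_iff mult_le_0_iff)
    have 3: "left_slope f v * ((x - y) \<bullet> (b x - b w) / u) \<le> \<Gamma> * \<psi> (f v)"
    proof -
      have "v * (left_slope f v * ((x - y) \<bullet> (b x - b w) / u)) \<le> v * (\<Gamma> * \<psi> (f v))"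
        using 1 unfolding xw inner_scaleR_left by (simp add: mult_ac)
      then show ?thesis using v(1) by (rule mult_left_le_imp_le)
    qed
    have "e = (x - y) \<bullet> (b x - b w) / u + (x - y) \<bullet> (b w - b y) / u"
      unfolding e_def by (simp add: add_divide_distrib[symmetric] inner_add_right[symmetric])
    then have "e \<le> (x - y) \<bullet> (b x - b w) / u"
      using 2 u by (simp add: divide_le_0_iff)
    then have "left_slope f v * e \<le> left_slope f v * ((x - y) \<bullet> (b x - b w) / u)"
      using slope_pos[of v] v by (intro mult_left_mono) auto
    with 3 show ?thesis by linarith
  qed
  have e: "e \<le> 0"
  proof -
    obtain v where v: "0 < v" "v < u" "P v" "P (u - v)"
      using frequently_ex[OF frequently_eventually_conj[OF frequently_at_left_AE[OF P u]
          eventually_at_leftI[of 0 u "\<lambda>v. v < u"]]] u by auto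
    have "left_slope f v * e \<le> 0"
      using split[OF v] \<Gamma> \<psi>_nonneg[of "f v"] f_pos[of v] v by (smt (verit) mult_nonpos_nonneg)
    with slope_pos[of v] v show ?thesis by (simp add: mult_le_0_iff)
  qed
  \<comment> \<open>A chord slope with fixed end \<open>v'\<close> is continuous in its other end,
    so \<open>v\<close> can tend to \<open>u\<close>; since \<open>e\<close> is not positive,
    passing from the left slope to the larger chord slope keeps the inequality. The infimum over
    \<open>v'\<close> is taken afterwards.\<close>
  have slope: "(f u - f v') / (u - v') * e \<le> \<Gamma> * \<psi> (f u)" if v': "0 < v'" "v' < u" for v'
  proof -
    have "isCont (\<lambda>v. (f v - f v') / (v - v') * e - \<Gamma> * \<psi> (f v)) u"
      using v' u isCont_pos[OF u] convex_isCont_pos[OF \<psi> f_pos[OF u]]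
      by (intro continuous_intros) (auto intro: isCont_o2)
    then have lim: "((\<lambda>v. (f v - f v') / (v - v') * e - \<Gamma> * \<psi> (f v))
        \<longlongrightarrow> (f u - f v') / (u - v') * e - \<Gamma> * \<psi> (f u)) (at_left u)"
      unfolding isCont_def by (rule tendsto_within_subset) auto
    have "\<forall>\<^sub>F v in at_left u. v' < v \<and> v < u"
      using v' by (intro eventually_at_leftI[of v']) auto
    with frequently_at_left_AE[OF P u]
    have freq: "\<exists>\<^sub>F v in at_left u. (f v - f v') / (v - v') * e - \<Gamma> * \<psi> (f v) \<le> 0"
    proof (rule frequently_rev_mp[OF frequently_eventually_conj], intro always_eventually allI impI)
      fix v assume v: "(v' < v \<and> v < u) \<and> 0 < v \<and> P v \<and> P (u - v)"
      have "(f v - f v') / (v - v') * e \<le> left_slope f v * e"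
        using left_slope_le[of v' v] v v' e by (intro mult_right_mono_neg) auto
      also have "\<dots> \<le> \<Gamma> * \<psi> (f v)"
        using split v by auto
      finally show "(f v - f v') / (v - v') * e - \<Gamma> * \<psi> (f v) \<le> 0" by simp
    qed
    have "(f u - f v') / (u - v') * e - \<Gamma> * \<psi> (f u) \<le> 0"
    proof (rule ccontr)
      assume "\<not> (f u - f v') / (u - v') * e - \<Gamma> * \<psi> (f u) \<le> 0"
      then have "0 < (f u - f v') / (u - v') * e - \<Gamma> * \<psi> (f u)" by linarith
      from order_tendstoD(1)[OF lim this] have "\<forall>\<^sub>F v in at_left u. 0 < (f v - f v') / (v - v') * e - \<Gamma> * \<psi> (f v)" .
      with freq have "\<exists>\<^sub>F v in at_left u. False"
        by (elim frequently_rev_mp) (auto elim: eventually_mono)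
      then show False by simp
    qed
    then show ?thesis by simp
  qed
  have "left_slope f u * e \<le> \<Gamma> * \<psi> (f u)"
  proof (cases "e = 0")
    case False
    have "\<Gamma> * \<psi> (f u) / e \<le> left_slope f u"
    proof (rule left_slope_greatest[OF u])
      fix v assume "0 < v" "v < u"
      then show "\<Gamma> * \<psi> (f u) / e \<le> (f u - f v) / (u - v)"
        using slope[of v] e False by (simp add: neg_divide_le_eq)
    qed
    then show ?thesis
      using e False by (simp add: neg_divide_le_eq)
  qed (use slope[of "u / 2"] u in auto)
  then have "left_slope f u * e * u \<le> \<Gamma> * \<psi> (f u) * u"
    using u by (intro mult_right_mono) auto
  then show ?thesis
    unfolding u_def[symmetric] e_def using u by (simp add: mult_ac)
qed

text \<open>A vanishing slope at a generic distance would make the left side of the dissipativity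
  inequality 0 and the right side negative. As the slope is antitone, a generic distance beyond
  \<open>u\<close>, found just below \<open>2 * u\<close>, settles \<open>u\<close> itself.\<close>

lemma left_slope_pos:
  fixes b :: "real ^ 'd \<Rightarrow> real ^ 'd"
  assumes diss: "dissipative f \<psi> \<Gamma> b" and \<Gamma>: "\<Gamma> < 0"
    and f_pos: "\<And>u. 0 < u \<Longrightarrow> 0 < f u" and \<psi>_pos: "\<And>u. 0 < u \<Longrightarrow> 0 < \<psi> u"
    and u: "0 < u"
  shows "0 < left_slope f u"
proof -
  define Q where "Q v \<longleftrightarrow> left_slope f v \<noteq> 0" for v
  have Q: "AE v in lborel. 0 < v \<longrightarrow> Q v"
    using diss AE_deriv_eq unfolding dissipative_def
  proof eventually_elim
    case (elim v)
    show ?case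
    proof
      assume v: "0 < v"
      obtain x :: "real ^ 'd" where x: "norm x = v"
        using vector_choose_size[of v] v by auto
      have "left_slope f v * ((x - 0) \<bullet> (b x - b 0)) \<le> \<Gamma> * v * \<psi> (f v)"
        using elim v x by (metis diff_zero)
      also have "\<dots> < 0"
        using v \<Gamma> \<psi>_pos[OF f_pos[OF v]] by (simp add: mult_less_0_iff)
      finally show "Q v" by (auto simp: Q_def)
    qed
  qed
  have "\<exists>\<^sub>F v in at_left (2 * u). (0 < v \<and> Q v \<and> Q (2 * u - v)) \<and> u < v"
    using u by (intro frequently_eventually_frequently[OF frequently_at_left_AE[OF Q]]
        eventually_at_leftI[of u]) auto
  then obtain v where v: "Q v" "u < v"
    using frequently_ex by blast
  then have "0 < left_slope f v"
    using left_slope_nonneg[of v] u by (auto simp: Q_def)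
  also have "\<dots> \<le> left_slope f u"
    using left_slope_antimono[of u v] u v by simp
  finally show ?thesis .
qed

end

section \<open>Contraction along a path\<close>

text \<open>On equal cells of length \<open>h\<close> the errors telescope to
  \<open>(m b - m a) * h\<close>, which vanishes with the mesh. Hence \<open>m\<close> may be any
  function, in particular one with jumps.\<close>

lemma partition_increment_le:
  fixes F A m :: "real \<Rightarrow> real"
  assumes ab: "a \<le> b"
    and step: "\<And>s t. a \<le> s \<Longrightarrow> s \<le> t \<Longrightarrow> t \<le> b \<Longrightarrow> A t - A s - (m t - m s) * (t - s) \<le> F t - F s"
  shows "A b - A a \<le> F b - F a"
proof -
  have *: "A b - A a - (m b - m a) * ((b - a) / real (Suc n)) \<le> F b - F a" for n
  proof -
    define h where "h = (b - a) / real (Suc n)"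
    have h: "0 \<le> h" "a + real (Suc n) * h = b"
      using ab by (auto simp: h_def)
    have "k \<le> Suc n \<Longrightarrow> A (a + real k * h) - A a - (m (a + real k * h) - m a) * h \<le> F (a + real k * h) - F a" for k
    proof (induction k)
      case (Suc k)
      have le: "a + real (Suc k) * h \<le> b"
        unfolding h(2)[symmetric] using Suc.prems h(1) by (intro add_left_mono mult_right_mono) auto
      have "A (a + real (Suc k) * h) - A (a + real k * h) - (m (a + real (Suc k) * h) - m (a + real k * h))
          * ((a + real (Suc k) * h) - (a + real k * h)) \<le> F (a + real (Suc k) * h) - F (a + real k * h)"
        using le h(1) by (intro step) (auto simp: algebra_simps)
      moreover have "(a + real (Suc k) * h) - (a + real k * h) = h"
        by (simp add: algebra_simps)
      ultimately show ?case
        using Suc.IH Suc.prems by (simp only:) (simp add: algebra_simps)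
    qed simp
    from this[of "Suc n"] show ?thesis
      unfolding h(2) by (simp add: h_def)
  qed
  have "(\<lambda>n. A b - A a - (m b - m a) * ((b - a) / real (Suc n))) \<longlonglongrightarrow> A b - A a - (m b - m a) * 0"
    by (intro tendsto_intros LIMSEQ_Suc[OF lim_const_over_n])
  with * show ?thesis
    by (intro LIMSEQ_le_const2[of _ "A b - A a"]) auto
qed

text \<open>One sample path seen deterministically: \<open>Z\<close> is the difference of two
  solutions, \<open>\<beta>\<close> its velocity, \<open>\<gamma>\<close> the dissipation rate read
  along the chain. As \<open>\<beta>\<close> is merely bounded, \<open>Z\<close> is given through
  integrals. The constants \<open>K\<close> and \<open>G\<close> enter only error terms that vanish
  with the mesh.\<close>

locale dissipative_path = concave_mono f
  for f :: "real \<Rightarrow> real" +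
  fixes \<psi> :: "real \<Rightarrow> real" and Z \<beta> :: "real \<Rightarrow> 'a::euclidean_space" and \<gamma> :: "real \<Rightarrow> real" and T K G :: real
  assumes f_zero: "f 0 = 0" and f_pos: "\<And>u. 0 < u \<Longrightarrow> 0 < f u"
    and slope_pos: "\<And>u. 0 < u \<Longrightarrow> 0 < left_slope f u"
    and \<psi>_convex: "convex_on {0..} \<psi>" and \<psi>_zero: "\<psi> 0 = 0" and \<psi>_pos: "\<And>u. 0 < u \<Longrightarrow> 0 < \<psi> u"
    and T: "0 \<le> T"
    and Z_integral: "\<And>s t. 0 \<le> s \<Longrightarrow> s \<le> t \<Longrightarrow> t \<le> T \<Longrightarrow> (\<beta> has_integral Z t - Z s) {s..t}"
    and \<beta>_bound: "\<And>\<tau>. 0 \<le> \<tau> \<Longrightarrow> \<tau> \<le> T \<Longrightarrow> norm (\<beta> \<tau>) \<le> K"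
    and \<gamma>_integrable: "\<gamma> integrable_on {0..T}"
    and \<gamma>_nonneg: "\<And>\<tau>. 0 \<le> \<gamma> \<tau>" and \<gamma>_bound: "\<And>\<tau>. \<gamma> \<tau> \<le> G"
    and dissipation: "\<And>\<tau>. 0 \<le> \<tau> \<Longrightarrow> \<tau> \<le> T \<Longrightarrow> Z \<tau> \<noteq> 0 \<Longrightarrow>
      left_slope f (norm (Z \<tau>)) * (Z \<tau> \<bullet> \<beta> \<tau>) \<le> - \<gamma> \<tau> * norm (Z \<tau>) * \<psi> (f (norm (Z \<tau>)))"
begin

lemma \<psi>_mono: "0 \<le> u \<Longrightarrow> u \<le> v \<Longrightarrow> \<psi> u \<le> \<psi> v"
  using \<psi>_pos \<psi>_zero by (intro convex_zero_mono[OF \<psi>_convex]) (metis less_eq_real_def)+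

lemma f_nonneg: "0 \<le> u \<Longrightarrow> 0 \<le> f u"
  using f_pos[of u] f_zero by (cases "u = 0") auto

lemma f_mono: "0 \<le> u \<Longrightarrow> u \<le> v \<Longrightarrow> f u \<le> f v"
  using mono by (auto simp: mono_on_def)

lemma K_nonneg: "0 \<le> K"
  using \<beta>_bound[of 0] T norm_ge_zero order_trans by blast

lemma G_nonneg: "0 \<le> G"
  using \<gamma>_bound[of 0] \<gamma>_nonneg[of 0] by linarith

lemma Z_lipschitz:
  assumes "0 \<le> s" "s \<le> t" "t \<le> T"
  shows "norm (Z t - Z s) \<le> K * (t - s)"
  using has_integral_bound_real[OF K_nonneg, of "{}" \<beta> "Z t - Z s" s t] Z_integral[of s t] \<beta>_bound assms
  by auto

lemma \<gamma>_integrable_sub: "0 \<le> s \<Longrightarrow> t \<le> T \<Longrightarrow> \<gamma> integrable_on {s..t}"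
  using \<gamma>_integrable by (rule integrable_on_subinterval) auto

lemma integral_\<gamma>_combine:
  "0 \<le> s \<Longrightarrow> s \<le> u \<Longrightarrow> u \<le> t \<Longrightarrow> t \<le> T \<Longrightarrow> integral {s..t} \<gamma> - integral {s..u} \<gamma> = integral {u..t} \<gamma>"
  using Henstock_Kurzweil_Integration.integral_combine[of s u t \<gamma>] \<gamma>_integrable_sub[of s t] by simp

lemma integral_\<gamma>_nonneg: "0 \<le> s \<Longrightarrow> t \<le> T \<Longrightarrow> 0 \<le> integral {s..t} \<gamma>"
  using \<gamma>_nonneg by (intro Henstock_Kurzweil_Integration.integral_nonneg \<gamma>_integrable_sub) auto

lemma integral_\<gamma>_le: "0 \<le> s \<Longrightarrow> s \<le> t \<Longrightarrow> t \<le> T \<Longrightarrow> integral {s..t} \<gamma> \<le> G * (t - s)"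
  using integral_le[OF \<gamma>_integrable_sub[of s t], of "\<lambda>_. G"] \<gamma>_bound
  by (simp add: mult.commute integrable_const_ivl)

text \<open>The squared norm is quadratic in \<open>Z\<close>, so its increments expand exactly and
  \<open>Z = 0\<close> is no exception; \<open>w\<close> is one lower bound for the dissipation,
  valid on the whole interval.\<close>

lemma energy_decay:
  assumes st: "0 \<le> s" "s \<le> t" "t \<le> T"
    and w: "\<And>\<tau>. s \<le> \<tau> \<Longrightarrow> \<tau> \<le> t \<Longrightarrow> Z \<tau> \<bullet> \<beta> \<tau> \<le> - w * \<gamma> \<tau>"
  shows "2 * w * integral {s..t} \<gamma> \<le> (norm (Z s))\<^sup>2 - (norm (Z t))\<^sup>2"
proof -
  have "2 * w * integral {s..t} \<gamma> - 2 * w * integral {s..s} \<gamma> \<le> - (norm (Z t))\<^sup>2 - - (norm (Z s))\<^sup>2"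
  \<comment> \<open>The 3 is made of 2 for freezing \<open>Z\<close> at \<open>u\<close> in the
    doubled inner product and 1 for the square of the increment.\<close>
  proof (rule partition_increment_le[where m="\<lambda>u. 3 * K\<^sup>2 * u", OF st(2)])
    fix u v assume uv: "s \<le> u" "u \<le> v" "v \<le> t"
    have int: "(\<beta> has_integral Z v - Z u) {u..v}"
      using Z_integral uv st by auto
    have 1: "((\<lambda>\<tau>. Z u \<bullet> \<beta> \<tau>) has_integral Z u \<bullet> (Z v - Z u)) {u..v}"
      using has_integral_linear[OF int bounded_linear_inner_right[of "Z u"]] by (simp add: o_def)
    have const: "((\<lambda>_. c) has_integral (v - u) *\<^sub>R c) {u..v}" for c :: real
      using has_integral_const_real[of c u v] uv by simp
    have 2: "((\<lambda>\<tau>. - w * \<gamma> \<tau> + K\<^sup>2 * (v - u)) has_integral - w * integral {u..v} \<gamma> + (v - u) *\<^sub>R (K\<^sup>2 * (v - u))) {u..v}"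
      using uv st \<gamma>_integrable_sub[of u v]
      by (intro has_integral_add has_integral_mult_right integrable_integral const) auto
    have pw: "Z u \<bullet> \<beta> \<tau> \<le> - w * \<gamma> \<tau> + K\<^sup>2 * (v - u)" if \<tau>: "\<tau> \<in> {u..v}" for \<tau>
    proof -
      have "Z u \<bullet> \<beta> \<tau> = Z \<tau> \<bullet> \<beta> \<tau> + (Z u - Z \<tau>) \<bullet> \<beta> \<tau>"
        by (simp add: inner_diff_left)
      also have "(Z u - Z \<tau>) \<bullet> \<beta> \<tau> \<le> norm (Z u - Z \<tau>) * norm (\<beta> \<tau>)"
        by (rule norm_cauchy_schwarz)
      also have "\<dots> \<le> (K * (v - u)) * K"
        using Z_lipschitz[of u \<tau>] \<beta>_bound[of \<tau>] \<tau> uv st K_nonneg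
        by (intro mult_mono order_trans[OF _ mult_left_mono[of "\<tau> - u" "v - u" K]])
          (auto simp: norm_minus_commute)
      finally show ?thesis
        using w[of \<tau>] \<tau> uv by (simp add: power2_eq_square mult_ac)
    qed
    have h1: "Z u \<bullet> (Z v - Z u) \<le> - w * integral {u..v} \<gamma> + K\<^sup>2 * (v - u)\<^sup>2"
      using has_integral_le[OF 1 2 pw] by (simp add: power2_eq_square mult_ac)
    have h2: "(norm (Z v))\<^sup>2 = (norm (Z u))\<^sup>2 + 2 * (Z u \<bullet> (Z v - Z u)) + (norm (Z v - Z u))\<^sup>2"
      by (simp add: power2_norm_eq_inner inner_diff_left inner_diff_right inner_commute)
    have "(norm (Z v - Z u))\<^sup>2 \<le> (K * (v - u))\<^sup>2"
      using Z_lipschitz[of u v] uv st by (intro power_mono) auto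
    then have h3: "(norm (Z v - Z u))\<^sup>2 \<le> K\<^sup>2 * (v - u)\<^sup>2"
      by (simp only: power_mult_distrib)
    have h4: "2 * w * integral {s..v} \<gamma> - 2 * w * integral {s..u} \<gamma> = 2 * (w * integral {u..v} \<gamma>)"
      unfolding right_diff_distrib[symmetric] using integral_\<gamma>_combine[of s u v] uv st by simp
    have h5: "(3 * K\<^sup>2 * v - 3 * K\<^sup>2 * u) * (v - u) = 3 * (K\<^sup>2 * (v - u)\<^sup>2)"
      by (simp only: power2_eq_square) (simp only: algebra_simps)
    show "2 * w * integral {s..v} \<gamma> - 2 * w * integral {s..u} \<gamma> - (3 * K\<^sup>2 * v - 3 * K\<^sup>2 * u) * (v - u)
        \<le> - (norm (Z v))\<^sup>2 - - (norm (Z u))\<^sup>2"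
      unfolding h4 h5 using h1 h2 h3 by linarith
  qed
  then show ?thesis by simp
qed

lemma norm_Z_antimono:
  assumes "0 \<le> s" "s \<le> t" "t \<le> T"
  shows "norm (Z t) \<le> norm (Z s)"
proof -
  have "Z \<tau> \<bullet> \<beta> \<tau> \<le> 0" if "0 \<le> \<tau>" "\<tau> \<le> T" for \<tau>
  proof (cases "Z \<tau> = 0")
    case False
    have "left_slope f (norm (Z \<tau>)) * (Z \<tau> \<bullet> \<beta> \<tau>) \<le> - \<gamma> \<tau> * norm (Z \<tau>) * \<psi> (f (norm (Z \<tau>)))"
      using dissipation that False by auto
    also have "\<dots> \<le> 0"
      using \<gamma>_nonneg[of \<tau>] \<psi>_pos[OF f_pos[of "norm (Z \<tau>)"]] False by (simp add: mult_le_0_iff)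
    finally show ?thesis
      using slope_pos[of "norm (Z \<tau>)"] False by (simp add: mult_le_0_iff)
  qed simp
  then have "2 * 0 * integral {s..t} \<gamma> \<le> (norm (Z s))\<^sup>2 - (norm (Z t))\<^sup>2"
    using assms by (intro energy_decay) auto
  then show ?thesis
    using power2_le_imp_le[of "norm (Z t)" "norm (Z s)"] by simp
qed

text \<open>Along the path the distance and \<open>\<psi> (f r)\<close> do not increase while the
  left slope does not decrease, so end point values control the whole interval; the two leading
  ratios are the price. Concavity finally converts a loss of distance into a loss of
  \<open>f\<close>.\<close>

lemma distance_decay:
  assumes st: "0 \<le> s" "s \<le> t" "t \<le> T" and pos: "Z t \<noteq> 0"
  shows "norm (Z t) / norm (Z s) * (left_slope f (norm (Z s)) / left_slope f (norm (Z t)))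
      * \<psi> (f (norm (Z t))) * integral {s..t} \<gamma> \<le> f (norm (Z s)) - f (norm (Z t))"
proof -
  define r where "r \<tau> = norm (Z \<tau>)" for \<tau>
  define a where "a = integral {s..t} \<gamma>"
  \<comment> \<open>The least value of \<open>r * \<psi> (f r) / left_slope f r\<close> on the
    interval, attained at \<open>t\<close>, where the distance is smallest.\<close>
  define w where "w = r t * \<psi> (f (r t)) / left_slope f (r t)"
  have anti: "r v \<le> r u" if "0 \<le> u" "u \<le> v" "v \<le> T" for u v
    using norm_Z_antimono that by (simp add: r_def)
  have rt: "0 < r t" using pos by (simp add: r_def)
  have rs: "r t \<le> r s" using anti st by simp
  have w: "0 \<le> w"
    using rt slope_pos[OF rt] \<psi>_pos[OF f_pos[OF rt]] by (simp add: w_def)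
  have a: "0 \<le> a" using integral_\<gamma>_nonneg st by (simp add: a_def)
  have "2 * w * a \<le> (r s)\<^sup>2 - (r t)\<^sup>2"
    unfolding a_def r_def
  proof (rule energy_decay[OF st])
    fix \<tau> assume \<tau>: "s \<le> \<tau>" "\<tau> \<le> t"
    have rt\<tau>: "r t \<le> r \<tau>" using anti[of \<tau> t] \<tau> st by simp
    with rt have r\<tau>: "0 < r \<tau>" by simp
    have "left_slope f (r \<tau>) * (Z \<tau> \<bullet> \<beta> \<tau>) \<le> - \<gamma> \<tau> * r \<tau> * \<psi> (f (r \<tau>))"
      unfolding r_def using dissipation[of \<tau>] \<tau> st r\<tau> by (auto simp: r_def)
    also have "\<dots> = - (\<gamma> \<tau> * (r \<tau> * \<psi> (f (r \<tau>))))" by simp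
    also have "\<dots> \<le> - (\<gamma> \<tau> * (left_slope f (r \<tau>) * w))"
    proof -
      have "left_slope f (r \<tau>) * w \<le> left_slope f (r t) * w"
        using left_slope_antimono[OF rt rt\<tau>] w by (rule mult_right_mono)
      also have "\<dots> = r t * \<psi> (f (r t))"
        using slope_pos[OF rt] by (simp add: w_def)
      also have "\<dots> \<le> r \<tau> * \<psi> (f (r \<tau>))"
        using rt rt\<tau> f_mono[of "r t" "r \<tau>"] f_pos[OF rt] \<psi>_pos[OF f_pos[OF rt]]
        by (intro mult_mono \<psi>_mono) auto
      finally show ?thesis
        using \<gamma>_nonneg[of \<tau>] by (simp add: mult_left_mono)
    qed
    also have "\<dots> = left_slope f (r \<tau>) * (- w * \<gamma> \<tau>)" by simp
    finally show "Z \<tau> \<bullet> \<beta> \<tau> \<le> - w * \<gamma> \<tau>"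
      using slope_pos[OF r\<tau>] by (simp only: mult_le_cancel_left_pos)
  qed
  also have "\<dots> = (r s + r t) * (r s - r t)"
    by (simp add: power2_eq_square algebra_simps)
  also have "\<dots> \<le> (2 * r s) * (r s - r t)"
    using rs rt by (intro mult_right_mono) auto
  finally have "w * a \<le> r s * (r s - r t)" by simp
  then have "w * a / r s \<le> r s - r t"
    using rs rt by (simp add: field_simps)
  then have "left_slope f (r s) * (w * a / r s) \<le> left_slope f (r s) * (r s - r t)"
    using slope_pos[of "r s"] rs rt by (intro mult_left_mono) auto
  also have "\<dots> \<le> f (r s) - f (r t)"
    using diff_ge_left_slope[of "r t" "r s"] rt rs by simp
  finally show ?thesis
    unfolding r_def[symmetric] a_def[symmetric] by (simp add: w_def mult_ac)
qed

text \<open>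
  The ratios \<open>\<rho>1\<close>, \<open>\<rho>2\<close>, \<open>\<rho>3\<close> need not be uniformly close to \<open>1\<close> on a fine partition, as the left slope may
  jump; but their deficits are bounded by the increments of the single function \<open>m\<close>, which telescope.
\<close>
theorem path_contraction:
  assumes \<epsilon>: "0 < \<epsilon>" "\<epsilon> \<le> f (norm (Z T))"
    and F: "\<And>v w. \<epsilon> \<le> v \<Longrightarrow> v \<le> w \<Longrightarrow> (w - v) / \<psi> w \<le> F v - F w"
  shows "integral {0..T} \<gamma> \<le> F (f (norm (Z T))) - F (f (norm (Z 0)))"
proof -
  define r where "r \<tau> = norm (Z \<tau>)" for \<tau>
  define y where "y \<tau> = f (r \<tau>)" for \<tau>
  define D where "D \<tau> = left_slope f (r \<tau>)" for \<tau>
  \<comment> \<open>Nondecreasing in \<open>t\<close>: \<open>D\<close> grows while \<open>r\<close>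
    and \<open>\<psi> (y t)\<close> shrink. The factor \<open>G\<close> bounds the clock per unit of
    time, which multiplies the deficits.\<close>
  define m where "m t = G * (D t / D 0 - r t / r T - \<psi> (y t) / \<psi> \<epsilon>)" for t
  have rT: "0 < r T"
    using \<epsilon> f_zero by (cases "Z T = 0") (auto simp: r_def)
  have anti: "r v \<le> r u" if "0 \<le> u" "u \<le> v" "v \<le> T" for u v
    using norm_Z_antimono that by (simp add: r_def)
  have rpos: "0 < r u" if "0 \<le> u" "u \<le> T" for u
    using anti[of u T] rT that by simp
  have Dpos: "0 < D u" if "0 \<le> u" "u \<le> T" for u
    using slope_pos[OF rpos] that by (simp add: D_def)
  have Dmono: "D u \<le> D v" if "0 \<le> u" "u \<le> v" "v \<le> T" for u v
    using left_slope_antimono[OF rpos anti] that by (simp add: D_def)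
  have yanti: "y v \<le> y u" if "0 \<le> u" "u \<le> v" "v \<le> T" for u v
    unfolding y_def using anti rpos[of v] that by (intro f_mono) auto
  have y\<epsilon>: "\<epsilon> \<le> y u" if "0 \<le> u" "u \<le> T" for u
    using yanti[of u T] \<epsilon> that by (simp add: y_def r_def)
  have \<psi>\<epsilon>: "\<psi> \<epsilon> \<le> \<psi> (y u)" if "0 \<le> u" "u \<le> T" for u
    using \<epsilon> y\<epsilon>[OF that] by (intro \<psi>_mono) auto
  have \<psi>\<epsilon>0: "0 < \<psi> \<epsilon>" using \<psi>_pos \<epsilon> by simp
  have "integral {0..T} \<gamma> - integral {0..0} \<gamma> \<le> F (y T) - F (y 0)"
  proof (rule partition_increment_le[where m=m, OF T])
    fix s t assume st: "0 \<le> s" "s \<le> t" "t \<le> T"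
    define a where "a = integral {s..t} \<gamma>"
    have a: "0 \<le> a" "a \<le> G * (t - s)"
      using integral_\<gamma>_nonneg integral_\<gamma>_le st by (auto simp: a_def)
    define \<rho>1 \<rho>2 \<rho>3 where "\<rho>1 = r t / r s" and "\<rho>2 = D s / D t" and "\<rho>3 = \<psi> (y t) / \<psi> (y s)"
    have \<psi>s: "0 < \<psi> (y s)" "0 < \<psi> (y t)"
      using \<psi>\<epsilon>0 \<psi>\<epsilon>[of s] \<psi>\<epsilon>[of t] st by auto
    have \<psi>le: "\<psi> (y t) \<le> \<psi> (y s)"
      using yanti[of s t] y\<epsilon>[of t] \<epsilon> st by (intro \<psi>_mono) auto
    have \<rho>1: "0 \<le> \<rho>1" "\<rho>1 \<le> 1" "1 - \<rho>1 \<le> (r s - r t) / r T"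
    proof -
      have "1 - \<rho>1 = (r s - r t) / r s"
        using rpos[of s] st by (simp add: \<rho>1_def diff_divide_distrib)
      also have "\<dots> \<le> (r s - r t) / r T"
        using anti[of s t] anti[of s T] rT st by (intro divide_left_mono) auto
      finally show "1 - \<rho>1 \<le> (r s - r t) / r T" .
    qed (use rpos[of s] rpos[of t] anti[of s t] st in \<open>auto simp: \<rho>1_def\<close>)
    have \<rho>2: "0 \<le> \<rho>2" "\<rho>2 \<le> 1" "1 - \<rho>2 \<le> (D t - D s) / D 0"
    proof -
      have "1 - \<rho>2 = (D t - D s) / D t"
        using Dpos[of t] st by (simp add: \<rho>2_def diff_divide_distrib)
      also have "\<dots> \<le> (D t - D s) / D 0"
        using Dmono[of s t] Dmono[of 0 t] Dpos[of 0] T st by (intro divide_left_mono) auto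
      finally show "1 - \<rho>2 \<le> (D t - D s) / D 0" .
    qed (use Dpos[of s] Dpos[of t] Dmono[of s t] st in \<open>auto simp: \<rho>2_def\<close>)
    have \<rho>3: "0 \<le> \<rho>3" "\<rho>3 \<le> 1" "1 - \<rho>3 \<le> (\<psi> (y s) - \<psi> (y t)) / \<psi> \<epsilon>"
    proof -
      have "1 - \<rho>3 = (\<psi> (y s) - \<psi> (y t)) / \<psi> (y s)"
        using \<psi>s by (simp add: \<rho>3_def diff_divide_distrib)
      also have "\<dots> \<le> (\<psi> (y s) - \<psi> (y t)) / \<psi> \<epsilon>"
        using \<psi>le \<psi>s \<psi>\<epsilon>[of s] \<psi>\<epsilon>0 st by (intro divide_left_mono) auto
      finally show "1 - \<rho>3 \<le> (\<psi> (y s) - \<psi> (y t)) / \<psi> \<epsilon>" .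
    qed (use \<psi>s \<psi>le in \<open>auto simp: \<rho>3_def\<close>)
    have p12: "0 \<le> \<rho>1 * \<rho>2" "\<rho>1 * \<rho>2 \<le> 1" "\<rho>1 + \<rho>2 - 1 \<le> \<rho>1 * \<rho>2"
      using \<rho>1 \<rho>2 mult_nonneg_nonneg[of "1 - \<rho>1" "1 - \<rho>2"] by (auto simp: mult_le_one algebra_simps)
    have "\<rho>1 * \<rho>2 + \<rho>3 - 1 \<le> \<rho>1 * \<rho>2 * \<rho>3"
      using p12 \<rho>3 mult_nonneg_nonneg[of "1 - \<rho>1 * \<rho>2" "1 - \<rho>3"] by (auto simp: algebra_simps)
    then have loss: "1 - \<rho>1 * \<rho>2 * \<rho>3 \<le> (r s - r t) / r T + (D t - D s) / D 0 + (\<psi> (y s) - \<psi> (y t)) / \<psi> \<epsilon>"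
      using \<rho>1 \<rho>2 \<rho>3 p12 by linarith
    have "(1 - \<rho>1 * \<rho>2 * \<rho>3) * a \<le> (1 - \<rho>1 * \<rho>2 * \<rho>3) * (G * (t - s))"
      using a p12 \<rho>3 by (intro mult_left_mono) (auto simp: mult_le_one)
    also have "\<dots> \<le> ((r s - r t) / r T + (D t - D s) / D 0 + (\<psi> (y s) - \<psi> (y t)) / \<psi> \<epsilon>) * (G * (t - s))"
      using loss G_nonneg st by (intro mult_right_mono) auto
    also have "\<dots> = (m t - m s) * (t - s)"
      by (simp add: m_def algebra_simps diff_divide_distrib)
    finally have "a - (m t - m s) * (t - s) \<le> \<rho>1 * \<rho>2 * \<rho>3 * a"
      by (simp add: algebra_simps)
    also have "\<dots> = (\<rho>1 * \<rho>2 * \<psi> (y t) * a) / \<psi> (y s)"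
      by (simp add: \<rho>3_def)
    also have "\<dots> \<le> (y s - y t) / \<psi> (y s)"
      using distance_decay[OF st] rpos[of t] st \<psi>s
      by (intro divide_right_mono) (auto simp: \<rho>1_def \<rho>2_def r_def y_def D_def a_def)
    also have "\<dots> \<le> F (y t) - F (y s)"
      using yanti y\<epsilon> st by (intro F) auto
    finally show "integral {0..t} \<gamma> - integral {0..s} \<gamma> - (m t - m s) * (t - s) \<le> F (y t) - F (y s)"
      using integral_\<gamma>_combine[of 0 s t] st by (simp add: a_def)
  qed
  then show ?thesis by (simp add: y_def r_def)
qed

text \<open>Above the level \<open>\<epsilon>\<close> one has \<open>\<psi>\<close> at least
  \<open>\<psi> \<epsilon>\<close>, so the linear function \<open>- v / \<psi> \<epsilon>\<close>
  can serve as \<open>F\<close>. This serves the convergence without rate.\<close>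

corollary contraction_general:
  assumes "0 < \<epsilon>" "\<epsilon> \<le> f (norm (Z T))"
  shows "\<psi> \<epsilon> * integral {0..T} \<gamma> \<le> f (norm (Z 0))"
proof -
  have \<psi>\<epsilon>: "0 < \<psi> \<epsilon>" using assms \<psi>_pos by simp
  have "integral {0..T} \<gamma> \<le> - f (norm (Z T)) / \<psi> \<epsilon> - - f (norm (Z 0)) / \<psi> \<epsilon>"
  proof (rule path_contraction[OF assms])
    fix v w assume vw: "\<epsilon> \<le> v" "v \<le> w"
    have "(w - v) / \<psi> w \<le> (w - v) / \<psi> \<epsilon>"
      using vw assms \<psi>\<epsilon> \<psi>_mono[of \<epsilon> w] by (intro divide_left_mono) auto
    then show "(w - v) / \<psi> w \<le> - v / \<psi> \<epsilon> - - w / \<psi> \<epsilon>"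
      by (simp add: diff_divide_distrib)
  qed
  also have "\<dots> \<le> f (norm (Z 0)) / \<psi> \<epsilon>"
    using \<psi>\<epsilon> f_nonneg[of "norm (Z T)"] by simp
  finally show ?thesis using \<psi>\<epsilon> by (simp add: field_simps)
qed

text \<open>\<open>F\<close> is an antiderivative of \<open>- 1 / \<psi>\<close>, and
  \<open>path_contraction\<close> asks only for a lower Riemann sum of its differences. Dropping the
  term at time 0 makes the bound independent of the starting points.\<close>

corollary contraction_power:
  assumes q: "1 < q" and \<psi>: "\<And>u. 0 \<le> u \<Longrightarrow> \<psi> u = u powr q" and pos: "0 < f (norm (Z T))"
  shows "(q - 1) * integral {0..T} \<gamma> \<le> f (norm (Z T)) powr (1 - q)"
proof -
  define F where "F v = v powr (1 - q) / (q - 1)" for v :: real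
  have "integral {0..T} \<gamma> \<le> F (f (norm (Z T))) - F (f (norm (Z 0)))"
  proof (rule path_contraction[OF pos order_refl])
    fix v w assume vw: "f (norm (Z T)) \<le> v" "v \<le> w"
    have deriv: "DERIV F x :> - (x powr (- q))" if "v \<le> x" for x
    proof -
      have "DERIV F x :> ((1 - q) * x powr (1 - q - 1)) / (q - 1)"
        unfolding F_def using that vw pos by (intro DERIV_cdivide has_real_derivative_powr) auto
      moreover have "((1 - q) * x powr (1 - q - 1)) / (q - 1) = - (x powr (- q))"
        using q by (simp add: field_simps)
      ultimately show ?thesis by simp
    qed
    show "(w - v) / \<psi> w \<le> F v - F w"
    proof (cases "v = w")
      case False
      have "\<exists>z>v. z < w \<and> F w - F v = (w - v) * - (z powr (- q))"
        using False vw by (intro MVT2 deriv) auto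
      then obtain z where z: "v < z" "z < w" "F v - F w = (w - v) * z powr (- q)"
        by (metis minus_diff_eq minus_mult_right minus_minus)
      have "w powr (- q) \<le> z powr (- q)"
        using z vw pos q by (intro powr_mono2') auto
      then have "(w - v) * w powr (- q) \<le> F v - F w"
        unfolding z using vw by (intro mult_left_mono) auto
      then show ?thesis
        using vw pos by (subst \<psi>) (auto simp: powr_minus divide_inverse)
    qed simp
  qed
  also have "\<dots> \<le> F (f (norm (Z T)))"
    using q by (simp add: F_def)
  finally show ?thesis
    using q by (simp add: F_def field_simps)
qed

text \<open>Here the antiderivative is \<open>- ln v / \<kappa>\<close>, and
  \<open>ln x \<le> x - 1\<close> is the required comparison.\<close>

corollary contraction_linear:
  assumes \<kappa>: "0 < \<kappa>" and \<psi>: "\<And>u. 0 \<le> u \<Longrightarrow> \<psi> u = \<kappa> * u"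
  shows "f (norm (Z T)) \<le> f (norm (Z 0)) * exp (- \<kappa> * integral {0..T} \<gamma>)"
proof (cases "f (norm (Z T)) = 0")
  case False
  then have pos: "0 < f (norm (Z T))" using f_nonneg[of "norm (Z T)"] by simp
  have le: "f (norm (Z T)) \<le> f (norm (Z 0))"
    using norm_Z_antimono[of 0 T] T by (intro f_mono) auto
  have "integral {0..T} \<gamma> \<le> - ln (f (norm (Z T))) / \<kappa> - - ln (f (norm (Z 0))) / \<kappa>"
  proof (rule path_contraction[OF pos order_refl])
    fix v w assume vw: "f (norm (Z T)) \<le> v" "v \<le> w"
    then have p: "0 < v" "0 < w" using pos by auto
    have "ln (v / w) \<le> v / w - 1"
      using p by (intro ln_le_minus_one) auto
    then have "(w - v) / w \<le> ln w - ln v"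
      using p by (simp add: ln_div diff_divide_distrib)
    then have "(w - v) / w / \<kappa> \<le> (ln w - ln v) / \<kappa>"
      using \<kappa> by (intro divide_right_mono) auto
    then show "(w - v) / \<psi> w \<le> - ln v / \<kappa> - - ln w / \<kappa>"
      using \<psi>[of w] p by (simp add: diff_divide_distrib mult.commute)
  qed
  then have "ln (f (norm (Z T))) \<le> ln (f (norm (Z 0))) - \<kappa> * integral {0..T} \<gamma>"
    using \<kappa> by (simp add: field_simps)
  then have "exp (ln (f (norm (Z T)))) \<le> exp (ln (f (norm (Z 0))) + - \<kappa> * integral {0..T} \<gamma>)"
    by simp
  then show ?thesis
    using pos le by (simp only: exp_add exp_ln)
qed (use f_nonneg in simp)

end

section \<open>The difference of two solutions\<close>

lemma approximates_cong:
  assumes "approximates M F \<phi> S" and eq: "\<And>s \<omega>. 0 \<le> s \<Longrightarrow> \<omega> \<in> space M \<Longrightarrow> \<phi> s \<omega> = \<phi>' s \<omega>"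
  shows "approximates M F \<phi>' S"
proof -
  have "{\<omega> \<in> space M. ennreal \<epsilon> < (\<integral>\<^sup>+s\<in>{0..T}. ennreal ((hs_norm (simple_val (S k) s \<omega> - \<phi> s \<omega>))\<^sup>2) \<partial>lborel)}
    = {\<omega> \<in> space M. ennreal \<epsilon> < (\<integral>\<^sup>+s\<in>{0..T}. ennreal ((hs_norm (simple_val (S k) s \<omega> - \<phi>' s \<omega>))\<^sup>2) \<partial>lborel)}"
    for \<epsilon> T k
  proof (intro Collect_cong conj_cong refl)
    fix \<omega> assume \<omega>: "\<omega> \<in> space M"
    have "(\<integral>\<^sup>+s\<in>{0..T}. ennreal ((hs_norm (simple_val (S k) s \<omega> - \<phi> s \<omega>))\<^sup>2) \<partial>lborel)
      = (\<integral>\<^sup>+s\<in>{0..T}. ennreal ((hs_norm (simple_val (S k) s \<omega> - \<phi>' s \<omega>))\<^sup>2) \<partial>lborel)"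
      using eq[OF _ \<omega>] by (intro nn_integral_cong) (auto simp: indicator_def)
    then show "(ennreal \<epsilon> < (\<integral>\<^sup>+s\<in>{0..T}. ennreal ((hs_norm (simple_val (S k) s \<omega> - \<phi> s \<omega>))\<^sup>2) \<partial>lborel)) =
      (ennreal \<epsilon> < (\<integral>\<^sup>+s\<in>{0..T}. ennreal ((hs_norm (simple_val (S k) s \<omega> - \<phi>' s \<omega>))\<^sup>2) \<partial>lborel))"
      by (simp only:)
  qed
  then show ?thesis
    using assms(1) unfolding approximates_def by simp
qed

text \<open>By continuity a countable dense set of times suffices. Measurability cannot be skipped:
  \<open>measure\<close> has the default value 0 off the sigma-algebra, so a vanishing measure alone
  would say nothing.\<close>

lemma sets_exceeds_on_compact:
  fixes h :: "real \<Rightarrow> 'w \<Rightarrow> real"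
  assumes meas: "\<And>t. t \<in> {0..T} \<Longrightarrow> h t \<in> borel_measurable M"
    and cont: "\<And>\<omega>. \<omega> \<in> space M \<Longrightarrow> continuous_on {0..T} (\<lambda>t. h t \<omega>)"
  shows "{\<omega>\<in>space M. \<exists>t\<in>{0..T}. \<epsilon> < h t \<omega>} \<in> sets M"
proof -
  obtain D where D: "countable D" "D \<subseteq> {0..T}" "{0..T} \<subseteq> closure D"
    using separable[of "{0..T}"] by blast
  have "{\<omega>\<in>space M. \<exists>t\<in>{0..T}. \<epsilon> < h t \<omega>} = {\<omega>\<in>space M. \<exists>t\<in>D. \<epsilon> < h t \<omega>}"
  proof (intro Collect_cong conj_cong refl iffI)
    fix \<omega> assume \<omega>: "\<omega> \<in> space M" and "\<exists>t\<in>{0..T}. \<epsilon> < h t \<omega>"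
    then obtain t where t: "t \<in> {0..T}" "\<epsilon> < h t \<omega>" by blast
    obtain x where x: "\<And>n. x n \<in> D" "x \<longlonglongrightarrow> t"
      using closure_sequential[of t D] t(1) D(3) by blast
    have "x n \<in> {0..T}" for n using x(1) D(2) by blast
    then have "(\<lambda>n. h (x n) \<omega>) \<longlonglongrightarrow> h t \<omega>"
      by (intro continuous_on_tendsto_compose[OF cont[OF \<omega>] x(2) t(1)] always_eventually) auto
    from order_tendstoD(1)[OF this t(2)] obtain n where "\<epsilon> < h (x n) \<omega>"
      by (auto simp: eventually_sequentially)
    with x(1) show "\<exists>t\<in>D. \<epsilon> < h t \<omega>" by blast
  qed (use D in auto)
  also have "\<dots> = (\<Union>t\<in>D. {\<omega>\<in>space M. \<epsilon> < h t \<omega>})" by auto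
  also have "\<dots> \<in> sets M"
    using D meas by (intro sets.countable_UN' borel_measurable_less) auto
  finally show ?thesis .
qed

lemma continuous_on_matrix_vector_mult:
  fixes f :: "'a::topological_space \<Rightarrow> real ^ 'n ^ 'd"
  assumes "continuous_on S f" "continuous_on S g"
  shows "continuous_on S (\<lambda>x. f x *v g x)"
  unfolding matrix_vector_mult_def
  using assms by (intro continuous_intros)

context stochastic_basis
begin

lemma measurable_adapted: "adapted F N Z \<Longrightarrow> 0 \<le> t \<Longrightarrow> Z t \<in> M \<rightarrow>\<^sub>M N"
  unfolding adapted_def using subalg by (blast intro: measurable_from_subalg)

lemma measurable_simple_int:
  fixes B :: "real \<Rightarrow> 'w \<Rightarrow> real ^ 'n" and S :: "('w, real ^ 'n ^ 'd) simple_proc"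
  assumes B: "adapted F borel B" and S: "is_simple_proc M F S" and t: "0 \<le> t"
  shows "simple_int B S t \<in> borel_measurable M"
proof -
  obtain m \<tau> \<xi> where S_eq: "S = (m, \<tau>, \<xi>)" by (cases S) auto
  have \<tau>: "0 \<le> \<tau> k" for k
    using S unfolding S_eq is_simple_proc_def by (auto simp: mono_def intro: order_trans[of 0 "\<tau> 0" "\<tau> k"])
  have [measurable]: "B (min t (\<tau> k)) \<in> borel_measurable M" for k
    using measurable_adapted[OF B] t \<tau> by simp
  have \<xi>: "\<xi> k \<in> borel_measurable M" if "k < m" for k
    using S that unfolding S_eq is_simple_proc_def by (auto intro: measurable_from_subalg[OF subalg])
  have "(\<lambda>\<omega>. \<xi> k \<omega> *v (B (min t (\<tau> (Suc k))) \<omega> - B (min t (\<tau> k)) \<omega>)) \<in> borel_measurable M" if "k < m" for k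
    using \<xi>[OF that]
    by (intro borel_measurable_continuous_Pair[where H="\<lambda>A x. A *v x"]
        continuous_on_matrix_vector_mult continuous_intros) auto
  then show ?thesis
    unfolding S_eq simple_int_def by (auto intro!: borel_measurable_sum)
qed

lemma continuous_simple_int:
  fixes B :: "real \<Rightarrow> 'w \<Rightarrow> real ^ 'n" and S :: "('w, real ^ 'n ^ 'd) simple_proc"
  assumes B: "continuous_on {0..} (\<lambda>t. B t \<omega>)" and S: "is_simple_proc M F S"
  shows "continuous_on {0..} (\<lambda>t. simple_int B S t \<omega>)"
proof -
  obtain m \<tau> \<xi> where S_eq: "S = (m, \<tau>, \<xi>)" by (cases S) auto
  have \<tau>: "0 \<le> \<tau> k" for k
    using S unfolding S_eq is_simple_proc_def by (auto simp: mono_def intro: order_trans[of 0 "\<tau> 0" "\<tau> k"])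
  have "continuous_on {0..} (\<lambda>t. B (min t (\<tau> k)) \<omega>)" for k
    using \<tau>[of k] by (intro continuous_on_compose2[OF B] continuous_intros) auto
  then show ?thesis
    unfolding S_eq simple_int_def by (auto intro!: continuous_intros continuous_on_matrix_vector_mult)
qed

text \<open>Both processes are limits, uniform on compacts in probability, of the same simple
  integrals, since a sequence approximating \<open>\<phi>\<close> also approximates
  \<open>\<phi>'\<close>. The integrands need to agree only where those of two solutions do: at
  nonnegative times and on \<open>space M\<close>.\<close>

lemma ito_integral_unique:
  fixes B :: "real \<Rightarrow> 'w \<Rightarrow> real ^ 'n" and I I' :: "real \<Rightarrow> 'w \<Rightarrow> real ^ 'd"
  assumes bm: "brownian_motion M F B"
    and I: "ito_integral M F B \<phi> I" and I': "ito_integral M F B \<phi>' I'"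
    and eq: "\<And>s \<omega>. 0 \<le> s \<Longrightarrow> \<omega> \<in> space M \<Longrightarrow> \<phi> s \<omega> = \<phi>' s \<omega>"
  shows "AE \<omega> in M. \<forall>t\<ge>0. I t \<omega> = I' t \<omega>"
proof -
  obtain S where S: "approximates M F \<phi> S"
    using I unfolding ito_integral_def by blast
  have S': "approximates M F \<phi>' S"
    using S eq by (rule approximates_cong)
  have simple: "is_simple_proc M F (S k)" for k
    using S unfolding approximates_def by blast
  have Bad: "adapted F borel B" and Bc: "\<And>\<omega>. \<omega> \<in> space M \<Longrightarrow> continuous_on {0..} (\<lambda>t. B t \<omega>)"
    using bm unfolding brownian_motion_def by auto
  have Iad: "adapted F borel I" "adapted F borel I'"
    and Ic: "\<And>\<omega>. \<omega> \<in> space M \<Longrightarrow> continuous_on {0..} (\<lambda>t. I t \<omega>)"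
      "\<And>\<omega>. \<omega> \<in> space M \<Longrightarrow> continuous_on {0..} (\<lambda>t. I' t \<omega>)"
    using I I' unfolding ito_integral_def by auto
  define A where "A J T \<epsilon> k = {\<omega> \<in> space M. \<exists>t\<in>{0..T}. \<epsilon> < norm (simple_int B (S k) t \<omega> - J t \<omega>)}" for J T \<epsilon> k
  have A: "A J T \<epsilon> k \<in> sets M" if "J = I \<or> J = I'" for J T \<epsilon> k
    unfolding A_def using that measurable_adapted[OF Iad(1)] measurable_adapted[OF Iad(2)]
      measurable_simple_int[OF Bad simple]
      continuous_on_subset[OF continuous_simple_int[OF Bc simple]] continuous_on_subset[OF Ic(1)]
      continuous_on_subset[OF Ic(2)]
    by (intro sets_exceeds_on_compact borel_measurable_norm borel_measurable_diff continuous_intros) auto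
  have null: "measure M {\<omega> \<in> space M. \<exists>t\<in>{0..T}. \<epsilon> + \<epsilon> < norm (I t \<omega> - I' t \<omega>)} = 0"
    (is "measure M ?D = 0") if "0 \<le> T" "0 < \<epsilon>" for T \<epsilon>
  proof -
    have "(\<lambda>k. measure M (A I T \<epsilon> k)) \<longlonglongrightarrow> 0" "(\<lambda>k. measure M (A I' T \<epsilon> k)) \<longlonglongrightarrow> 0"
      using I I' S S' that unfolding ito_integral_def A_def by blast+
    then have lim: "(\<lambda>k. measure M (A I T \<epsilon> k) + measure M (A I' T \<epsilon> k)) \<longlonglongrightarrow> 0 + 0"
      by (rule tendsto_add)
    have le: "measure M ?D \<le> measure M (A I T \<epsilon> k) + measure M (A I' T \<epsilon> k)" for k
    proof -
      have "?D \<subseteq> A I T \<epsilon> k \<union> A I' T \<epsilon> k"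
      proof
        fix \<omega> assume "\<omega> \<in> ?D"
        then obtain t where t: "\<omega> \<in> space M" "t \<in> {0..T}" "\<epsilon> + \<epsilon> < norm (I t \<omega> - I' t \<omega>)" by blast
        have "norm (I t \<omega> - I' t \<omega>) \<le> norm (simple_int B (S k) t \<omega> - I t \<omega>) + norm (simple_int B (S k) t \<omega> - I' t \<omega>)"
          using norm_triangle_ineq4[of "simple_int B (S k) t \<omega> - I' t \<omega>" "simple_int B (S k) t \<omega> - I t \<omega>"] by simp
        with t have "\<epsilon> < norm (simple_int B (S k) t \<omega> - I t \<omega>) \<or> \<epsilon> < norm (simple_int B (S k) t \<omega> - I' t \<omega>)"
          by linarith
        with t show "\<omega> \<in> A I T \<epsilon> k \<union> A I' T \<epsilon> k" unfolding A_def by blast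
      qed
      then have "measure M ?D \<le> measure M (A I T \<epsilon> k \<union> A I' T \<epsilon> k)"
        using A by (intro finite_measure_mono) auto
      also have "\<dots> \<le> measure M (A I T \<epsilon> k) + measure M (A I' T \<epsilon> k)"
        using A by (intro measure_Un_le) auto
      finally show ?thesis .
    qed
    have "measure M ?D \<le> 0 + 0"
      using le by (intro LIMSEQ_le_const[OF lim]) auto
    then show ?thesis using measure_nonneg[of M ?D] by linarith
  qed
  have "AE \<omega> in M. \<not> (\<exists>t\<in>{0..real m}. 1 / real (Suc n) + 1 / real (Suc n) < norm (I t \<omega> - I' t \<omega>))" for m n
  proof (rule AE_I')
    have "{\<omega> \<in> space M. \<exists>t\<in>{0..real m}. 1 / real (Suc n) + 1 / real (Suc n) < norm (I t \<omega> - I' t \<omega>)} \<in> sets M"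
      using measurable_adapted[OF Iad(1)] measurable_adapted[OF Iad(2)]
        continuous_on_subset[OF Ic(1)] continuous_on_subset[OF Ic(2)]
      by (intro sets_exceeds_on_compact borel_measurable_norm borel_measurable_diff continuous_intros) auto
    then show "{\<omega> \<in> space M. \<exists>t\<in>{0..real m}. 1 / real (Suc n) + 1 / real (Suc n) < norm (I t \<omega> - I' t \<omega>)} \<in> null_sets M"
      using null[of "real m" "1 / real (Suc n)"] by (auto simp: emeasure_eq_measure)
  qed auto
  then have "AE \<omega> in M. \<forall>m n. \<not> (\<exists>t\<in>{0..real m}. 1 / real (Suc n) + 1 / real (Suc n) < norm (I t \<omega> - I' t \<omega>))"
    by (simp add: AE_all_countable)
  then show ?thesis
  proof eventually_elim
    case (elim \<omega>)
    show ?case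
    proof (intro allI impI)
      fix t :: real assume t: "0 \<le> t"
      obtain m where m: "t \<le> real m" using real_arch_simple by blast
      have "norm (I t \<omega> - I' t \<omega>) \<le> 1 / real (Suc n) + 1 / real (Suc n)" for n
        using elim m t by (meson atLeastAtMost_iff not_less)
      moreover have "(\<lambda>n. 1 / real (Suc n) + 1 / real (Suc n)) \<longlonglongrightarrow> 0 + 0"
        by (intro tendsto_add LIMSEQ_Suc[OF lim_const_over_n])
      ultimately have "norm (I t \<omega> - I' t \<omega>) \<le> 0 + 0"
        by (intro LIMSEQ_le_const) auto
      then show "I t \<omega> = I' t \<omega>" by simp
    qed
  qed
qed

end

section \<open>Two solutions driven by the same noise\<close>

lemma hs_norm_nonneg: "0 \<le> hs_norm A"
  unfolding hs_norm_def trace_def matrix_matrix_mult_def transpose_def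
  by (auto intro!: sum_nonneg)

locale regime_diffusion = stochastic_basis M F
  for M :: "'w measure" and F :: "real \<Rightarrow> 'w measure" +
  fixes B :: "real \<Rightarrow> 'w \<Rightarrow> real ^ 'n"
    and b :: "real ^ 'd \<Rightarrow> 's::finite \<Rightarrow> real ^ 'd"
    and \<sigma> :: "real ^ 'd \<Rightarrow> 's \<Rightarrow> real ^ 'n ^ 'd"
    and X :: "real ^ 'd \<Rightarrow> 's \<Rightarrow> real \<Rightarrow> 'w \<Rightarrow> real ^ 'd"
    and \<Lambda> :: "real ^ 'd \<Rightarrow> 's \<Rightarrow> real \<Rightarrow> 'w \<Rightarrow> 's"
    and \<sigma>\<^sub>0 :: "'s \<Rightarrow> real ^ 'n ^ 'd"
    and \<Lambda>\<^sub>0 :: "'s \<Rightarrow> real \<Rightarrow> 'w \<Rightarrow> 's"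
  assumes bm: "brownian_motion M F B"
    and A1: "locally_bounded_coeffs b \<sigma>"
    and A2: "sde_well_posed M F B b \<sigma> X \<Lambda>"
    and A3: "strong_markov M F X \<Lambda>"
    and \<Lambda>_indep: "\<And>x i t \<omega>. 0 \<le> t \<Longrightarrow> \<omega> \<in> space M \<Longrightarrow> \<Lambda> x i t \<omega> = \<Lambda>\<^sub>0 i t \<omega>"
    and \<sigma>_indep: "\<And>x i. \<sigma> x i = \<sigma>\<^sub>0 i"
    and chain: "homogeneous_markov_chain M F \<Lambda>\<^sub>0"
begin

lemma solution: "strong_solution M F B b \<sigma> (\<Lambda> x i) x (X x i)"
  using A2 by (simp add: sde_well_posed_def)

lemma X_0: "\<omega> \<in> space M \<Longrightarrow> X x i 0 \<omega> = x"
  and continuous_X: "\<omega> \<in> space M \<Longrightarrow> continuous_on {0..} (\<lambda>t. X x i t \<omega>)"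
  using solution[of x i] by (auto simp: strong_solution_def)

lemma measurable_\<Lambda>\<^sub>0[measurable]: "0 \<le> t \<Longrightarrow> \<Lambda>\<^sub>0 i t \<in> M \<rightarrow>\<^sub>M count_space UNIV"
  using chain measurable_adapted by (auto simp: homogeneous_markov_chain_def switching_process_def)

lemma measurable_\<Lambda>: "0 \<le> t \<Longrightarrow> \<Lambda> x i t \<in> M \<rightarrow>\<^sub>M count_space UNIV"
  using measurable_\<Lambda>\<^sub>0[of t i] by (simp add: \<Lambda>_indep cong: measurable_cong)

lemma measurable_X[measurable]:
  assumes t: "0 \<le> t"
  shows "X x i t \<in> borel_measurable M"
proof -
  have "X x i t \<in> noise_algebra M B (\<Lambda> x i) t \<rightarrow>\<^sub>M borel"
    using solution[of x i] t by (simp add: strong_solution_def adapted_def)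
  moreover have "space (noise_algebra M B (\<Lambda> x i) t) = space M"
    unfolding noise_algebra_def by (intro space_measure_of) (auto dest: sets.sets_into_space)
  moreover have "sets (noise_algebra M B (\<Lambda> x i) t) \<subseteq> sets M"
  proof -
    have B: "B s -` A \<inter> space M \<in> sets M" if "0 \<le> s" "A \<in> sets borel" for s A
      using bm that by (auto simp: brownian_motion_def intro!: measurable_sets[OF measurable_adapted])
    have L: "\<Lambda> x i s -` A \<inter> space M \<in> sets M" if "0 \<le> s" for s A
      using measurable_\<Lambda>[OF that, of x i] by (rule measurable_sets) auto
    have sub: "{B s -` A \<inter> space M | s A. 0 \<le> s \<and> s \<le> t \<and> A \<in> sets borel} \<union>
      {\<Lambda> x i s -` A \<inter> space M | s A. 0 \<le> s \<and> s \<le> t} \<union> null_sets M \<subseteq> sets M"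
      using B L by auto
    then show ?thesis
      unfolding noise_algebra_def
      using sets.sigma_sets_subset[OF sub] order_trans[OF sub sets.space_closed]
      by (subst sets_measure_of) blast+
  qed
  ultimately show ?thesis
    by (auto simp: measurable_def)
qed

text \<open>The noise is additive, so it cancels in the difference of two solutions driven by the same chain.\<close>

lemma AE_difference:
  "AE \<omega> in M. \<forall>s t. 0 \<le> s \<longrightarrow> s \<le> t \<longrightarrow>
    ((\<lambda>\<tau>. b (X x i \<tau> \<omega>) (\<Lambda>\<^sub>0 i \<tau> \<omega>) - b (X y i \<tau> \<omega>) (\<Lambda>\<^sub>0 i \<tau> \<omega>)) has_integral
      ((X x i t \<omega> - X y i t \<omega>) - (X x i s \<omega> - X y i s \<omega>))) {s..t}"
proof -
  obtain I where I: "ito_integral M F B (\<lambda>s \<omega>. \<sigma> (X x i s \<omega>) (\<Lambda> x i s \<omega>)) I"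
    "AE \<omega> in M. \<forall>t\<ge>0. X x i t \<omega> = x + (LINT s:{0..t}|lborel. b (X x i s \<omega>) (\<Lambda> x i s \<omega>)) + I t \<omega>"
    using solution[of x i] unfolding strong_solution_def by blast
  obtain J where J: "ito_integral M F B (\<lambda>s \<omega>. \<sigma> (X y i s \<omega>) (\<Lambda> y i s \<omega>)) J"
    "AE \<omega> in M. \<forall>t\<ge>0. X y i t \<omega> = y + (LINT s:{0..t}|lborel. b (X y i s \<omega>) (\<Lambda> y i s \<omega>)) + J t \<omega>"
    using solution[of y i] unfolding strong_solution_def by blast
  have IJ: "AE \<omega> in M. \<forall>t\<ge>0. I t \<omega> = J t \<omega>"
    by (rule ito_integral_unique[OF bm I(1) J(1)]) (simp add: \<sigma>_indep \<Lambda>_indep)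
  have int: "AE \<omega> in M. \<forall>t\<ge>0. set_integrable lborel {0..t} (\<lambda>s. b (X z i s \<omega>) (\<Lambda> z i s \<omega>))" for z
    using solution[of z i] by (simp add: strong_solution_def)
  show ?thesis
    using I(2) J(2) IJ int[of x] int[of y] AE_space
  proof eventually_elim
    case (elim \<omega>)
    have *: "((\<lambda>\<tau>. b (X z i \<tau> \<omega>) (\<Lambda>\<^sub>0 i \<tau> \<omega>)) has_integral (LINT s:{0..t}|lborel. b (X z i s \<omega>) (\<Lambda> z i s \<omega>))) {0..t}"
      if "0 \<le> t" "z = x \<or> z = y" for z t
    proof -
      have si: "set_integrable lborel {0..t} (\<lambda>s. b (X z i s \<omega>) (\<Lambda> z i s \<omega>))"
        using elim that by auto
      have "((\<lambda>\<tau>. b (X z i \<tau> \<omega>) (\<Lambda> z i \<tau> \<omega>)) has_integral (LINT s:{0..t}|lborel. b (X z i s \<omega>) (\<Lambda> z i s \<omega>))) {0..t}"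
        using set_borel_integral_eq_integral[OF si] by (simp add: has_integral_integral)
      then show ?thesis
        by (rule has_integral_eq[rotated]) (use elim in \<open>auto simp: \<Lambda>_indep\<close>)
    qed
    define \<beta> where "\<beta> \<tau> = b (X x i \<tau> \<omega>) (\<Lambda>\<^sub>0 i \<tau> \<omega>) - b (X y i \<tau> \<omega>) (\<Lambda>\<^sub>0 i \<tau> \<omega>)" for \<tau>
    have 0: "(\<beta> has_integral (X x i t \<omega> - X y i t \<omega>) - (x - y)) {0..t}" if "0 \<le> t" for t
    proof -
      have "(X x i t \<omega> - X y i t \<omega>) - (x - y) = (LINT s:{0..t}|lborel. b (X x i s \<omega>) (\<Lambda> x i s \<omega>))
          - (LINT s:{0..t}|lborel. b (X y i s \<omega>) (\<Lambda> y i s \<omega>))"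
      proof -
        have "X x i t \<omega> = x + (LINT s:{0..t}|lborel. b (X x i s \<omega>) (\<Lambda> x i s \<omega>)) + I t \<omega>"
          "X y i t \<omega> = y + (LINT s:{0..t}|lborel. b (X y i s \<omega>) (\<Lambda> y i s \<omega>)) + I t \<omega>"
          using elim that by auto
        then show ?thesis by (simp only:) simp
      qed
      then show ?thesis
        unfolding \<beta>_def using has_integral_diff[OF *[OF that] *[OF that]] by auto
    qed
    have "(\<beta> has_integral (X x i t \<omega> - X y i t \<omega>) - (X x i s \<omega> - X y i s \<omega>)) {s..t}" if "0 \<le> s" "s \<le> t" for s t
    proof -
      have "\<beta> integrable_on {s..t}"
        using that by (intro integrable_on_subinterval[OF has_integral_integrable[OF 0[of t]]]) auto
      then have "(\<beta> has_integral ((X x i s \<omega> - X y i s \<omega>) - (x - y)) + integral {s..t} \<beta>) {0..t}"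
        using 0[of s] that by (intro has_integral_combine[of 0 s t] integrable_integral) auto
      then have "((X x i s \<omega> - X y i s \<omega>) - (x - y)) + integral {s..t} \<beta>
          = (X x i t \<omega> - X y i t \<omega>) - (x - y)"
        using 0[of t] that by (intro has_integral_unique[of \<beta> _ "{0..t}"]) auto
      then have "integral {s..t} \<beta> = (X x i t \<omega> - X y i t \<omega>) - (X x i s \<omega> - X y i s \<omega>)"
        by (simp add: algebra_simps)
      with integrable_integral[OF \<open>\<beta> integrable_on {s..t}\<close>] show ?thesis
        by (simp only:)
    qed
    then show ?case unfolding \<beta>_def by blast
  qed
qed

text \<open>The path up to \<open>T\<close> is compact, \<open>A1\<close> bounds the drift on a ball
  around it, and finitely many regimes leave a maximum. This supplies the Lipschitz constant of the
  difference of two solutions.\<close>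

lemma b_bounded_on_path:
  assumes \<omega>: "\<omega> \<in> space M"
  shows "\<exists>K. \<forall>t\<in>{0..T}. \<forall>j. norm (b (X x i t \<omega>) j) \<le> K"
proof -
  have c: "compact ((\<lambda>t. X x i t \<omega>) ` {0..T})"
    by (intro compact_continuous_image continuous_on_subset[OF continuous_X[OF \<omega>]]) auto
  then obtain r where r: "0 < r" "(\<lambda>t. X x i t \<omega>) ` {0..T} \<subseteq> ball 0 r"
    using bounded_subset_ballD[OF compact_imp_bounded[OF c], of 0] by metis
  have "\<exists>K. \<forall>z\<in>ball 0 r. norm (b z j) \<le> K" for j
  proof -
    have "bdd_above ((\<lambda>x. norm (b x j) + hs_norm (\<sigma> x j)) ` ball 0 r)"
      using A1 r(1) by (simp add: locally_bounded_coeffs_def)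
    then obtain K where K: "\<forall>v\<in>(\<lambda>x. norm (b x j) + hs_norm (\<sigma> x j)) ` ball 0 r. v \<le> K"
      unfolding bdd_above_def by blast
    have "norm (b z j) \<le> K" if "z \<in> ball 0 r" for z
      using bspec[OF K imageI[OF that]] hs_norm_nonneg[of "\<sigma> z j"] by linarith
    then show ?thesis by blast
  qed
  then obtain K where K: "\<And>j z. z \<in> ball 0 r \<Longrightarrow> norm (b z j) \<le> K j" by metis
  have "norm (b (X x i t \<omega>) j) \<le> Max (range K)" if "t \<in> {0..T}" for t j
  proof -
    have "X x i t \<omega> \<in> ball 0 r" using r(2) that by blast
    then have "norm (b (X x i t \<omega>) j) \<le> K j" by (rule K)
    also have "\<dots> \<le> Max (range K)" by (intro Max_ge) auto
    finally show ?thesis .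
  qed
  then show ?thesis by blast
qed

end

section \<open>Finite Markov chains and hitting times\<close>

lemma sum_mult_of_bool_eq:
  fixes w :: "'s::finite \<Rightarrow> real"
  shows "(\<Sum>i\<in>UNIV. w i * of_bool (i = k)) = w k" "(\<Sum>i\<in>UNIV. w i * of_bool (k = i)) = w k"
    "(\<Sum>i\<in>UNIV. of_bool (i = k) * w i) = w k" "(\<Sum>i\<in>UNIV. of_bool (k = i) * w i) = w k"
proof -
  have "(\<Sum>i\<in>UNIV. w i * of_bool (i = k)) = (\<Sum>i\<in>UNIV. if i = k then w i else 0)"
    by (intro sum.cong) auto
  then show "(\<Sum>i\<in>UNIV. w i * of_bool (i = k)) = w k" by simp
  then show "(\<Sum>i\<in>UNIV. w i * of_bool (k = i)) = w k" "(\<Sum>i\<in>UNIV. of_bool (i = k) * w i) = w k"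
    "(\<Sum>i\<in>UNIV. of_bool (k = i) * w i) = w k"
    by (simp_all add: mult.commute eq_commute[of k])
qed

text \<open>Only the transition function is kept, so that the chain becomes matrix algebra. The
  rates are known just through the limits of \<open>P\<close> at 0; differentiability at other times
  has to be derived.\<close>

locale finite_chain =
  fixes P :: "real \<Rightarrow> 's::finite \<Rightarrow> 's \<Rightarrow> real" and q :: "'s \<Rightarrow> 's \<Rightarrow> real" and lam :: "'s \<Rightarrow> real"
  assumes P_nonneg: "0 \<le> t \<Longrightarrow> 0 \<le> P t i j"
    and P_sum: "0 \<le> t \<Longrightarrow> (\<Sum>j\<in>UNIV. P t i j) = 1"
    and P_0: "P 0 i j = of_bool (i = j)"
    and P_add: "0 \<le> s \<Longrightarrow> 0 \<le> t \<Longrightarrow> P (s + t) i j = (\<Sum>k\<in>UNIV. P s i k * P t k j)"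
    and P_rate: "i \<noteq> j \<Longrightarrow> ((\<lambda>t. P t i j / t) \<longlongrightarrow> q i j) (at_right 0)"
    and q_diag: "q i i = - (\<Sum>j\<in>UNIV - {i}. q i j)"
    and irreducible: "irreducible_rates q"
    and lam_nonneg: "0 \<le> lam i" and lam_sum: "(\<Sum>i\<in>UNIV. lam i) = 1"
    and lam_invariant: "0 \<le> t \<Longrightarrow> (\<Sum>i\<in>UNIV. lam i * P t i j) = lam j"
begin

lemma P_le_1: "0 \<le> t \<Longrightarrow> P t i j \<le> 1"
  using member_le_sum[of j UNIV "P t i"] P_nonneg[of t i] P_sum[of t i] by simp

lemma P_generator: "((\<lambda>t. (P t i j - of_bool (i = j)) / t) \<longlongrightarrow> q i j) (at_right 0)"
proof (cases "i = j")
  case True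
  have ev: "\<forall>\<^sub>F t in at_right 0. - (\<Sum>k\<in>UNIV - {i}. P t i k / t) = (P t i j - of_bool (i = j)) / t"
  proof (rule eventually_at_rightI[of 0 1])
    fix t :: real assume "t \<in> {0<..<1}"
    then have "P t i i + (\<Sum>k\<in>UNIV - {i}. P t i k) = 1"
      using P_sum[of t i] by (simp add: sum.remove[of UNIV i])
    then have S: "(\<Sum>k\<in>UNIV - {i}. P t i k) = 1 - P t i i" by linarith
    show "- (\<Sum>k\<in>UNIV - {i}. P t i k / t) = (P t i j - of_bool (i = j)) / t"
      unfolding sum_divide_distrib[symmetric] S by (simp add: True[symmetric] diff_divide_distrib)
  qed simp
  have "((\<lambda>t. - (\<Sum>k\<in>UNIV - {i}. P t i k / t)) \<longlongrightarrow> - (\<Sum>k\<in>UNIV - {i}. q i k)) (at_right 0)"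
    by (intro tendsto_minus tendsto_sum P_rate) auto
  then show ?thesis
    using Lim_transform_eventually[OF _ ev] True by (simp add: q_diag)
qed (use P_rate in simp)

lemma q_nonneg: "i \<noteq> j \<Longrightarrow> 0 \<le> q i j"
proof (rule tendsto_lowerbound[OF P_rate])
  assume "i \<noteq> j"
  show "\<forall>\<^sub>F t in at_right 0. 0 \<le> P t i j / t"
    by (rule eventually_at_rightI[of 0 1]) (auto simp: P_nonneg)
qed auto

lemma q_row_sum: "(\<Sum>j\<in>UNIV. q i j) = 0"
  using q_diag[of i] by (simp add: sum.remove[of UNIV i])

lemma lam_q: "(\<Sum>i\<in>UNIV. lam i * q i j) = 0"
proof -
  have "((\<lambda>t. \<Sum>i\<in>UNIV. lam i * ((P t i j - of_bool (i = j)) / t)) \<longlongrightarrow> (\<Sum>i\<in>UNIV. lam i * q i j)) (at_right 0)"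
    by (intro tendsto_intros P_generator)
  moreover have "\<forall>\<^sub>F t in at_right 0. (\<Sum>i\<in>UNIV. lam i * ((P t i j - of_bool (i = j)) / t)) = 0"
  proof (rule eventually_at_rightI[of 0 1])
    fix t :: real assume t: "t \<in> {0<..<1}"
    have "(\<Sum>i\<in>UNIV. lam i * ((P t i j - of_bool (i = j)) / t))
      = ((\<Sum>i\<in>UNIV. lam i * P t i j) - (\<Sum>i\<in>UNIV. lam i * of_bool (i = j))) / t"
      unfolding sum_subtractf[symmetric] sum_divide_distrib by (simp add: right_diff_distrib)
    also have "\<dots> = 0"
      using t lam_invariant[of t j] by (simp add: sum_mult_of_bool_eq)
    finally show "(\<Sum>i\<in>UNIV. lam i * ((P t i j - of_bool (i = j)) / t)) = 0" .
  qed simp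
  ultimately have "((\<lambda>_. 0) \<longlongrightarrow> (\<Sum>i\<in>UNIV. lam i * q i j)) (at_right (0::real))"
    by (rule Lim_transform_eventually)
  then show ?thesis by (simp add: tendsto_const_iff)
qed

definition Pv :: "real \<Rightarrow> ('s \<Rightarrow> real) \<Rightarrow> 's \<Rightarrow> real" where
  "Pv t v i = (\<Sum>j\<in>UNIV. P t i j * v j)"

definition Qv :: "('s \<Rightarrow> real) \<Rightarrow> 's \<Rightarrow> real" where
  "Qv v i = (\<Sum>j\<in>UNIV. q i j * v j)"

lemma Qv_eq_diff: "Qv v i = (\<Sum>j\<in>UNIV. q i j * (v j - v i))"
  unfolding Qv_def by (simp add: right_diff_distrib sum_subtractf sum_distrib_right[symmetric] q_row_sum)

lemma lam_Qv: "(\<Sum>i\<in>UNIV. lam i * Qv v i) = 0"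
proof -
  have "(\<Sum>i\<in>UNIV. lam i * Qv v i) = (\<Sum>i\<in>UNIV. \<Sum>j\<in>UNIV. lam i * q i j * v j)"
    unfolding Qv_def by (simp add: sum_distrib_left mult_ac)
  also have "\<dots> = (\<Sum>j\<in>UNIV. (\<Sum>i\<in>UNIV. lam i * q i j) * v j)"
    by (subst sum.swap) (simp add: sum_distrib_right)
  finally show ?thesis by (simp add: lam_q)
qed

lemma Pv_0: "Pv 0 v i = v i"
  unfolding Pv_def P_0 by (rule sum_mult_of_bool_eq)

lemma Pv_add: "0 \<le> s \<Longrightarrow> 0 \<le> t \<Longrightarrow> Pv (s + t) v i = Pv s (Pv t v) i"
proof -
  assume st: "0 \<le> s" "0 \<le> t"
  have "Pv (s + t) v i = (\<Sum>j\<in>UNIV. \<Sum>k\<in>UNIV. P s i k * P t k j * v j)"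
    unfolding Pv_def by (simp add: P_add[OF st] sum_distrib_right)
  also have "\<dots> = (\<Sum>k\<in>UNIV. P s i k * (\<Sum>j\<in>UNIV. P t k j * v j))"
    by (subst sum.swap) (simp add: sum_distrib_left mult_ac)
  finally show ?thesis by (simp add: Pv_def)
qed

lemma Pv_diff: "Pv t (\<lambda>j. v j - w j) i = Pv t v i - Pv t w i"
  unfolding Pv_def by (simp add: right_diff_distrib sum_subtractf)

lemma Pv_divide: "Pv t (\<lambda>j. v j / c) i = Pv t v i / c"
  unfolding Pv_def by (simp add: sum_divide_distrib)

lemma Pv_abs_le:
  assumes t: "0 \<le> t"
  shows "\<bar>Pv t v i\<bar> \<le> (\<Sum>j\<in>UNIV. \<bar>v j\<bar>)"
proof -
  have "\<bar>Pv t v i\<bar> \<le> (\<Sum>j\<in>UNIV. \<bar>P t i j * v j\<bar>)"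
    unfolding Pv_def by (rule sum_abs)
  also have "\<dots> \<le> (\<Sum>j\<in>UNIV. \<bar>v j\<bar>)"
    using t P_nonneg P_le_1 by (intro sum_mono) (simp add: abs_mult mult_left_le_one_le)
  finally show ?thesis .
qed

lemma Pv_generator: "((\<lambda>t. (Pv t v i - v i) / t) \<longlongrightarrow> Qv v i) (at_right 0)"
proof -
  have "((\<lambda>t. \<Sum>j\<in>UNIV. (P t i j - of_bool (i = j)) / t * v j) \<longlongrightarrow> Qv v i) (at_right 0)"
    unfolding Qv_def by (intro tendsto_intros P_generator)
  moreover have "(\<Sum>j\<in>UNIV. (P t i j - of_bool (i = j)) / t * v j) = (Pv t v i - v i) / t" for t
  proof -
    have "(\<Sum>j\<in>UNIV. (P t i j - of_bool (i = j)) / t * v j)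
      = ((\<Sum>j\<in>UNIV. P t i j * v j) - (\<Sum>j\<in>UNIV. of_bool (i = j) * v j)) / t"
      unfolding sum_subtractf[symmetric] sum_divide_distrib by (simp add: left_diff_distrib)
    also have "(\<Sum>j\<in>UNIV. of_bool (i = j) * v j) = v i"
      by (rule sum_mult_of_bool_eq)
    finally show ?thesis by (simp add: Pv_def)
  qed
  ultimately show ?thesis by simp
qed

lemma Pv_tendsto: "((\<lambda>t. Pv t v i) \<longlongrightarrow> v i) (at_right 0)"
proof -
  have "((\<lambda>t. (Pv t v i - v i) / t * t + v i) \<longlongrightarrow> Qv v i * 0 + v i) (at_right 0)"
    by (intro tendsto_intros Pv_generator)
  moreover have "\<forall>\<^sub>F t in at_right 0. (Pv t v i - v i) / t * t + v i = Pv t v i"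
    by (rule eventually_at_rightI[of 0 1]) auto
  ultimately show ?thesis
    by (simp add: Lim_transform_eventually)
qed

text \<open>With \<open>a = min s t\<close> and \<open>h = \<bar>s - t\<bar>\<close>, forward and
  backward quotients alike are \<open>Pv a\<close> applied to the quotient at 0, and
  \<open>Pv a\<close> is bounded uniformly in \<open>a\<close>. So the right derivative at 0 yields
  the derivative everywhere.\<close>

lemma Pv_deriv:
  assumes t: "0 \<le> t"
  shows "((\<lambda>s. Pv s v i) has_real_derivative Pv t (Qv v) i) (at t within {0..})"
proof -
  define d where "d h j = (Pv h v j - v j) / h" for h j
  \<comment> \<open>The first sum is the error of the quotient at 0, the second the displacement of
    \<open>Qv v\<close> between the times \<open>a\<close> and \<open>t\<close>.\<close>
  define E where "E h = (\<Sum>j\<in>UNIV. \<bar>d h j - Qv v j\<bar>) + (\<Sum>j\<in>UNIV. \<bar>Pv h (Qv v) j - Qv v j\<bar>)" for h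
  have "(E \<longlongrightarrow> (\<Sum>j\<in>(UNIV::'s set). \<bar>Qv v j - Qv v j\<bar>) + (\<Sum>j\<in>(UNIV::'s set). \<bar>Qv v j - Qv v j\<bar>)) (at_right 0)"
    unfolding E_def d_def by (intro tendsto_intros Pv_generator Pv_tendsto)
  then have E: "(E \<longlongrightarrow> 0) (at_right 0)" by simp
  have "filterlim (\<lambda>s. \<bar>s - t\<bar>) (at_right 0) (at t within {0..})"
    unfolding filterlim_at
  proof (intro conjI)
    show "\<forall>\<^sub>F s in at t within {0..}. \<bar>s - t\<bar> \<in> {0<..} \<and> \<bar>s - t\<bar> \<noteq> 0"
      unfolding eventually_at by (intro exI[of _ 1]) auto
    have "((\<lambda>s. \<bar>s - t\<bar>) \<longlongrightarrow> \<bar>t - t\<bar>) (at t within {0..})"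
      by (intro tendsto_intros)
    then show "((\<lambda>s. \<bar>s - t\<bar>) \<longlongrightarrow> 0) (at t within {0..})" by simp
  qed
  from filterlim_compose[OF E this] have E': "((\<lambda>s. E \<bar>s - t\<bar>) \<longlongrightarrow> 0) (at t within {0..})" .
  have "norm ((Pv s v i - Pv t v i) / (s - t) - Pv t (Qv v) i) \<le> E \<bar>s - t\<bar>" if s: "0 \<le> s" "s \<noteq> t" for s
  proof -
    define a where "a = min s t"
    define h where "h = \<bar>s - t\<bar>"
    have a: "0 \<le> a" and h: "0 < h" and ah: "a + h = max s t"
      using s t by (auto simp: a_def h_def)
    have "Pv (a + h) v i - Pv a v i = h * Pv a (d h) i"
      unfolding d_def Pv_divide Pv_diff using Pv_add[of a h v i] a h by simp
    then have quot: "(Pv s v i - Pv t v i) / (s - t) = Pv a (d h) i"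
      unfolding ah using s h by (cases "s < t") (auto simp: a_def h_def field_simps)
    have 1: "\<bar>Pv a (d h) i - Pv a (Qv v) i\<bar> \<le> (\<Sum>j\<in>UNIV. \<bar>d h j - Qv v j\<bar>)"
      using Pv_abs_le[OF a] unfolding Pv_diff[symmetric] .
    have 2: "\<bar>Pv a (Qv v) i - Pv t (Qv v) i\<bar> \<le> (\<Sum>j\<in>UNIV. \<bar>Pv h (Qv v) j - Qv v j\<bar>)"
    proof (cases "s < t")
      case True
      then have "Pv t (Qv v) i = Pv a (Pv h (Qv v)) i"
        using Pv_add[of a h "Qv v" i] a h by (simp add: ah max_def)
      then have "\<bar>Pv a (Qv v) i - Pv t (Qv v) i\<bar> = \<bar>Pv a (\<lambda>j. Pv h (Qv v) j - Qv v j) i\<bar>"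
        by (simp add: Pv_diff)
      then show ?thesis using Pv_abs_le[OF a] by simp
    qed (auto simp: a_def intro!: sum_nonneg)
    show ?thesis
      unfolding quot E_def h_def[symmetric] real_norm_def using 1 2 by linarith
  qed
  then have "\<forall>\<^sub>F s in at t within {0..}. norm ((Pv s v i - Pv t v i) / (s - t) - Pv t (Qv v) i) \<le> E \<bar>s - t\<bar>"
    unfolding eventually_at by (intro exI[of _ 1]) auto
  from Lim_null_comparison[OF this E'] show ?thesis
    unfolding has_field_derivative_iff by (rule LIM_zero_cancel)
qed

text \<open>Positivity near 0 is continuity. For larger \<open>t\<close>, being at \<open>i\<close>
  at the end of each of \<open>n\<close> short periods is one way to be there at time
  \<open>t\<close>.\<close>

lemma P_diag_pos:
  assumes t: "0 \<le> t"
  shows "0 < P t i i"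
proof -
  have "((\<lambda>t. P t i i) \<longlongrightarrow> 1) (at_right 0)"
    using Pv_tendsto[of "\<lambda>j. of_bool (j = i)" i] by (simp add: Pv_def sum_mult_of_bool_eq)
  then have "\<forall>\<^sub>F t in at_right 0. 0 < P t i i"
    by (rule order_tendstoD) simp
  then obtain e where e: "0 < e" "\<And>t. 0 < t \<Longrightarrow> t < e \<Longrightarrow> 0 < P t i i"
    unfolding eventually_at_right_field by auto
  obtain n where n: "t / e < real n" using reals_Archimedean2 by blast
  then have n0: "0 < real n" using t e by (smt (verit) divide_nonneg_pos)
  have "0 < P (real k * (t / real n)) i i" for k
  proof (induction k)
    case (Suc k)
    have step: "0 < P (t / real n) i i"
    proof (cases "t = 0")
      case False
      then show ?thesis
        using n n0 e t by (intro e(2)) (auto simp: field_simps)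
    qed (simp add: P_0)
    have "0 < P (real k * (t / real n)) i i * P (t / real n) i i"
      using Suc step by simp
    also have "\<dots> \<le> (\<Sum>j\<in>UNIV. P (real k * (t / real n)) i j * P (t / real n) j i)"
      using t n0 by (intro member_le_sum[of i UNIV "\<lambda>j. P (real k * (t / real n)) i j * P (t / real n) j i"]) (auto intro!: mult_nonneg_nonneg P_nonneg)
    also have "\<dots> = P (real k * (t / real n) + t / real n) i i"
      using t n0 by (intro P_add[symmetric]) auto
    also have "real k * (t / real n) + t / real n = real (Suc k) * (t / real n)"
      by (simp add: algebra_simps add_divide_distrib)
    finally show ?case .
  qed (simp add: P_0)
  from this[of n] n0 show ?thesis by simp
qed

lemma P_mult_le:
  assumes "0 \<le> s" "0 \<le> t"
  shows "P s i k * P t k j \<le> P (s + t) i j"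
  unfolding P_add[OF assms] using assms
  by (intro member_le_sum[of k UNIV "\<lambda>k. P s i k * P t k j"]) (auto intro!: mult_nonneg_nonneg P_nonneg)

lemma P_pos_rate:
  assumes "i \<noteq> j" "0 < q i j" "0 < t"
  shows "0 < P t i j"
proof -
  have "\<forall>\<^sub>F h in at_right 0. 0 < P h i j / h"
    using order_tendstoD(1)[OF P_rate[OF assms(1)] assms(2)] .
  moreover have "\<forall>\<^sub>F h in at_right 0. 0 < h \<and> h < t"
    using assms(3) by (intro eventually_at_rightI[of 0 t]) auto
  ultimately have "\<forall>\<^sub>F h in at_right 0. 0 < P h i j / h \<and> 0 < h \<and> h < t"
    by eventually_elim auto
  then obtain h where h: "0 < P h i j / h" "0 < h" "h < t"
    using eventually_happens'[of "at_right (0::real)"] by auto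
  have "0 < P h i j * P (t - h) j j"
    using h P_diag_pos[of "t - h" j] by (simp add: zero_less_divide_iff)
  also have "\<dots> \<le> P t i j"
    using P_mult_le[of h "t - h" i j j] h by simp
  finally show ?thesis .
qed

text \<open>Along a chain of positive rates the last jump gets half of the time and the earlier ones
  share the other half by induction; so all of them fit into any positive time.\<close>

lemma P_pos:
  assumes t: "0 < t"
  shows "0 < P t i j"
proof (cases "i = j")
  case False
  then obtain m k where k: "k 0 = i" "k m = j" "\<And>l. l < m \<Longrightarrow> k l \<noteq> k (Suc l) \<and> 0 < q (k l) (k (Suc l))"
    using irreducible unfolding irreducible_rates_def by metis
  have "l \<le> m \<Longrightarrow> 0 < t \<Longrightarrow> 0 < P t i (k l)" for l t
  proof (induction l arbitrary: t)
    case (Suc l)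
    have "0 < P (t / 2) i (k l) * P (t / 2) (k l) (k (Suc l))"
      using Suc.IH[of "t / 2"] P_pos_rate[of "k l" "k (Suc l)" "t / 2"] k(3)[of l] Suc.prems by simp
    also have "\<dots> \<le> P t i (k (Suc l))"
      using P_mult_le[of "t / 2" "t / 2" i "k l" "k (Suc l)"] Suc.prems by simp
    finally show ?case .
  qed (use k P_diag_pos in auto)
  from this[of m t] k(2) t show ?thesis by simp
qed (use P_diag_pos t in simp)

lemma lam_pos: "0 < lam i"
proof -
  obtain k where k: "0 < lam k"
    using lam_sum lam_nonneg by (metis less_eq_real_def sum.neutral zero_neq_one)
  have "0 < lam k * P 1 k i"
    using k P_pos by simp
  also have "\<dots> \<le> (\<Sum>k\<in>UNIV. lam k * P 1 k i)"
    using lam_nonneg P_nonneg by (intro member_le_sum[of k UNIV "\<lambda>k. lam k * P 1 k i"]) auto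
  finally show ?thesis by (simp add: lam_invariant)
qed

lemma lam_le_1: "lam i \<le> 1"
  using member_le_sum[of i UNIV lam] lam_nonneg lam_sum by simp

section \<open>The Poisson equation and hitting times\<close>

lemma Qv_nonneg_at_min:
  assumes "\<And>j. v i \<le> v j"
  shows "0 \<le> Qv v i"
  unfolding Qv_eq_diff using assms q_nonneg
  by (intro sum_nonneg) (metis diff_ge_0_iff_ge diff_self mult_nonneg_nonneg mult_zero_right order_refl)

text \<open>Where the minimum is attained, \<open>Qv v = 0\<close> is a vanishing sum of nonnegative
  terms, so the minimum passes on along every positive rate and by irreducibility to every
  state.\<close>

lemma Qv_zero_const:
  assumes "\<And>i. Qv v i = 0"
  shows "v i = v j"
proof -
  have step: "v k' = Min (range v)" if k: "v k = Min (range v)" "k \<noteq> k'" "0 < q k k'" for k k'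
  proof -
    have min: "v k \<le> v l" for l using k(1) by simp
    have nn: "0 \<le> q k l * (v l - v k)" for l
      using min[of l] q_nonneg[of k l] by (cases "k = l") auto
    have "(\<Sum>l\<in>UNIV. q k l * (v l - v k)) = 0"
      using assms[of k] by (simp add: Qv_eq_diff)
    then have "q k k' * (v k' - v k) = 0"
      using nn by (subst (asm) sum_nonneg_eq_0_iff) auto
    with k show ?thesis by simp
  qed
  have "Min (range v) \<in> range v" by (intro Min_in) auto
  then obtain i0 where i0: "v i0 = Min (range v)" by (metis imageE)
  have "v j = Min (range v)" for j
  proof (cases "i0 = j")
    case False
    then obtain m k where k: "k 0 = i0" "k m = j" "\<And>l. l < m \<Longrightarrow> k l \<noteq> k (Suc l) \<and> 0 < q (k l) (k (Suc l))"
      using irreducible unfolding irreducible_rates_def by metis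
    have "l \<le> m \<Longrightarrow> v (k l) = Min (range v)" for l
    proof (induction l)
      case (Suc l)
      then show ?case using step[of "k l" "k (Suc l)"] k(3)[of l] by simp
    qed (use i0 k in simp)
    from this[of m] k(2) show ?thesis by simp
  qed (use i0 in simp)
  then show ?thesis by metis
qed

text \<open>Fredholm alternative made explicit. Subtracting the \<open>lam\<close>-mean from every
  coordinate of \<open>Qv\<close> gives an injective, hence surjective, map \<open>L\<close>.
  Testing \<open>L x = w\<close> with \<open>lam\<close> shows that the mean of \<open>x\<close> is
  0, so that the subtracted term disappears.\<close>

lemma poisson_solution:
  assumes w: "(\<Sum>i\<in>UNIV. lam i * w i) = 0"
  shows "\<exists>v. \<forall>i. Qv v i = w i"
proof -
  define L where "L x = (\<chi> i. Qv (($) x) i - (\<Sum>j\<in>UNIV. lam j * x $ j))" for x :: "real ^ 's"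
  have lin: "linear L"
    by (rule linearI) (auto simp: L_def Qv_def vec_eq_iff algebra_simps sum.distrib sum_distrib_left)
  have lam_L: "(\<Sum>i\<in>UNIV. lam i * L x $ i) = - (\<Sum>j\<in>UNIV. lam j * x $ j)" for x
    using lam_Qv[of "($) x"] lam_sum
    by (simp add: L_def right_diff_distrib sum_subtractf sum_distrib_right[symmetric])
  have "inj L"
  proof (rule linear_injective_0[OF lin, THEN iffD2], intro allI impI)
    fix x assume x: "L x = 0"
    then have m: "(\<Sum>j\<in>UNIV. lam j * x $ j) = 0" using lam_L[of x] by simp
    have "Qv (($) x) i = 0" for i
      using arg_cong[OF x, of "\<lambda>v. v $ i"] m by (simp add: L_def)
    from Qv_zero_const[OF this] have c: "x $ j = x $ i" for i j .
    have "x $ i = 0" for i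
    proof -
      have "(\<Sum>j\<in>UNIV. lam j * x $ j) = (\<Sum>j\<in>UNIV. lam j * x $ i)"
        by (intro sum.cong refl arg_cong[of _ _ "\<lambda>y. _ * y"] c)
      also have "\<dots> = x $ i" by (simp add: sum_distrib_right[symmetric] lam_sum)
      finally show ?thesis using m by simp
    qed
    then show "x = 0" by (simp add: vec_eq_iff)
  qed
  then have "surj L" by (rule linear_injective_imp_surjective[OF lin]) simp
  then obtain x where x: "L x = (\<chi> i. w i)" by (metis surjD)
  have "- (\<Sum>j\<in>UNIV. lam j * x $ j) = 0"
    using lam_L[of x] w x by simp
  then have "Qv (($) x) i = w i" for i
    using arg_cong[OF x, of "\<lambda>v. v $ i"] by (simp add: L_def)
  then show ?thesis by blast
qed

lemma Qv_add_const: "Qv (\<lambda>j. v j + c) i = Qv v i"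
  unfolding Qv_eq_diff by simp

text \<open>
  \<open>u j\<close> is the expected time to reach \<open>k\<close> from \<open>j\<close>. The trivial estimate through geometric trials
  at integer times only yields \<open>1 / \<zeta>\<close>, which is larger than \<open>1 / \<vartheta>\<close> with \<open>\<vartheta> = - ln (1 - \<zeta>)\<close>. The
  improvement compares the upper bound \<open>m 1 \<le> H - \<zeta> (H + V)\<close> for the mean \<open>m\<close> of \<open>u\<close>, started at its
  maximum \<open>H\<close>, with the lower bound following from \<open>m' \<ge> - 1\<close> up to time \<open>V\<close> and from
  \<open>\<mu> m' \<ge> - m\<close> afterwards.
\<close>
lemma hitting_time_bound:
  assumes \<zeta>: "0 < \<zeta>" "\<zeta> < 1" "\<And>i j. \<zeta> \<le> P 1 i j"
  shows "\<exists>u. (\<forall>j. Qv u j = of_bool (j = k) / lam k - 1 \<and> 0 \<le> u j \<and> u j * (- ln (1 - \<zeta>)) \<le> 1)"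
proof -
  \<comment> \<open>The weight \<open>1 / lam k\<close> is the one that gives the right-hand side
    mean 0, the solvability condition.\<close>
  have "(\<Sum>i\<in>UNIV. lam i * (of_bool (i = k) / lam k - 1)) = 0"
    using lam_pos[of k] lam_sum
    by (simp add: right_diff_distrib sum_subtractf sum_divide_distrib[symmetric] sum_mult_of_bool_eq)
  from poisson_solution[OF this] obtain v where v: "\<And>i. Qv v i = of_bool (i = k) / lam k - 1" by blast
  define u where "u j = v j + (- v k)" for j
  have Qu: "Qv u j = of_bool (j = k) / lam k - 1" for j
    unfolding u_def Qv_add_const by (rule v)
  have uk: "u k = 0" by (simp add: u_def)
  \<comment> \<open>At a minimum \<open>Qv u\<close> is nonnegative, but off \<open>k\<close> it
    equals -1.\<close>
  have min_at: "j = k" if "\<And>l. u j \<le> u l" for j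
    using Qv_nonneg_at_min[of u j] that Qu[of j] by (cases "j = k") auto
  obtain i0 where i0: "u i0 = Min (range u)" by (metis (mono_tags) Min_in UNIV_not_empty finite finite_imageI image_is_empty imageE)
  then have "i0 = k" by (intro min_at) simp
  then have u_nonneg: "0 \<le> u j" for j
    using i0 uk Min_le[of "range u" "u j"] by simp
  have u_pos: "0 < u j" if "j \<noteq> k" for j
    using that min_at[of j] u_nonneg by (metis less_eq_real_def)
  define H where "H = Max (range u)"
  have uH: "u j \<le> H" for j by (simp add: H_def)
  have "H * (- ln (1 - \<zeta>)) \<le> 1"
  proof (cases "UNIV = {k}")
    case True
    then have "range u = {0}" using uk by auto
    then have "H = 0" by (simp add: H_def)
    then show ?thesis by simp
  next
    case False
    then have ne: "- {k} \<noteq> {}" by auto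
    \<comment> \<open>The least value off \<open>k\<close>, so that \<open>V\<close> is the
      oscillation of \<open>u\<close> there.\<close>
    define \<mu> where "\<mu> = Min (u ` (- {k}))"
    define V where "V = H - \<mu>"
    have "\<mu> \<in> u ` (- {k})" unfolding \<mu>_def using ne by (intro Min_in) auto
    then obtain l where l: "l \<noteq> k" "\<mu> = u l" by auto
    have \<mu>: "0 < \<mu>" using u_pos l by simp
    have u\<mu>: "\<mu> \<le> u j" if "j \<noteq> k" for j
      unfolding \<mu>_def using that by (intro Min_le) auto
    have V: "0 \<le> V" using uH[of l] by (simp add: V_def l)
    have H: "0 < H" using \<mu> uH[of l] l by simp
    have "H \<in> range u" unfolding H_def by (intro Max_in) auto
    then obtain i where i: "H = u i" by auto
    define m where "m s = Pv s u i" for s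
    define m' where "m' s = P s i k / lam k - 1" for s
    have m0: "m 0 = H" by (simp add: m_def Pv_0 i)
    have deriv: "(m has_real_derivative m' s) (at s within {0..})" if "0 \<le> s" for s
    proof -
      have "Pv s (Qv u) i = m' s"
        using P_sum[OF that, of i] unfolding Pv_def m'_def Qu
        by (simp add: right_diff_distrib sum_subtractf sum_divide_distrib[symmetric] sum_mult_of_bool_eq)
      moreover have "m = (\<lambda>s. Pv s u i)" by (simp add: m_def fun_eq_iff)
      ultimately show ?thesis using Pv_deriv[OF that, of u i] by simp
    qed
    have deriv_at: "(m has_real_derivative m' s) (at s)" if "0 < s" for s
    proof -
      have "at s within {0..} = at s within UNIV"
        using that by (intro at_within_nhd[of s "{0<..}"]) auto
      with deriv[of s] that show ?thesis by simp
    qed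
    have m'_ge: "- 1 \<le> m' s" if "0 \<le> s" for s
      using P_nonneg[OF that] lam_pos[of k] by (simp add: m'_def)
    have m_ge: "\<mu> * (1 - P s i k) \<le> m s" if s: "0 \<le> s" for s
    proof -
      have "\<mu> * (1 - P s i k) = (\<Sum>j\<in>UNIV. P s i j * (\<mu> * of_bool (j \<noteq> k)))"
      proof -
        have "(\<Sum>j\<in>UNIV. P s i j * (\<mu> * of_bool (j \<noteq> k))) = (\<Sum>j\<in>UNIV. \<mu> * P s i j - \<mu> * (P s i j * of_bool (j = k)))"
          by (intro sum.cong) auto
        also have "\<dots> = \<mu> * (1 - P s i k)"
          using P_sum[OF s, of i]
          by (simp only: sum_subtractf sum_distrib_left[symmetric] sum_mult_of_bool_eq) (simp add: algebra_simps)
        finally show ?thesis by simp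
      qed
      also have "\<dots> \<le> m s"
        unfolding m_def Pv_def using s u\<mu> uk by (intro sum_mono mult_left_mono P_nonneg) auto
      finally show ?thesis .
    qed
    have growth: "- m s \<le> \<mu> * m' s" if s: "0 \<le> s" for s
    proof -
      have "P s i k \<le> P s i k / lam k"
        using P_nonneg[OF s, of i k] lam_pos[of k] lam_le_1[of k] by (simp add: le_divide_eq mult_left_le)
      then have "\<mu> * P s i k \<le> \<mu> * (P s i k / lam k)" using \<mu> by (intro mult_left_mono) auto
      then show ?thesis using m_ge[OF s] by (simp add: m'_def algebra_simps)
    qed
    have linear: "H - s \<le> m s" if s: "0 \<le> s" for s
    proof -
      have "m 0 + 0 \<le> m s + s"
      proof (rule DERIV_nonneg_imp_increasing_open[where f="\<lambda>s. m s + s"])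
        show "\<exists>y. ((\<lambda>s. m s + s) has_real_derivative y) (at x) \<and> 0 \<le> y" if "0 < x" "x < s" for x
        proof -
          have "((\<lambda>s. m s + s) has_real_derivative m' x + 1) (at x)"
            using that by (intro DERIV_add deriv_at DERIV_ident)
          moreover have "0 \<le> m' x + 1" using that m'_ge[of x] by simp
          ultimately show ?thesis by blast
        qed
        have "continuous_on {0..} m"
          unfolding continuous_on_eq_continuous_within using deriv by (meson DERIV_continuous atLeast_iff)
        then show "continuous_on {0..s} (\<lambda>s. m s + s)"
          by (intro continuous_intros) (auto intro: continuous_on_subset)
      qed (rule s)
      then show ?thesis by (simp add: m0)
    qed
    \<comment> \<open>Started at the maximum, the mass at \<open>k\<close> lowers the mean by at
      least \<open>\<zeta> * H\<close>, that at \<open>l\<close> by at least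
      \<open>\<zeta> * V\<close>.\<close>
    have m1: "m 1 \<le> H - \<zeta> * (H + V)"
    proof -
      have "m 1 = H - (\<Sum>j\<in>UNIV. P 1 i j * (H - u j))"
        using P_sum[of 1 i] unfolding m_def Pv_def
        by (simp add: right_diff_distrib sum_subtractf sum_distrib_right[symmetric])
      moreover have "(\<Sum>j\<in>{k, l}. \<zeta> * (H - u j)) \<le> (\<Sum>j\<in>{k, l}. P 1 i j * (H - u j))"
        using \<zeta> uH by (intro sum_mono mult_right_mono) auto
      moreover have "(\<Sum>j\<in>{k, l}. P 1 i j * (H - u j)) \<le> (\<Sum>j\<in>UNIV. P 1 i j * (H - u j))"
        using uH by (intro sum_mono2) (auto intro!: mult_nonneg_nonneg P_nonneg)
      moreover have "(\<Sum>j\<in>{k, l}. \<zeta> * (H - u j)) = \<zeta> * (H + V)"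
        using l by (simp add: uk V_def algebra_simps)
      ultimately show ?thesis by linarith
    qed
    have key: "(1 + 1 / H) * exp (- 1 / H) \<le> 1"
      using exp_ge_add_one_self[of "1 / H"] by (simp add: exp_minus field_simps)
    \<comment> \<open>The claim in exponential form. If \<open>V\<close> is at least 1, the linear
      lower bound already reaches time 1; otherwise it stops at time \<open>V\<close> with the value
      \<open>\<mu>\<close>, from where exponential decay continues it.\<close>
    have "exp (- 1 / H) \<le> 1 - \<zeta>"
    proof (cases "1 \<le> V")
      case True
      have "\<zeta> * (H + 1) \<le> \<zeta> * (H + V)" using True \<zeta> by simp
      also have "\<dots> \<le> 1" using m1 linear[of 1] by simp
      finally have "H \<le> (1 - \<zeta>) * (H + 1)" by (simp add: algebra_simps)
      moreover have "exp (- 1 / H) * (H + 1) \<le> H"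
        using key H by (simp add: field_simps)
      ultimately have "exp (- 1 / H) * (H + 1) \<le> (1 - \<zeta>) * (H + 1)" by linarith
      then show ?thesis using H by simp
    next
      case False
      have "\<mu> * exp (V / \<mu>) \<le> m V * exp (V / \<mu>)"
        using linear[OF V] by (simp add: V_def)
      also have "\<dots> \<le> m 1 * exp (1 / \<mu>)"
      proof (rule DERIV_nonneg_imp_increasing_open[where f="\<lambda>s. m s * exp (s / \<mu>)"])
        show "V \<le> 1" using False by simp
        show "\<exists>y. ((\<lambda>s. m s * exp (s / \<mu>)) has_real_derivative y) (at x) \<and> 0 \<le> y" if "V < x" "x < 1" for x
        proof -
          have x: "0 < x" using V that by simp
          have "((\<lambda>s. exp (s / \<mu>)) has_real_derivative exp (x / \<mu>) * (1 / \<mu>)) (at x)"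
            using \<mu> by (auto intro!: derivative_eq_intros)
          from DERIV_mult[OF deriv_at[OF x] this]
          have "((\<lambda>s. m s * exp (s / \<mu>)) has_real_derivative m' x * exp (x / \<mu>) + exp (x / \<mu>) * (1 / \<mu>) * m x) (at x)" .
          moreover have "m' x * exp (x / \<mu>) + exp (x / \<mu>) * (1 / \<mu>) * m x = exp (x / \<mu>) / \<mu> * (\<mu> * m' x + m x)"
            using \<mu> by (simp add: field_simps)
          moreover have "0 \<le> exp (x / \<mu>) / \<mu> * (\<mu> * m' x + m x)"
            using growth[of x] x \<mu> by (intro mult_nonneg_nonneg) auto
          ultimately show ?thesis by metis
        qed
        have "continuous_on {0..} m"
          unfolding continuous_on_eq_continuous_within using deriv by (meson DERIV_continuous atLeast_iff)
        then show "continuous_on {V..1} (\<lambda>s. m s * exp (s / \<mu>))"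
          using V \<mu> by (intro continuous_intros) (auto intro: continuous_on_subset)
      qed
      finally have "\<mu> * exp (V / \<mu>) * exp (- 1 / \<mu>) \<le> m 1"
        by (simp add: exp_minus field_simps)
      then have lower: "\<mu> * exp ((V - 1) / \<mu>) \<le> m 1"
        by (simp add: mult.assoc exp_add[symmetric] diff_divide_distrib)
      \<comment> \<open>The excess of \<open>(V - 1) / \<mu>\<close> over \<open>- 1 / H\<close>.
        Bounding \<open>exp z\<close> below by \<open>1 + z\<close> leaves \<open>H - V / H\<close>,
        and the missing multiple of \<open>V\<close> is supplied by \<open>key\<close>.\<close>
      define z where "z = V * (H - 1) / (H * \<mu>)"
      have "(V - 1) / \<mu> = - 1 / H + z"
        using H \<mu> unfolding z_def by (simp add: field_simps V_def)
      then have "\<mu> * exp ((V - 1) / \<mu>) = exp (- 1 / H) * (\<mu> * exp z)"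
        by (simp only: exp_add mult_ac)
      moreover have "\<mu> * (1 + z) \<le> \<mu> * exp z"
        using \<mu> exp_ge_add_one_self[of z] by simp
      moreover have "\<mu> * (1 + z) = H - V / H"
        using H \<mu> unfolding z_def by (simp add: field_simps V_def)
      ultimately have "exp (- 1 / H) * (H - V / H) \<le> m 1"
        using lower by (smt (verit) exp_ge_zero mult_left_mono)
      then have "exp (- 1 / H) * (H - V / H) + V \<le> (1 - \<zeta>) * (H + V)"
        using m1 by (simp add: algebra_simps)
      moreover have "V * ((1 + 1 / H) * exp (- 1 / H)) \<le> V * 1"
        using key V by (rule mult_left_mono)
      moreover have "exp (- 1 / H) * (H - V / H) + V * ((1 + 1 / H) * exp (- 1 / H)) = exp (- 1 / H) * (H + V)"
        by (simp add: algebra_simps)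
      ultimately have "exp (- 1 / H) * (H + V) \<le> (1 - \<zeta>) * (H + V)" by linarith
      then show ?thesis using H V by simp
    qed
    then have "- 1 / H \<le> ln (1 - \<zeta>)"
      using \<zeta> by (simp add: ln_ge_iff)
    then show ?thesis using H by (simp add: field_simps)
  qed
  moreover have "0 \<le> - ln (1 - \<zeta>)" using \<zeta> by simp
  ultimately have "u j * (- ln (1 - \<zeta>)) \<le> 1" for j
    using mult_right_mono[OF uH[of j], of "- ln (1 - \<zeta>)"] by linarith
  with Qu u_nonneg show ?thesis by blast
qed

text \<open>Constants lie in the kernel of \<open>Qv\<close>, so the solution may be shifted to have
  minimum 0. The bound \<open>G\<close> is not explicit, but it is available for every value of
  \<open>zeta\<close>, including the value 1 of a single regime.\<close>

lemma poisson_nonneg: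
  "\<exists>g G. \<forall>i. Qv g i = c i - (\<Sum>j\<in>UNIV. lam j * c j) \<and> 0 \<le> g i \<and> g i \<le> G"
proof -
  have "(\<Sum>i\<in>UNIV. lam i * (c i - (\<Sum>j\<in>UNIV. lam j * c j))) = 0"
    by (simp add: right_diff_distrib sum_subtractf sum_distrib_right[symmetric] lam_sum)
  from poisson_solution[OF this] obtain v where v: "\<And>i. Qv v i = c i - (\<Sum>j\<in>UNIV. lam j * c j)" by blast
  define g where "g j = v j + (- Min (range v))" for j
  have "Qv g i = c i - (\<Sum>j\<in>UNIV. lam j * c j)" for i
    unfolding g_def Qv_add_const by (rule v)
  moreover have "0 \<le> g i" for i
  proof -
    have "Min (range v) \<le> v i" by (intro Min_le) auto
    then show ?thesis unfolding g_def by linarith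
  qed
  moreover have "g i \<le> Max (range g)" for i
    by (intro Max_ge) auto
  ultimately show ?thesis by blast
qed

text \<open>Superposition of hitting times: weighting \<open>u k\<close> by
  \<open>lam k * c k\<close> cancels the factor \<open>1 / lam k\<close> and produces
  \<open>c\<close> minus its mean, and the bound on each \<open>u k\<close> is multiplied by the
  total weight, which is that mean.\<close>

lemma poisson_bounded:
  assumes \<zeta>: "0 < \<zeta>" "\<zeta> < 1" "\<And>i j. \<zeta> \<le> P 1 i j" and c: "\<And>i. 0 \<le> c i"
  shows "\<exists>g. \<forall>i. Qv g i = c i - (\<Sum>j\<in>UNIV. lam j * c j) \<and> 0 \<le> g i
    \<and> g i \<le> (\<Sum>j\<in>UNIV. lam j * c j) / (- ln (1 - \<zeta>))"
proof -
  obtain u where u: "\<And>k j. Qv (u k) j = of_bool (j = k) / lam k - 1" "\<And>k j. 0 \<le> u k j"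
    "\<And>k j. u k j * (- ln (1 - \<zeta>)) \<le> 1"
    using hitting_time_bound[OF \<zeta>] by metis
  define g where "g i = (\<Sum>k\<in>UNIV. lam k * c k * u k i)" for i
  have \<theta>: "0 < - ln (1 - \<zeta>)" using \<zeta> by simp
  have "Qv g i = c i - (\<Sum>j\<in>UNIV. lam j * c j)" for i
  proof -
    have "Qv g i = (\<Sum>k\<in>UNIV. lam k * c k * Qv (u k) i)"
      unfolding Qv_def g_def by (simp add: sum_distrib_left mult_ac, subst sum.swap) (simp add: mult_ac)
    also have "\<dots> = c i - (\<Sum>j\<in>UNIV. lam j * c j)"
    proof -
      have "lam k * c k * Qv (u k) i = c k * of_bool (i = k) - lam k * c k" for k
        unfolding u(1) using lam_pos[of k] by (simp add: right_diff_distrib)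
      then show ?thesis by (simp add: sum_subtractf sum_mult_of_bool_eq)
    qed
    finally show ?thesis .
  qed
  moreover have "0 \<le> g i" for i
    unfolding g_def using lam_nonneg c u(2) by (intro sum_nonneg mult_nonneg_nonneg)
  moreover have "g i \<le> (\<Sum>j\<in>UNIV. lam j * c j) / (- ln (1 - \<zeta>))" for i
  proof -
    have "g i * (- ln (1 - \<zeta>)) = (\<Sum>k\<in>UNIV. lam k * c k * (u k i * (- ln (1 - \<zeta>))))"
      unfolding g_def sum_distrib_right by (simp add: mult_ac)
    also have "\<dots> \<le> (\<Sum>k\<in>UNIV. lam k * c k * 1)"
      using lam_nonneg c u(3) by (intro sum_mono mult_left_mono mult_nonneg_nonneg)
    finally show ?thesis using \<theta> by (simp only: pos_le_divide_eq) simp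
  qed
  ultimately show ?thesis by blast
qed

end

section \<open>Exponential moments of occupation times\<close>

text \<open>Paths are right-continuous, so each cell is sampled at its right end: the sample point
  is \<open>s\<close> or approaches it from the right. Dominated convergence gives integrability and
  the limit together.\<close>

lemma right_riemann_sum:
  fixes u :: "real \<Rightarrow> real"
  assumes t: "0 < t" and bound: "\<And>s. \<bar>u s\<bar> \<le> B"
    and right: "\<And>s. 0 \<le> s \<Longrightarrow> \<forall>\<^sub>F r in at_right s. u r = u s"
  shows "u integrable_on {0..t}" (is ?I)
    and "(\<lambda>m. \<Sum>k<Suc m. t / real (Suc m) * u (real (Suc k) * (t / real (Suc m)))) \<longlonglongrightarrow> integral {0..t} u" (is ?L)
proof -
  define h where "h m = t / real (Suc m)" for m
  have h: "0 < h m" for m using t by (simp add: h_def)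
  define f where "f m s = u (h m * of_int \<lceil>s / h m\<rceil>)" for m s
  have int: "(f m has_integral (\<Sum>k<j. h m * u (real (Suc k) * h m))) {0..real j * h m}" for m j
  proof (induction j)
    case 0
    show ?case using has_integral_refl(2)[of "f m" "0::real"] by simp
  next
    case (Suc j)
    have "((\<lambda>_. u (real (Suc j) * h m)) has_integral (real (Suc j) * h m - real j * h m) *\<^sub>R u (real (Suc j) * h m))
        {real j * h m..real (Suc j) * h m}"
      using has_integral_const_real[of "u (real (Suc j) * h m)" "real j * h m" "real (Suc j) * h m"] h[of m]
      by (simp add: mult_right_mono)
    then have "(f m has_integral (real (Suc j) * h m - real j * h m) *\<^sub>R u (real (Suc j) * h m))
        {real j * h m..real (Suc j) * h m}"
    \<comment> \<open>At the left end of a cell the ceiling still belongs to the preceding cell;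
      this single point is exempted.\<close>
    proof (rule has_integral_spike_finite[of "{real j * h m}", rotated 2])
      fix s assume s: "s \<in> {real j * h m..real (Suc j) * h m} - {real j * h m}"
      have "real j < s / h m" "s / h m \<le> real (Suc j)"
        using s h[of m] by (auto simp: field_simps)
      then have "\<lceil>s / h m\<rceil> = int (Suc j)"
        by (intro ceiling_unique) auto
      then show "f m s = u (real (Suc j) * h m)"
        by (simp add: f_def mult.commute)
    qed simp
    then have "(f m has_integral h m * u (real (Suc j) * h m)) {real j * h m..real (Suc j) * h m}"
      by (simp add: algebra_simps)
    then show ?case
      using Suc.IH h[of m]
      by (simp only: sum.lessThan_Suc)
        (intro has_integral_combine[of 0 "real j * h m" "real (Suc j) * h m"], auto simp: mult_right_mono)
  qed
  have full: "real (Suc m) * h m = t" for m by (simp add: h_def)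
  have int_t: "(f m has_integral (\<Sum>k<Suc m. h m * u (real (Suc k) * h m))) {0..t}" for m
    using int[of m "Suc m"] unfolding full .
  have conv: "(\<lambda>m. f m s) \<longlonglongrightarrow> u s" if s: "s \<in> {0..t}" for s
  proof -
    obtain e where e: "s < e" "\<And>r. s < r \<Longrightarrow> r < e \<Longrightarrow> u r = u s"
      using right[of s] s unfolding eventually_at_right_field by auto
    have "(\<lambda>m. h m) \<longlonglongrightarrow> 0"
      unfolding h_def by (rule LIMSEQ_Suc[OF lim_const_over_n])
    then have "\<forall>\<^sub>F m in sequentially. h m < e - s"
      using e(1) by (intro order_tendstoD) auto
    then have "\<forall>\<^sub>F m in sequentially. f m s = u s"
    proof eventually_elim
      case (elim m)
      have "s / h m \<le> of_int \<lceil>s / h m\<rceil>" "of_int \<lceil>s / h m\<rceil> < s / h m + 1"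
        using ceiling_correct[of "s / h m"] by linarith+
      then have "of_int \<lceil>s / h m\<rceil> - 1 < s / h m" by linarith
      then have "(of_int \<lceil>s / h m\<rceil> - 1) * h m < s"
        using pos_less_divide_eq[OF h] by metis
      moreover have "s \<le> of_int \<lceil>s / h m\<rceil> * h m"
        using pos_divide_le_eq[OF h[of m], of s "of_int \<lceil>s / h m\<rceil>"] by simp
      ultimately have "s \<le> h m * of_int \<lceil>s / h m\<rceil>" "h m * of_int \<lceil>s / h m\<rceil> < s + h m"
        by (auto simp: left_diff_distrib right_diff_distrib mult.commute)
      then show ?case
        unfolding f_def using e elim by (cases "h m * of_int \<lceil>s / h m\<rceil> = s") auto
    qed
    then show ?thesis by (rule tendsto_eventually)
  qed
  have dom: "norm (f m s) \<le> B" for m s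
    unfolding f_def real_norm_def by (rule bound)
  have B: "(\<lambda>_. B) integrable_on {0..t}" by (rule integrable_const_ivl)
  show ?I
    by (rule dominated_convergence(1)[of f _ "\<lambda>_. B"]) (use int_t dom conv B in auto)
  have "(\<lambda>m. integral {0..t} (f m)) \<longlonglongrightarrow> integral {0..t} u"
    by (rule dominated_convergence(2)[of f _ "\<lambda>_. B"]) (use int_t dom conv B in auto)
  then show ?L
    unfolding integral_unique[OF int_t] h_def .
qed

lemma tendsto_exp_quotient: "((\<lambda>h. (exp (a * h) - 1) / h) \<longlongrightarrow> a) (at_right (0::real))"
proof -
  have "((\<lambda>x. exp (a * x)) has_real_derivative a) (at 0)"
    by (auto intro!: derivative_eq_intros)
  then have "((\<lambda>h. (exp (a * h) - 1) / h) \<longlongrightarrow> a) (at 0)"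
    by (simp add: DERIV_def)
  then show ?thesis
    by (rule tendsto_within_subset) simp
qed

definition occupation :: "('s \<Rightarrow> real \<Rightarrow> 'w \<Rightarrow> 's) \<Rightarrow> ('s \<Rightarrow> real) \<Rightarrow> 's \<Rightarrow> real \<Rightarrow> 'w \<Rightarrow> real" where
  "occupation L c i t \<omega> = integral {0..t} (\<lambda>s. c (L i s \<omega>))"

context finite_chain
begin

text \<open>At \<open>h = 0\<close> both sides agree, and the derivative of their difference is
  \<open>Qv \<phi> i - c i * \<phi> i + \<mu>' * \<phi> i\<close>, which is negative. The gap
  between \<open>\<mu>'\<close> and \<open>\<mu>\<close> absorbs the error of order
  \<open>o(h)\<close>; finitely many regimes make it uniform in \<open>i\<close>.\<close>

lemma supersolution_step:
  assumes \<phi>: "\<And>i. 0 < \<phi> i" and super: "\<And>i. Qv \<phi> i - c i * \<phi> i \<le> - \<mu> * \<phi> i" and \<mu>: "\<mu>' < \<mu>"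
  shows "\<forall>\<^sub>F h in at_right 0. \<forall>i. Pv h (\<lambda>j. exp (- c j * h) * \<phi> j) i \<le> exp (- \<mu>' * h) * \<phi> i"
proof (rule eventually_all_finite)
  fix i
  have P_lim: "((\<lambda>h. P h i j) \<longlongrightarrow> of_bool (i = j)) (at_right 0)" for j
    using Pv_tendsto[of "\<lambda>k. of_bool (k = j)" i] by (simp add: Pv_def sum_mult_of_bool_eq)
  define d where "d h = (Pv h \<phi> i - \<phi> i) / h + (\<Sum>j\<in>UNIV. P h i j * ((exp (- c j * h) - 1) / h * \<phi> j))
    - (exp (- \<mu>' * h) - 1) / h * \<phi> i" for h
  have "(d \<longlongrightarrow> Qv \<phi> i + (\<Sum>j\<in>UNIV. of_bool (i = j) * (- c j * \<phi> j)) - - \<mu>' * \<phi> i) (at_right 0)"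
    unfolding d_def by (intro tendsto_intros Pv_generator P_lim tendsto_exp_quotient)
  then have lim: "(d \<longlongrightarrow> Qv \<phi> i - c i * \<phi> i + \<mu>' * \<phi> i) (at_right 0)"
    by (simp add: sum_negf sum_mult_of_bool_eq)
  have "\<mu>' * \<phi> i < \<mu> * \<phi> i" using \<phi>[of i] \<mu> by simp
  then have "Qv \<phi> i - c i * \<phi> i + \<mu>' * \<phi> i < 0" using super[of i] by simp
  from order_tendstoD(2)[OF lim this] have "\<forall>\<^sub>F h in at_right 0. d h < 0" .
  moreover have "\<forall>\<^sub>F h in at_right 0. (0::real) < h" by (rule eventually_at_right_less)
  ultimately show "\<forall>\<^sub>F h in at_right 0. Pv h (\<lambda>j. exp (- c j * h) * \<phi> j) i \<le> exp (- \<mu>' * h) * \<phi> i"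
  proof eventually_elim
    case (elim h)
    have "Pv h (\<lambda>j. exp (- c j * h) * \<phi> j) i
      = Pv h \<phi> i + (\<Sum>j\<in>UNIV. P h i j * ((exp (- c j * h) - 1) * \<phi> j))"
      unfolding Pv_def sum.distrib[symmetric] by (simp add: algebra_simps)
    also have "(\<Sum>j\<in>UNIV. P h i j * ((exp (- c j * h) - 1) * \<phi> j))
      = h * (\<Sum>j\<in>UNIV. P h i j * ((exp (- c j * h) - 1) / h * \<phi> j))"
      unfolding sum_distrib_left using elim by (intro sum.cong) auto
    finally have 1: "Pv h (\<lambda>j. exp (- c j * h) * \<phi> j) i
      = Pv h \<phi> i + h * (\<Sum>j\<in>UNIV. P h i j * ((exp (- c j * h) - 1) / h * \<phi> j))" .
    have 2: "h * d h = Pv h \<phi> i - \<phi> i + h * (\<Sum>j\<in>UNIV. P h i j * ((exp (- c j * h) - 1) / h * \<phi> j))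
        - (exp (- \<mu>' * h) - 1) * \<phi> i"
      unfolding d_def right_diff_distrib distrib_left using elim by simp
    have "Pv h (\<lambda>j. exp (- c j * h) * \<phi> j) i - exp (- \<mu>' * h) * \<phi> i = h * d h"
      unfolding 1 2 by (simp add: left_diff_distrib)
    moreover have "h * d h \<le> 0" using elim by (simp add: mult_le_0_iff)
    ultimately show ?case by linarith
  qed
qed

end

section \<open>The Markov property of the chain\<close>

context stochastic_basis
begin

context
  fixes L :: "'s::finite \<Rightarrow> real \<Rightarrow> 'w \<Rightarrow> 's"
  assumes chain: "homogeneous_markov_chain M F L"
begin

lemma L_adapted: "adapted F (count_space UNIV) (L i)"
  and L_0: "\<omega> \<in> space M \<Longrightarrow> L i 0 \<omega> = i"
  and L_right: "\<omega> \<in> space M \<Longrightarrow> 0 \<le> t \<Longrightarrow> \<forall>\<^sub>F s in at_right t. L i s \<omega> = L i t \<omega>"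
  using chain by (auto simp: homogeneous_markov_chain_def switching_process_def)

lemma measurable_L_F: "0 \<le> s \<Longrightarrow> s \<le> t \<Longrightarrow> L i s \<in> F t \<rightarrow>\<^sub>M count_space UNIV"
proof -
  assume st: "0 \<le> s" "s \<le> t"
  have "subalgebra (F t) (F s)"
    using sets_F_mono[OF st(2)] by (simp add: subalgebra_def space_F)
  then show ?thesis
    using L_adapted[of i] st(1) by (auto simp: adapted_def intro: measurable_from_subalg)
qed

lemma measurable_L: "0 \<le> t \<Longrightarrow> L i t \<in> M \<rightarrow>\<^sub>M count_space UNIV"
  using measurable_adapted[OF L_adapted] .

lemma measurable_fun_L[measurable]: "0 \<le> t \<Longrightarrow> (\<lambda>\<omega>. g (L i t \<omega>)) \<in> borel_measurable M" for g :: "'s \<Rightarrow> real"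
  by (rule measurable_compose[OF measurable_L]) auto

lemma integrable_bounded_fun_L:
  fixes g :: "'s \<Rightarrow> real"
  assumes t: "0 \<le> t" and Y: "Y \<in> borel_measurable M" "\<And>\<omega>. \<omega> \<in> space M \<Longrightarrow> \<bar>Y \<omega>\<bar> \<le> C"
  shows "integrable M (\<lambda>\<omega>. Y \<omega> * g (L i t \<omega>))"
proof (rule integrable_const_bound[of _ "C * Max (range (\<lambda>j. \<bar>g j\<bar>))"])
  show "AE \<omega> in M. norm (Y \<omega> * g (L i t \<omega>)) \<le> C * Max (range (\<lambda>j. \<bar>g j\<bar>))"
    using Y(2) by (intro AE_I2) (auto simp: abs_mult intro!: mult_mono order_trans[OF _ Y(2)])
qed (use t Y in measurable)

lemma expectation_fun_L:
  fixes g :: "'s \<Rightarrow> real"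
  assumes t: "0 \<le> t"
  shows "(\<integral>\<omega>. g (L i t \<omega>) \<partial>M) = (\<Sum>j\<in>UNIV. trans_prob M L t i j * g j)"
proof -
  have sets: "{\<omega> \<in> space M. L i t \<omega> = j} \<in> sets M" for j
    using measurable_sets[OF measurable_L[OF t, of i], of "{j}"] by (simp add: vimage_def Int_def conj_commute)
  have "(\<integral>\<omega>. g (L i t \<omega>) \<partial>M) = (\<integral>\<omega>. (\<Sum>j\<in>UNIV. g j * indicator {\<omega> \<in> space M. L i t \<omega> = j} \<omega>) \<partial>M)"
  proof (intro Bochner_Integration.integral_cong refl)
    fix \<omega> assume "\<omega> \<in> space M"
    then have "(\<Sum>j\<in>UNIV. g j * indicator {\<omega> \<in> space M. L i t \<omega> = j} \<omega>) = (\<Sum>j\<in>UNIV. g j * of_bool (L i t \<omega> = j))"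
      by (intro sum.cong) (auto simp: indicator_def)
    then show "g (L i t \<omega>) = (\<Sum>j\<in>UNIV. g j * indicator {\<omega> \<in> space M. L i t \<omega> = j} \<omega>)"
      by (simp add: sum_mult_of_bool_eq)
  qed
  also have "\<dots> = (\<Sum>j\<in>UNIV. g j * measure M {\<omega> \<in> space M. L i t \<omega> = j})"
    using sets by (subst Bochner_Integration.integral_sum) (auto simp: emeasure_eq_measure intro!: integrable_real_indicator)
  finally show ?thesis by (simp add: trans_prob_def mult.commute)
qed

text \<open>The conditional expectation in integrated form, tested against bounded functions of the
  past. A function of finitely many regimes is a combination of indicators, for which the property
  is assumed.\<close>

lemma markov_property:
  fixes g :: "'s \<Rightarrow> real"
  assumes st: "0 \<le> s" "0 \<le> t" and Y: "Y \<in> borel_measurable (F s)" "\<And>\<omega>. \<omega> \<in> space M \<Longrightarrow> \<bar>Y \<omega>\<bar> \<le> C"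
  shows "(\<integral>\<omega>. Y \<omega> * g (L i (s + t) \<omega>) \<partial>M) = (\<integral>\<omega>. Y \<omega> * (\<Sum>j\<in>UNIV. trans_prob M L t (L i s \<omega>) j * g j) \<partial>M)"
proof -
  interpret finite_measure_subalgebra M "F s"
    by unfold_locales (rule subalg)
  have YM: "Y \<in> borel_measurable M" by (rule measurable_from_subalg[OF subalg Y(1)])
  have st': "0 \<le> s + t" using st by simp
  have int1: "integrable M (\<lambda>\<omega>. Y \<omega> * indicator {j} (L i (s + t) \<omega>))" for j :: 's
    by (rule integrable_bounded_fun_L[OF st' YM Y(2)])
  have eq: "(\<integral>\<omega>. Y \<omega> * indicator {j} (L i (s + t) \<omega>) \<partial>M) = (\<integral>\<omega>. Y \<omega> * trans_prob M L t (L i s \<omega>) j \<partial>M)" for j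
  proof -
    have "(\<integral>\<omega>. Y \<omega> * indicator {j} (L i (s + t) \<omega>) \<partial>M)
      = (\<integral>\<omega>. Y \<omega> * real_cond_exp M (F s) (\<lambda>\<omega>. indicator {j} (L i (s + t) \<omega>)) \<omega> \<partial>M)"
      by (rule real_cond_exp_intg(2)[symmetric, OF int1 Y(1) measurable_fun_L[OF st']])
    also have "\<dots> = (\<integral>\<omega>. Y \<omega> * trans_prob M L t (L i s \<omega>) j \<partial>M)"
    proof (rule integral_cong_AE)
      have "AE \<omega> in M. real_cond_exp M (F s) (\<lambda>\<omega>. indicator {j} (L i (s + t) \<omega>)) \<omega> = trans_prob M L t (L i s \<omega>) j"
        using chain st by (simp add: homogeneous_markov_chain_def)
      then show "AE \<omega> in M. Y \<omega> * real_cond_exp M (F s) (\<lambda>\<omega>. indicator {j} (L i (s + t) \<omega>)) \<omega>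
          = Y \<omega> * trans_prob M L t (L i s \<omega>) j"
        by eventually_elim simp
    qed (use YM st in \<open>auto intro!: borel_measurable_times measurable_fun_L\<close>)
    finally show ?thesis .
  qed
  have "(\<integral>\<omega>. Y \<omega> * g (L i (s + t) \<omega>) \<partial>M) = (\<integral>\<omega>. (\<Sum>j\<in>UNIV. g j * (Y \<omega> * indicator {j} (L i (s + t) \<omega>))) \<partial>M)"
  proof (intro Bochner_Integration.integral_cong refl)
    fix \<omega>
    have "(\<Sum>j\<in>UNIV. g j * (Y \<omega> * indicator {j} (L i (s + t) \<omega>))) = (\<Sum>j\<in>UNIV. (g j * Y \<omega>) * of_bool (L i (s + t) \<omega> = j))"
      by (intro sum.cong) (auto simp: indicator_def)
    then show "Y \<omega> * g (L i (s + t) \<omega>) = (\<Sum>j\<in>UNIV. g j * (Y \<omega> * indicator {j} (L i (s + t) \<omega>)))"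
      by (simp add: sum_mult_of_bool_eq)
  qed
  also have "\<dots> = (\<Sum>j\<in>UNIV. g j * (\<integral>\<omega>. Y \<omega> * trans_prob M L t (L i s \<omega>) j \<partial>M))"
    using int1 by (subst Bochner_Integration.integral_sum) (auto simp: eq)
  also have "\<dots> = (\<integral>\<omega>. (\<Sum>j\<in>UNIV. g j * (Y \<omega> * trans_prob M L t (L i s \<omega>) j)) \<partial>M)"
    using integrable_bounded_fun_L[OF st(1) YM Y(2), of "\<lambda>k. trans_prob M L t k j" for j]
    by (subst Bochner_Integration.integral_sum) auto
  also have "\<dots> = (\<integral>\<omega>. Y \<omega> * (\<Sum>j\<in>UNIV. trans_prob M L t (L i s \<omega>) j * g j) \<partial>M)"
    by (simp add: sum_distrib_left mult_ac)
  finally show ?thesis .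
qed

lemma finite_chain_trans_prob:
  assumes irr: "irreducible_rates (rate M L)" and inv: "invariant_prob M L lam"
  shows "finite_chain (trans_prob M L) (rate M L) lam"
proof
  fix t s :: real and i j :: 's
  show "0 \<le> trans_prob M L t i j" by (simp add: trans_prob_def)
  show "(\<Sum>j\<in>UNIV. trans_prob M L t i j) = 1" if "0 \<le> t"
    using expectation_fun_L[OF that, of "\<lambda>_. 1" i] by (simp add: prob_space)
  show "trans_prob M L 0 i j = of_bool (i = j)"
  proof -
    have "{\<omega> \<in> space M. L i 0 \<omega> = j} = (if i = j then space M else {})"
      using L_0 by auto
    then show ?thesis by (simp add: trans_prob_def prob_space)
  qed
  show "trans_prob M L (s + t) i j = (\<Sum>k\<in>UNIV. trans_prob M L s i k * trans_prob M L t k j)"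
    if st: "0 \<le> s" "0 \<le> t"
  proof -
    have "trans_prob M L (s + t) i j = (\<integral>\<omega>. of_bool (L i (s + t) \<omega> = j) \<partial>M)"
      using expectation_fun_L[of "s + t" "\<lambda>k. of_bool (k = j)" i] st by (simp add: sum_mult_of_bool_eq)
    also have "\<dots> = (\<integral>\<omega>. 1 * (\<Sum>k\<in>UNIV. trans_prob M L t (L i s \<omega>) k * of_bool (k = j)) \<partial>M)"
      using markov_property[OF st, of "\<lambda>_. 1" 1 "\<lambda>k. of_bool (k = j)" i] by simp
    also have "\<dots> = (\<integral>\<omega>. trans_prob M L t (L i s \<omega>) j \<partial>M)"
      by (simp add: sum_mult_of_bool_eq)
    also have "\<dots> = (\<Sum>k\<in>UNIV. trans_prob M L s i k * trans_prob M L t k j)"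
      using expectation_fun_L[OF st(1), of "\<lambda>k. trans_prob M L t k j" i] .
    finally show ?thesis .
  qed
  \<comment> \<open>\<open>Lim\<close> denotes a limit only where one exists, which
    \<open>switching_process\<close> guarantees.\<close>
  have lim: "((\<lambda>t. trans_prob M L t i j / t) \<longlongrightarrow> Lim (at_right 0) (\<lambda>t. trans_prob M L t i j / t)) (at_right 0)"
    if ij: "i \<noteq> j" for i j
  proof -
    obtain l where l: "((\<lambda>t. trans_prob M L t i j / t) \<longlongrightarrow> l) (at_right 0)"
      using chain ij unfolding homogeneous_markov_chain_def switching_process_def by blast
    then show ?thesis by (simp add: tendsto_Lim)
  qed
  show "((\<lambda>t. trans_prob M L t i j / t) \<longlongrightarrow> rate M L i j) (at_right 0)" if "i \<noteq> j"
    using lim[OF that] that by (simp add: rate_def Let_def)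
  show "rate M L i i = - (\<Sum>j\<in>UNIV - {i}. rate M L i j)"
    unfolding rate_def Let_def by (auto intro!: sum.cong)
qed (use irr inv in \<open>auto simp: invariant_prob_def\<close>)

lemma measurable_weight_product:
  fixes w :: "'s \<Rightarrow> real"
  assumes h: "0 \<le> h"
  shows "(\<lambda>\<omega>. \<Prod>k<m. w (L i (real (Suc k) * h) \<omega>)) \<in> borel_measurable (F (real m * h))"
proof (intro borel_measurable_prod measurable_compose[OF measurable_L_F])
  fix k assume "k \<in> {..<m}"
  then have "real (Suc k) \<le> real m" by simp
  then show "real (Suc k) * h \<le> real m * h" using h by (rule mult_right_mono)
qed (use h in auto)

text \<open>Discrete Feynman-Kac formula. The Markov property at the last but one grid time absorbs
  the last factor into \<open>R g\<close>; hence the induction over all \<open>g\<close>.\<close>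

lemma expectation_weight_product:
  fixes w g :: "'s \<Rightarrow> real"
  assumes h: "0 \<le> h" and w: "\<And>j. 0 \<le> w j" "\<And>j. w j \<le> 1"
  shows "(\<integral>\<omega>. (\<Prod>k<m. w (L i (real (Suc k) * h) \<omega>)) * g (L i (real m * h) \<omega>) \<partial>M)
    = ((\<lambda>v i. \<Sum>j\<in>UNIV. trans_prob M L h i j * (w j * v j)) ^^ m) g i"
proof (induction m arbitrary: g)
  case 0
  have "(\<integral>\<omega>. g (L i 0 \<omega>) \<partial>M) = (\<integral>\<omega>. g i \<partial>M)"
    using L_0 by (intro Bochner_Integration.integral_cong) auto
  then show ?case by (simp add: prob_space)
next
  case (Suc m)
  define Y where "Y \<omega> = (\<Prod>k<m. w (L i (real (Suc k) * h) \<omega>))" for \<omega>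
  define R where "R v i = (\<Sum>j\<in>UNIV. trans_prob M L h i j * (w j * v j))" for v :: "'s \<Rightarrow> real" and i
  have Y: "\<bar>Y \<omega>\<bar> \<le> 1" for \<omega>
    unfolding Y_def abs_prod using w by (intro prod_le_1) auto
  have "(\<integral>\<omega>. (\<Prod>k<Suc m. w (L i (real (Suc k) * h) \<omega>)) * g (L i (real (Suc m) * h) \<omega>) \<partial>M)
    = (\<integral>\<omega>. Y \<omega> * (w (L i (real m * h + h) \<omega>) * g (L i (real m * h + h) \<omega>)) \<partial>M)"
    unfolding Y_def by (simp add: mult_ac distrib_left add.commute)
  also have "\<dots> = (\<integral>\<omega>. Y \<omega> * R g (L i (real m * h) \<omega>) \<partial>M)"
    unfolding R_def
    using markov_property[of "real m * h" h Y 1 "\<lambda>j. w j * g j" i] h Y measurable_weight_product[OF h, where m=m and i=i and w=w]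
    unfolding Y_def[symmetric] by simp
  also have "\<dots> = (R ^^ m) (R g) i"
    using Suc.IH[of "R g"] unfolding Y_def[symmetric] R_def[symmetric] .
  finally show ?case
    unfolding R_def[symmetric] by (simp add: funpow_swap1)
qed

section \<open>Exponential moments and deviations of the clock\<close>

lemma integrable_fun_L_path:
  fixes c :: "'s \<Rightarrow> real"
  assumes "\<omega> \<in> space M"
  shows "(\<lambda>s. c (L i s \<omega>)) integrable_on {0..t}"
proof (cases "0 < t")
  case True
  show ?thesis
  proof (rule right_riemann_sum(1)[OF True, where B="Max (range (\<lambda>j. \<bar>c j\<bar>))"])
    show "\<forall>\<^sub>F r in at_right s. c (L i r \<omega>) = c (L i s \<omega>)" if "0 \<le> s" for s
      using L_right[OF assms that, of i] by eventually_elim simp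
  qed (auto intro!: Max_ge)
next
  case False
  have "(\<lambda>s. c (L i s \<omega>)) integrable_on cbox 0 t"
    using False by (intro integrable_on_null) auto
  then show ?thesis by simp
qed

lemma occupation_riemann:
  assumes "0 < t" "\<omega> \<in> space M"
  shows "(\<lambda>m. \<Sum>k<Suc m. t / real (Suc m) * c (L i (real (Suc k) * (t / real (Suc m))) \<omega>))
    \<longlonglongrightarrow> occupation L c i t \<omega>"
  unfolding occupation_def
proof (rule right_riemann_sum(2)[OF assms(1), where B="Max (range (\<lambda>j. \<bar>c j\<bar>))"])
  show "\<forall>\<^sub>F r in at_right s. c (L i r \<omega>) = c (L i s \<omega>)" if "0 \<le> s" for s
    using L_right[OF assms(2) that, of i] by eventually_elim simp
qed (auto intro!: Max_ge)

lemma measurable_occupation[measurable]: "0 \<le> t \<Longrightarrow> occupation L c i t \<in> borel_measurable M"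
proof (cases "t = 0")
  case False
  assume t: "0 \<le> t"
  show ?thesis
  proof (rule borel_measurable_LIMSEQ_real[OF occupation_riemann])
    show "(\<lambda>\<omega>. \<Sum>k<Suc m. t / real (Suc m) * c (L i (real (Suc k) * (t / real (Suc m))) \<omega>)) \<in> borel_measurable M" for m
      using t by (intro borel_measurable_sum borel_measurable_times measurable_fun_L) auto
  qed (use t False in auto)
qed (simp add: occupation_def[abs_def])

lemma occupation_nonneg: "(\<And>j. 0 \<le> c j) \<Longrightarrow> \<omega> \<in> space M \<Longrightarrow> 0 \<le> occupation L c i t \<omega>"
  unfolding occupation_def using integrable_fun_L_path
  by (intro Henstock_Kurzweil_Integration.integral_nonneg) auto

lemma occupation_scale: "occupation L (\<lambda>j. a * c j) i t \<omega> = a * occupation L c i t \<omega>"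
  by (simp add: occupation_def)

lemma integrable_exp_occupation:
  assumes "\<And>j. 0 \<le> c j" "0 \<le> t"
  shows "integrable M (\<lambda>\<omega>. exp (- occupation L c i t \<omega>))"
  using assms occupation_nonneg[of c]
  by (intro integrable_const_bound[of _ 1] AE_I2) auto

text \<open>On a grid the exponential of the Riemann sum is a product of weights. Inserting
  \<open>\<phi> \<ge> 1\<close> at the final time makes its mean an iterate of the weighted kernel,
  to which \<open>supersolution_step\<close> applies cell by cell; the mesh then tends to 0 by
  dominated convergence.\<close>

lemma exp_occupation_supersolution:
  assumes fc: "finite_chain (trans_prob M L) q lam"
    and c: "\<And>j. 0 \<le> c j" and \<phi>: "\<And>j. 1 \<le> \<phi> j"
    and super: "\<And>i. finite_chain.Qv q \<phi> i - c i * \<phi> i \<le> - \<mu> * \<phi> i" and \<mu>: "\<mu>' < \<mu>"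
    and t: "0 \<le> t"
  shows "(\<integral>\<omega>. exp (- occupation L c i t \<omega>) \<partial>M) \<le> exp (- \<mu>' * t) * \<phi> i"
proof (cases "t = 0")
  case True
  then show ?thesis using \<phi>[of i] by (simp add: occupation_def prob_space)
next
  case False
  then have t: "0 < t" using t by simp
  interpret fc: finite_chain "trans_prob M L" q lam by (rule fc)
  define h where "h m = t / real (Suc m)" for m
  have h: "0 < h m" for m using t by (simp add: h_def)
  define S where "S m \<omega> = (\<Sum>k<Suc m. h m * c (L i (real (Suc k) * h m) \<omega>))" for m \<omega>
  have S: "(\<lambda>m. S m \<omega>) \<longlonglongrightarrow> occupation L c i t \<omega>" if "\<omega> \<in> space M" for \<omega>
    using occupation_riemann[OF t that] unfolding S_def h_def .
  have S_meas[measurable]: "S m \<in> borel_measurable M" for m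
    unfolding S_def using h[of m]
    by (intro borel_measurable_sum borel_measurable_times measurable_fun_L) auto
  have S_nonneg: "0 \<le> S m \<omega>" for m \<omega>
    unfolding S_def using c h[of m] by (intro sum_nonneg mult_nonneg_nonneg) auto
  have lim: "(\<lambda>m. \<integral>\<omega>. exp (- S m \<omega>) \<partial>M) \<longlonglongrightarrow> (\<integral>\<omega>. exp (- occupation L c i t \<omega>) \<partial>M)"
    using t S S_nonneg
    by (intro integral_dominated_convergence[of _ _ _ "\<lambda>_. 1"]) (auto intro!: tendsto_intros AE_I2)
  have "filterlim h (at_right 0) sequentially"
    unfolding filterlim_at
    using h LIMSEQ_Suc[OF lim_const_over_n[of t]] by (auto simp: h_def[abs_def])
  from eventually_compose_filterlim[OF fc.supersolution_step[of \<phi> c \<mu> \<mu>'] this]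
  have "\<forall>\<^sub>F m in sequentially. \<forall>i. fc.Pv (h m) (\<lambda>j. exp (- c j * h m) * \<phi> j) i \<le> exp (- \<mu>' * h m) * \<phi> i"
    using \<phi> super \<mu> by (metis less_le_trans zero_less_one)
  then have "\<forall>\<^sub>F m in sequentially. (\<integral>\<omega>. exp (- S m \<omega>) \<partial>M) \<le> exp (- \<mu>' * t) * \<phi> i"
  proof eventually_elim
    case (elim m)
    define w where "w j = exp (- c j * h m)" for j
    define R where "R v i = (\<Sum>j\<in>UNIV. trans_prob M L (h m) i j * (w j * v j))" for v i
    have R_mono: "R v i \<le> R v' i" if "\<And>j. v j \<le> v' j" for v v' i
      unfolding R_def using that by (intro sum_mono mult_left_mono) (auto simp: w_def trans_prob_def)
    have R_scale: "R (\<lambda>j. a * v j) i = a * R v i" for a v i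
      unfolding R_def by (simp add: sum_distrib_left mult_ac)
    have R_step: "R \<phi> i \<le> exp (- \<mu>' * h m) * \<phi> i" for i
      using elim unfolding fc.Pv_def R_def w_def by simp
    have R_iter: "(R ^^ n) \<phi> i \<le> exp (- \<mu>' * h m) ^ n * \<phi> i" for n i
    proof (induction n arbitrary: i)
      case (Suc n)
      have "(R ^^ Suc n) \<phi> i \<le> R (\<lambda>j. exp (- \<mu>' * h m) ^ n * \<phi> j) i"
        using Suc.IH by (simp add: R_mono)
      also have "\<dots> \<le> exp (- \<mu>' * h m) ^ n * (exp (- \<mu>' * h m) * \<phi> i)"
        unfolding R_scale by (intro mult_left_mono R_step) simp
      finally show ?case by (simp add: mult_ac)
    qed simp
    have exp_S: "exp (- S m \<omega>) = (\<Prod>k<Suc m. w (L i (real (Suc k) * h m) \<omega>))" for \<omega>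
      unfolding S_def w_def by (subst exp_sum[symmetric]) (auto simp: sum_negf mult.commute simp del: sum.lessThan_Suc)
    have meas: "exp (- S m \<omega>) \<le> 1" "0 \<le> exp (- S m \<omega>)" for \<omega> using S_nonneg[of m \<omega>] by auto
    have "(\<integral>\<omega>. exp (- S m \<omega>) \<partial>M) \<le> (\<integral>\<omega>. exp (- S m \<omega>) * \<phi> (L i (real (Suc m) * h m) \<omega>) \<partial>M)"
    proof (rule integral_mono)
      show "integrable M (\<lambda>\<omega>. exp (- S m \<omega>))"
        using meas by (intro integrable_const_bound[of _ 1]) auto
      show "integrable M (\<lambda>\<omega>. exp (- S m \<omega>) * \<phi> (L i (real (Suc m) * h m) \<omega>))"
        using h[of m] meas by (intro integrable_bounded_fun_L[where C=1]) auto
      show "exp (- S m \<omega>) \<le> exp (- S m \<omega>) * \<phi> (L i (real (Suc m) * h m) \<omega>)" for \<omega>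
        using \<phi> by simp
    qed
    also have "\<dots> = (R ^^ Suc m) \<phi> i"
      unfolding exp_S R_def using c h[of m]
      by (intro expectation_weight_product) (auto simp: w_def less_imp_le)
    also have "\<dots> \<le> exp (- \<mu>' * h m) ^ Suc m * \<phi> i" by (rule R_iter)
    also have "exp (- \<mu>' * h m) ^ Suc m = exp (- \<mu>' * t)"
      unfolding exp_of_nat_mult[symmetric] by (simp add: h_def)
    finally show ?case .
  qed
  then show ?thesis
    by (intro tendsto_upperbound[OF lim]) auto
qed

text \<open>For \<open>\<phi> = 1 + \<theta> * g\<close> the terms \<open>\<theta> * c i\<close>
  cancel. What is left is at most minus \<open>\<theta>\<close> times the mean of \<open>c\<close>,
  and \<open>\<phi> \<le> 1 + \<theta> * G\<close> turns this constant into a multiple of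
  \<open>\<phi>\<close>.\<close>

lemma exp_occupation_poisson:
  assumes fc: "finite_chain (trans_prob M L) q lam" and c: "\<And>j. 0 \<le> c j"
    and g: "\<And>i. finite_chain.Qv q g i = c i - (\<Sum>j\<in>UNIV. lam j * c j)" "\<And>i. 0 \<le> g i" "\<And>i. g i \<le> G"
    and \<theta>: "0 < \<theta>" and \<mu>: "\<mu>' < \<theta> * (\<Sum>j\<in>UNIV. lam j * c j) / (1 + \<theta> * G)" and t: "0 \<le> t"
  shows "(\<integral>\<omega>. exp (- \<theta> * occupation L c i t \<omega>) \<partial>M) \<le> (1 + \<theta> * G) * exp (- \<mu>' * t)"
proof -
  interpret fc: finite_chain "trans_prob M L" q lam by (rule fc)
  define cbar where "cbar = (\<Sum>j\<in>UNIV. lam j * c j)"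
  define \<phi> where "\<phi> j = 1 + \<theta> * g j" for j
  have cbar: "0 \<le> cbar" unfolding cbar_def using c fc.lam_nonneg by (intro sum_nonneg) auto
  have G: "0 \<le> G" using g(2,3) order_trans by blast
  have \<phi>G: "\<phi> j \<le> 1 + \<theta> * G" for j using g(3)[of j] \<theta> by (simp add: \<phi>_def)
  have "(\<integral>\<omega>. exp (- occupation L (\<lambda>j. \<theta> * c j) i t \<omega>) \<partial>M) \<le> exp (- \<mu>' * t) * \<phi> i"
  proof (rule exp_occupation_supersolution[OF fc _ _ _ \<mu> t])
    show "0 \<le> \<theta> * c j" for j using \<theta> c by simp
    show "1 \<le> \<phi> j" for j using \<theta> g(2)[of j] by (simp add: \<phi>_def)
    fix i
    have "fc.Qv \<phi> i = \<theta> * (c i - cbar)"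
    proof -
      have "fc.Qv \<phi> i = \<theta> * fc.Qv g i"
        unfolding fc.Qv_eq_diff \<phi>_def by (simp add: sum_distrib_left algebra_simps)
      then show ?thesis by (simp add: g(1) cbar_def)
    qed
    then have "fc.Qv \<phi> i - \<theta> * c i * \<phi> i = - \<theta> * cbar - \<theta> * c i * (\<theta> * g i)"
      by (simp add: \<phi>_def algebra_simps)
    also have "\<dots> \<le> - (\<theta> * cbar)"
      using \<theta> c[of i] g(2)[of i] by simp
    also have "\<dots> \<le> - (\<theta> * cbar * (\<phi> i / (1 + \<theta> * G)))"
    proof -
      have "0 < 1 + \<theta> * G" using \<theta> G by (simp add: add_pos_nonneg)
      then have "\<phi> i / (1 + \<theta> * G) \<le> 1" using \<phi>G[of i] by simp
      then have "\<theta> * cbar * (\<phi> i / (1 + \<theta> * G)) \<le> \<theta> * cbar * 1"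
        using \<theta> cbar by (intro mult_left_mono) auto
      then show ?thesis by simp
    qed
    finally show "fc.Qv \<phi> i - \<theta> * c i * \<phi> i \<le> - (\<theta> * (\<Sum>j\<in>UNIV. lam j * c j) / (1 + \<theta> * G)) * \<phi> i"
      by (simp add: cbar_def)
  qed
  also have "\<dots> \<le> exp (- \<mu>' * t) * (1 + \<theta> * G)"
    using \<phi>G by (intro mult_left_mono) auto
  finally show ?thesis by (simp add: occupation_scale mult.commute)
qed

text \<open>Exponential Chebyshev inequality: the decay of the moment has to beat the growth
  \<open>\<theta> * cbar * (1 - \<delta>)\<close> of the compensating factor.\<close>

lemma occupation_deviation:
  assumes fc: "finite_chain (trans_prob M L) q lam" and c: "\<And>j. 0 \<le> c j"
    and pos: "0 < (\<Sum>j\<in>UNIV. lam j * c j)" and \<delta>: "0 < \<delta>" "\<delta> < 1"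
  shows "\<exists>C r. 0 < r \<and> (\<forall>i. \<forall>t\<ge>0.
    measure M {\<omega>\<in>space M. occupation L c i t \<omega> \<le> (1 - \<delta>) * (\<Sum>j\<in>UNIV. lam j * c j) * t} \<le> C * exp (- r * t))"
proof -
  interpret fc: finite_chain "trans_prob M L" q lam by (rule fc)
  define cbar where "cbar = (\<Sum>j\<in>UNIV. lam j * c j)"
  have cbar: "0 < cbar" using pos by (simp add: cbar_def)
  obtain g G where g: "\<And>i. fc.Qv g i = c i - cbar" "\<And>i. 0 \<le> g i" "\<And>i. g i \<le> G"
    using fc.poisson_nonneg[of c] unfolding cbar_def by blast
  have G: "0 \<le> G" using g(2,3) order_trans by blast
  \<comment> \<open>Small enough that \<open>(1 - \<delta>) * (1 + \<theta> * G)\<close> is at most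
    \<open>1 - \<delta>\<close> times \<open>1 + \<delta>\<close>, hence below 1; this leaves room
    for \<open>\<mu>\<close>.\<close>
  define \<theta> where "\<theta> = \<delta> / (1 + G)"
  have \<theta>: "0 < \<theta>" using \<delta> G by (simp add: \<theta>_def)
  have "\<theta> * G \<le> \<delta>"
    using G \<delta> by (simp add: \<theta>_def field_simps)
  then have "(1 - \<delta>) * (1 + \<theta> * G) \<le> (1 - \<delta>) * (1 + \<delta>)"
    using \<delta> by (intro mult_left_mono) auto
  also have "\<dots> < 1" using \<delta> by (simp add: algebra_simps)
  finally have "1 - \<delta> < 1 / (1 + \<theta> * G)"
    using \<theta> G by (simp add: pos_less_divide_eq add_pos_nonneg)
  then have "\<theta> * cbar * (1 - \<delta>) < \<theta> * cbar * (1 / (1 + \<theta> * G))"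
    using \<theta> cbar by (intro mult_strict_left_mono) auto
  then obtain \<mu> where \<mu>: "\<theta> * cbar * (1 - \<delta>) < \<mu>" "\<mu> < \<theta> * cbar / (1 + \<theta> * G)"
    using dense by auto
  have "measure M {\<omega>\<in>space M. occupation L c i t \<omega> \<le> (1 - \<delta>) * cbar * t}
      \<le> (1 + \<theta> * G) * exp (- (\<mu> - \<theta> * cbar * (1 - \<delta>)) * t)" if t: "0 \<le> t" for i t
  proof -
    define A where "A = {\<omega>\<in>space M. occupation L c i t \<omega> \<le> (1 - \<delta>) * cbar * t}"
    define E where "E \<omega> = exp (\<theta> * ((1 - \<delta>) * cbar * t)) * exp (- \<theta> * occupation L c i t \<omega>)" for \<omega>
    have [measurable]: "A \<in> sets M" unfolding A_def using t by measurable
    have "integrable M (\<lambda>\<omega>. exp (- occupation L (\<lambda>j. \<theta> * c j) i t \<omega>))"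
      using \<theta> c t by (intro integrable_exp_occupation) auto
    then have intE: "integrable M E"
      unfolding E_def by (simp add: occupation_scale)
    have "measure M A = (\<integral>\<omega>. indicator A \<omega> \<partial>M)" by simp
    also have "\<dots> \<le> (\<integral>\<omega>. E \<omega> \<partial>M)"
    proof (rule integral_mono[OF _ intE])
      show "indicator A \<omega> \<le> E \<omega>" for \<omega>
      proof (cases "\<omega> \<in> A")
        case True
        then have "\<theta> * occupation L c i t \<omega> \<le> \<theta> * ((1 - \<delta>) * cbar * t)"
          using \<theta> by (intro mult_left_mono) (auto simp: A_def)
        then show ?thesis
          unfolding E_def exp_add[symmetric] by (simp add: True)
      qed (simp add: E_def)
    qed (auto simp: emeasure_eq_measure intro!: integrable_real_indicator)
    also have "\<dots> = exp (\<theta> * ((1 - \<delta>) * cbar * t)) * (\<integral>\<omega>. exp (- \<theta> * occupation L c i t \<omega>) \<partial>M)"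
      unfolding E_def by simp
    also have "\<dots> \<le> exp (\<theta> * ((1 - \<delta>) * cbar * t)) * ((1 + \<theta> * G) * exp (- \<mu> * t))"
      using exp_occupation_poisson[OF fc c, where g=g and G=G and \<theta>=\<theta> and \<mu>'=\<mu> and t=t and i=i] g \<theta> \<mu> t
      by (intro mult_left_mono) (auto simp: cbar_def)
    also have "\<dots> = (1 + \<theta> * G) * exp (- (\<mu> - \<theta> * cbar * (1 - \<delta>)) * t)"
      by (simp add: exp_add[symmetric] mult.left_commute algebra_simps)
    finally show ?thesis by (simp add: A_def)
  qed
  with \<mu>(1) show ?thesis
    unfolding cbar_def[symmetric]
    by (intro exI[of _ "1 + \<theta> * G"] exI[of _ "\<mu> - \<theta> * cbar * (1 - \<delta>)"]) auto
qed

end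

end

section \<open>Couplings\<close>

text \<open>\<open>D\<close> stands for the pairs with equal regimes. With kernels, gluing the
  phases at the meeting is a \<open>bind\<close>, which is why \<open>sync t\<close> must be
  measurable in the starting pair.\<close>

locale coupled_kernels =
  fixes S :: "'z measure" and \<K> :: "real \<Rightarrow> 'z \<Rightarrow> 'z measure" and D :: "('z \<times> 'z) set"
    and sync :: "real \<Rightarrow> 'z \<times> 'z \<Rightarrow> ('z \<times> 'z) measure"
  assumes kernel[measurable]: "0 \<le> t \<Longrightarrow> \<K> t \<in> S \<rightarrow>\<^sub>M prob_algebra S"
    and chapman_kolmogorov: "0 \<le> s \<Longrightarrow> 0 \<le> t \<Longrightarrow> z \<in> space S \<Longrightarrow> \<K> (s + t) z = \<K> s z \<bind> \<K> t"
    and sync[measurable]: "0 \<le> t \<Longrightarrow> sync t \<in> S \<Otimes>\<^sub>M S \<rightarrow>\<^sub>M prob_algebra (S \<Otimes>\<^sub>M S)"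
    and sync_fst: "0 \<le> t \<Longrightarrow> q \<in> space (S \<Otimes>\<^sub>M S) \<Longrightarrow> distr (sync t q) S fst = \<K> t (fst q)"
    and sync_snd: "0 \<le> t \<Longrightarrow> q \<in> space (S \<Otimes>\<^sub>M S) \<Longrightarrow> distr (sync t q) S snd = \<K> t (snd q)"
    and D[measurable]: "D \<in> sets (S \<Otimes>\<^sub>M S)"
begin

definition product :: "real \<Rightarrow> 'z \<times> 'z \<Rightarrow> ('z \<times> 'z) measure" where
  "product t q = \<K> t (fst q) \<Otimes>\<^sub>M \<K> t (snd q)"

lemma product[measurable]: "0 \<le> t \<Longrightarrow> product t \<in> S \<Otimes>\<^sub>M S \<rightarrow>\<^sub>M prob_algebra (S \<Otimes>\<^sub>M S)"
  unfolding product_def[abs_def]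
  by (intro measurable_pair_prob measurable_compose[OF measurable_fst] measurable_compose[OF measurable_snd] kernel)

lemma prob_space_kernel: "0 \<le> t \<Longrightarrow> z \<in> space S \<Longrightarrow> prob_space (\<K> t z) \<and> sets (\<K> t z) = sets S"
  using measurable_space[OF kernel] by (auto simp: space_prob_algebra)

lemma product_marginals:
  assumes t: "0 \<le> t" and q: "q \<in> space (S \<Otimes>\<^sub>M S)"
  shows "distr (product t q) S fst = \<K> t (fst q)" "distr (product t q) S snd = \<K> t (snd q)"
proof -
  have q': "fst q \<in> space S" "snd q \<in> space S" using q by (auto simp: space_pair_measure)
  interpret P1: prob_space "\<K> t (fst q)" using prob_space_kernel[OF t q'(1)] by simp
  interpret P2: prob_space "\<K> t (snd q)" using prob_space_kernel[OF t q'(2)] by simp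
  interpret pair_prob_space "\<K> t (fst q)" "\<K> t (snd q)" ..
  have sets: "sets (\<K> t (fst q)) = sets S" "sets (\<K> t (snd q)) = sets S"
    using prob_space_kernel[OF t q'(1)] prob_space_kernel[OF t q'(2)] by auto
  show "distr (product t q) S fst = \<K> t (fst q)"
    unfolding product_def using P2.distr_pair_fst[of "\<K> t (fst q)"]
    by (subst distr_cong[OF refl sets(1)[symmetric] refl])
  have "distr (product t q) S snd = distr (\<K> t (fst q) \<Otimes>\<^sub>M \<K> t (snd q)) (\<K> t (snd q)) snd"
    unfolding product_def by (subst distr_cong[OF refl sets(2)[symmetric] refl]) (rule refl)
  also have "\<dots> = distr (distr (\<K> t (snd q) \<Otimes>\<^sub>M \<K> t (fst q)) (\<K> t (fst q) \<Otimes>\<^sub>M \<K> t (snd q)) (\<lambda>(x, y). (y, x))) (\<K> t (snd q)) snd"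
    by (subst distr_pair_swap) (rule refl)
  also have "\<dots> = distr (\<K> t (snd q) \<Otimes>\<^sub>M \<K> t (fst q)) (\<K> t (snd q)) fst"
    by (subst distr_distr) (auto simp: o_def split_beta')
  also have "\<dots> = \<K> t (snd q)" by (rule P1.distr_pair_fst)
  finally show "distr (product t q) S snd = \<K> t (snd q)" .
qed

text \<open>\<open>D\<close> is tested at the start and after each of \<open>n\<close> unit steps;
  the leftover time \<open>T\<close> comes last. A pair found in \<open>D\<close> at one of these
  tests therefore has at least \<open>T\<close> left for synchronous motion.\<close>

primrec coupling :: "real \<Rightarrow> nat \<Rightarrow> 'z \<times> 'z \<Rightarrow> ('z \<times> 'z) measure" where
  "coupling T 0 q = (if q \<in> D then sync T q else product T q)"
| "coupling T (Suc n) q = (if q \<in> D then sync (T + real (Suc n)) q else product 1 q \<bind> coupling T n)"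

lemma coupling_in_D: "q \<in> D \<Longrightarrow> coupling T n q = sync (T + real n) q"
  by (cases n) auto

lemma coupling[measurable]:
  assumes T: "0 \<le> T"
  shows "coupling T n \<in> S \<Otimes>\<^sub>M S \<rightarrow>\<^sub>M prob_algebra (S \<Otimes>\<^sub>M S)"
proof (induction n)
  case 0
  have "(\<lambda>q. if q \<in> D then sync T q else product T q) \<in> S \<Otimes>\<^sub>M S \<rightarrow>\<^sub>M prob_algebra (S \<Otimes>\<^sub>M S)"
    using T by (intro measurable_If_set sync product) (auto simp: D[THEN sets.Int_space_eq1] D[THEN sets.Int_space_eq2])
  then show ?case by (simp cong: measurable_cong)
next
  case (Suc n)
  have "(\<lambda>q. if q \<in> D then sync (T + real (Suc n)) q else product 1 q \<bind> coupling T n)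
      \<in> S \<Otimes>\<^sub>M S \<rightarrow>\<^sub>M prob_algebra (S \<Otimes>\<^sub>M S)"
    using T by (intro measurable_If_set sync measurable_bind_prob_space[OF product Suc])
      (auto simp: D[THEN sets.Int_space_eq1] D[THEN sets.Int_space_eq2])
  then show ?case by (simp cong: measurable_cong)
qed

text \<open>A projection commutes with \<open>bind\<close>, so the kernel of the first unit and that
  of the remaining time compose by Chapman-Kolmogorov.\<close>

lemma coupling_marginals:
  assumes T: "0 \<le> T" and q: "q \<in> space (S \<Otimes>\<^sub>M S)"
  shows "distr (coupling T n q) S fst = \<K> (T + real n) (fst q) \<and> distr (coupling T n q) S snd = \<K> (T + real n) (snd q)"
  using q
proof (induction n arbitrary: q)
  case 0
  then show ?case using T by (simp add: sync_fst sync_snd product_marginals)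
next
  case (Suc n)
  have q': "fst q \<in> space S" "snd q \<in> space S" using Suc.prems by (auto simp: space_pair_measure)
  have N: "product 1 q \<in> space (prob_algebra (S \<Otimes>\<^sub>M S))"
    using measurable_space[OF product Suc.prems] by simp
  then have sN: "sets (product 1 q) = sets (S \<Otimes>\<^sub>M S)" "space (product 1 q) = space (S \<Otimes>\<^sub>M S)"
    by (auto simp: space_prob_algebra dest: sets_eq_imp_space_eq)
  have ne: "space (product 1 q) \<noteq> {}" using Suc.prems sN by auto
  have K: "coupling T n \<in> product 1 q \<rightarrow>\<^sub>M subprob_algebra (S \<Otimes>\<^sub>M S)"
    using measurable_prob_algebraD[OF coupling[OF T, of n]] sN by (simp cong: measurable_cong_sets)
  have marg: "distr (product 1 q \<bind> coupling T n) S \<pi> = \<K> (T + real (Suc n)) (\<pi> q)"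
    if \<pi>[measurable]: "\<pi> \<in> S \<Otimes>\<^sub>M S \<rightarrow>\<^sub>M S"
      and IH: "\<And>q. q \<in> space (S \<Otimes>\<^sub>M S) \<Longrightarrow> distr (coupling T n q) S \<pi> = \<K> (T + real n) (\<pi> q)"
      and prod: "distr (product 1 q) S \<pi> = \<K> 1 (\<pi> q)" for \<pi>
  proof -
    have \<pi>': "\<pi> \<in> product 1 q \<rightarrow>\<^sub>M S" using \<pi> sN by (simp cong: measurable_cong_sets)
    have "distr (product 1 q \<bind> coupling T n) S \<pi> = product 1 q \<bind> (\<lambda>q. distr (coupling T n q) S \<pi>)"
      by (rule distr_bind[OF K ne \<pi>])
    also have "\<dots> = product 1 q \<bind> (\<lambda>q. \<K> (T + real n) (\<pi> q))"
      using sN by (intro bind_cong_All) (auto simp: IH)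
    also have "\<dots> = distr (product 1 q) S \<pi> \<bind> \<K> (T + real n)"
      using T by (intro bind_distr[symmetric, OF \<pi>' measurable_prob_algebraD[OF kernel] ne]) auto
    also have "\<dots> = \<K> (1 + (T + real n)) (\<pi> q)"
      unfolding prod using T measurable_space[OF \<pi> Suc.prems] by (intro chapman_kolmogorov[symmetric]) auto
    finally show ?thesis by (simp add: add_ac)
  qed
  show ?case
    using marg[of fst] marg[of snd] Suc.IH Suc.prems product_marginals[of 1 q] T
    by (simp add: sync_fst sync_snd)
qed

text \<open>
  Each unit of time before the regimes meet is survived with probability at most \<open>1 - \<zeta>\<close>; after the
  meeting the cost is that of the synchronous coupling over the remaining time.
\<close>
lemma coupling_cost:
  assumes T: "0 \<le> T" and r[measurable]: "r \<in> borel_measurable (S \<Otimes>\<^sub>M S)"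
    and s: "\<And>q n. q \<in> D \<Longrightarrow> (\<integral>\<^sup>+w. r w \<partial>sync (T + real n) q) \<le> ennreal (s n)"
    and r_le: "\<And>w. r w \<le> ennreal (d 0)"
    and meet: "\<And>q. q \<in> space (S \<Otimes>\<^sub>M S) \<Longrightarrow> q \<notin> D \<Longrightarrow> \<zeta> \<le> measure (product 1 q) D"
    and s_nonneg: "\<And>n. 0 \<le> s n" and sd: "\<And>n. s n \<le> d n"
    and rec: "\<And>n. \<zeta> * s n + (1 - \<zeta>) * d n \<le> d (Suc n)"
    and q: "q \<in> space (S \<Otimes>\<^sub>M S)"
  shows "(\<integral>\<^sup>+w. r w \<partial>coupling T n q) \<le> ennreal (d n)"
  using q
proof (induction n arbitrary: q)
  case 0
  have "prob_space (coupling T 0 q)"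
    using measurable_space[OF coupling[OF T] 0] by (auto simp: space_prob_algebra simp del: coupling.simps)
  then interpret prob_space "coupling T 0 q" .
  have "(\<integral>\<^sup>+w. r w \<partial>coupling T 0 q) \<le> (\<integral>\<^sup>+w. ennreal (d 0) \<partial>coupling T 0 q)"
    using r_le by (intro nn_integral_mono)
  then show ?case by (simp add: emeasure_space_1 del: coupling.simps)
next
  case (Suc n)
  show ?case
  proof (cases "q \<in> D")
    case True
    then show ?thesis
      unfolding coupling_in_D[OF True] using s[OF True, of "Suc n"] sd[of "Suc n"] by (meson ennreal_leI order_trans)
  next
    case False
    have N: "product 1 q \<in> space (prob_algebra (S \<Otimes>\<^sub>M S))"
      using measurable_space[OF product Suc.prems] by simp
    then have sN: "sets (product 1 q) = sets (S \<Otimes>\<^sub>M S)" "space (product 1 q) = space (S \<Otimes>\<^sub>M S)"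
      by (auto simp: space_prob_algebra dest: sets_eq_imp_space_eq)
    interpret N: prob_space "product 1 q" using N by (simp add: space_prob_algebra)
    have K: "coupling T n \<in> product 1 q \<rightarrow>\<^sub>M subprob_algebra (S \<Otimes>\<^sub>M S)"
      using measurable_prob_algebraD[OF coupling[OF T, of n]] sN by (simp cong: measurable_cong_sets)
    have DN[measurable]: "D \<in> sets (product 1 q)" using D sN by simp
    define m where "m = measure (product 1 q) D"
    have m: "\<zeta> \<le> m" "0 \<le> m" "m \<le> 1" using meet[OF Suc.prems False] by (auto simp: m_def)
    have d: "0 \<le> d n" using s_nonneg sd order_trans by blast
    have "(\<integral>\<^sup>+w. r w \<partial>coupling T (Suc n) q) = (\<integral>\<^sup>+q'. (\<integral>\<^sup>+w. r w \<partial>coupling T n q') \<partial>product 1 q)"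
      using False by (simp add: nn_integral_bind[OF r K])
    also have "\<dots> \<le> (\<integral>\<^sup>+q'. ennreal (s n) * indicator D q' + ennreal (d n) * indicator (space (product 1 q) - D) q' \<partial>product 1 q)"
    proof (rule nn_integral_mono)
      fix q' assume q': "q' \<in> space (product 1 q)"
      show "(\<integral>\<^sup>+w. r w \<partial>coupling T n q') \<le> ennreal (s n) * indicator D q' + ennreal (d n) * indicator (space (product 1 q) - D) q'"
      proof (cases "q' \<in> D")
        case True
        then show ?thesis unfolding coupling_in_D[OF True] using s[OF True, of n] by simp
      qed (use Suc.IH[of q'] q' sN in simp)
    qed
    also have "\<dots> = ennreal (s n) * emeasure (product 1 q) D + ennreal (d n) * emeasure (product 1 q) (space (product 1 q) - D)"
      by (subst nn_integral_add) (auto simp: nn_integral_cmult_indicator)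
    also have "\<dots> = ennreal (s n * m + d n * (1 - m))"
      unfolding N.emeasure_eq_measure N.prob_compl[OF DN] m_def[symmetric]
      using s_nonneg d m by (simp add: ennreal_mult ennreal_plus)
    also have "\<dots> \<le> ennreal (d (Suc n))"
    proof (rule ennreal_leI)
      \<comment> \<open>A meeting probability above \<open>\<zeta>\<close> only helps, because
        \<open>s n \<le> d n\<close>.\<close>
      have "\<zeta> * (d n - s n) \<le> m * (d n - s n)"
        using m sd[of n] by (intro mult_right_mono) auto
      then show "s n * m + d n * (1 - m) \<le> d (Suc n)"
        using rec[of n] by (simp add: algebra_simps)
    qed
    finally show ?thesis .
  qed
qed

end

section \<open>Pathwise contraction of the diffusion\<close>

locale contractive_diffusion = regime_diffusion M F B b \<sigma> X \<Lambda> \<sigma>\<^sub>0 \<Lambda>\<^sub>0 + concave_mono f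
  for M :: "'w measure" and F :: "real \<Rightarrow> 'w measure"
    and B :: "real \<Rightarrow> 'w \<Rightarrow> real ^ 'n"
    and b :: "real ^ 'd \<Rightarrow> 's::finite \<Rightarrow> real ^ 'd"
    and \<sigma> :: "real ^ 'd \<Rightarrow> 's \<Rightarrow> real ^ 'n ^ 'd"
    and X :: "real ^ 'd \<Rightarrow> 's \<Rightarrow> real \<Rightarrow> 'w \<Rightarrow> real ^ 'd"
    and \<Lambda> :: "real ^ 'd \<Rightarrow> 's \<Rightarrow> real \<Rightarrow> 'w \<Rightarrow> 's"
    and \<sigma>\<^sub>0 :: "'s \<Rightarrow> real ^ 'n ^ 'd"
    and \<Lambda>\<^sub>0 :: "'s \<Rightarrow> real \<Rightarrow> 'w \<Rightarrow> 's"
    and f :: "real \<Rightarrow> real" +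
  fixes \<psi> :: "real \<Rightarrow> real" and \<Gamma> :: "'s \<Rightarrow> real" and R :: real
  assumes f_zero: "f 0 = 0" and f_pos: "\<And>u. 0 < u \<Longrightarrow> 0 < f u" and f_le: "\<And>u. 0 \<le> u \<Longrightarrow> f u \<le> R"
    and \<psi>_convex: "convex_on {0..} \<psi>" and \<psi>_zero: "\<psi> 0 = 0" and \<psi>_pos: "\<And>u. 0 < u \<Longrightarrow> 0 < \<psi> u"
    and \<Gamma>_nonpos: "\<And>i. \<Gamma> i \<le> 0" and \<Gamma>_neg: "\<exists>k. \<Gamma> k < 0"
    and diss: "\<And>i. dissipative f \<psi> (\<Gamma> i) (\<lambda>x. b x i)"
begin

lemma f_nonneg: "0 \<le> u \<Longrightarrow> 0 \<le> f u"
  using f_pos[of u] f_zero by (cases "u = 0") auto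

abbreviation "clock \<equiv> occupation \<Lambda>\<^sub>0 (\<lambda>i. - \<Gamma> i)"

abbreviation "gap x y i t \<omega> \<equiv> norm (X x i t \<omega> - X y i t \<omega>)"

abbreviation "contracting_path x y i T K \<omega> \<equiv> dissipative_path f \<psi> (\<lambda>t. X x i t \<omega> - X y i t \<omega>)
  (\<lambda>t. b (X x i t \<omega>) (\<Lambda>\<^sub>0 i t \<omega>) - b (X y i t \<omega>) (\<Lambda>\<^sub>0 i t \<omega>)) (\<lambda>t. - \<Gamma> (\<Lambda>\<^sub>0 i t \<omega>)) T K (Max (range (\<lambda>j. - \<Gamma> j)))"

text \<open>One null set serves all horizons, because \<open>AE_difference\<close> holds for all
  times at once; the drift bound \<open>K\<close> may depend on \<open>T\<close> and on the
  path.\<close>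

lemma AE_contracting_path: "AE \<omega> in M. \<forall>T\<ge>0. \<exists>K. contracting_path x y i T K \<omega>"
  using AE_difference[of x i y] AE_space
proof eventually_elim
  case (elim \<omega>)
  \<comment> \<open>One strictly dissipative regime makes the left slope positive, and
    \<open>f\<close> is common to all regimes; so regimes with \<open>\<Gamma> i = 0\<close> are
    covered too.\<close>
  obtain k where k: "\<Gamma> k < 0" using \<Gamma>_neg by blast
  have slope: "0 < left_slope f u" if "0 < u" for u
    using left_slope_pos[OF diss k f_pos \<psi>_pos that] .
  have \<psi>_nonneg: "0 \<le> \<psi> u" if "0 \<le> u" for u
    using that \<psi>_pos[of u] \<psi>_zero by (cases "u = 0") auto
  show ?case
  proof (intro allI impI)
    fix T :: real assume T: "0 \<le> T"
    obtain K1 where K1: "\<forall>t\<in>{0..T}. \<forall>j. norm (b (X x i t \<omega>) j) \<le> K1"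
      using b_bounded_on_path elim by blast
    obtain K2 where K2: "\<forall>t\<in>{0..T}. \<forall>j. norm (b (X y i t \<omega>) j) \<le> K2"
      using b_bounded_on_path elim by blast
    have "contracting_path x y i T (K1 + K2) \<omega>"
    proof unfold_locales
      fix \<tau> assume \<tau>: "0 \<le> \<tau>" "\<tau> \<le> T"
      let ?\<beta> = "b (X x i \<tau> \<omega>) (\<Lambda>\<^sub>0 i \<tau> \<omega>) - b (X y i \<tau> \<omega>) (\<Lambda>\<^sub>0 i \<tau> \<omega>)"
      show "norm ?\<beta> \<le> K1 + K2"
        using K1 K2 \<tau> by (intro order_trans[OF norm_triangle_ineq4] add_mono) auto
      assume "X x i \<tau> \<omega> - X y i \<tau> \<omega> \<noteq> 0"
      then show "left_slope f (gap x y i \<tau> \<omega>) * ((X x i \<tau> \<omega> - X y i \<tau> \<omega>) \<bullet> ?\<beta>)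
        \<le> - (- \<Gamma> (\<Lambda>\<^sub>0 i \<tau> \<omega>)) * gap x y i \<tau> \<omega> * \<psi> (f (gap x y i \<tau> \<omega>))"
        using dissipative_left_slope[OF diss \<Gamma>_nonpos f_pos \<psi>_convex \<psi>_nonneg slope] by simp
    next
      show "(\<lambda>t. - \<Gamma> (\<Lambda>\<^sub>0 i t \<omega>)) integrable_on {0..T}"
        using integrable_fun_L_path[OF chain, of \<omega> "\<lambda>j. - \<Gamma> j" i T] elim by blast
      show "- \<Gamma> (\<Lambda>\<^sub>0 i \<tau> \<omega>) \<le> Max (range (\<lambda>j. - \<Gamma> j))" for \<tau>
        by (intro Max_ge) auto
    qed (use T elim f_zero f_pos \<psi>_convex \<psi>_zero \<psi>_pos \<Gamma>_nonpos slope in auto)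
    then show "\<exists>K. contracting_path x y i T K \<omega>" by blast
  qed
qed

lemma AE_along_paths:
  assumes "\<And>\<omega> t K. \<omega> \<in> space M \<Longrightarrow> 0 \<le> t \<Longrightarrow> contracting_path x y i t K \<omega> \<Longrightarrow> Q t \<omega>"
  shows "AE \<omega> in M. \<forall>t\<ge>0. Q t \<omega>"
  using AE_contracting_path[of x i y] AE_space by eventually_elim (use assms in blast)

lemma AE_nonexpansive: "AE \<omega> in M. \<forall>t\<ge>0. gap x y i t \<omega> \<le> norm (x - y)"
proof (rule AE_along_paths)
  fix \<omega> t K assume \<omega>: "\<omega> \<in> space M" and t: "0 \<le> t" and path: "contracting_path x y i t K \<omega>"
  show "gap x y i t \<omega> \<le> norm (x - y)"
    using dissipative_path.norm_Z_antimono[OF path, of 0 t] t \<omega> by (simp add: X_0)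
qed

lemma AE_contraction_general:
  "AE \<omega> in M. \<forall>t\<ge>0. \<forall>\<epsilon>>0. \<epsilon> \<le> f (gap x y i t \<omega>) \<longrightarrow> \<psi> \<epsilon> * clock i t \<omega> \<le> R"
proof (rule AE_along_paths, intro allI impI)
  fix \<omega> t K \<epsilon> assume path: "contracting_path x y i t K \<omega>" and \<epsilon>: "0 < \<epsilon>" "\<epsilon> \<le> f (gap x y i t \<omega>)"
  from dissipative_path.contraction_general[OF path \<epsilon>] show "\<psi> \<epsilon> * clock i t \<omega> \<le> R"
    using f_le[of "gap x y i 0 \<omega>"] by (simp add: occupation_def)
qed

lemma AE_contraction_power:
  assumes q: "1 < q" and \<psi>: "\<And>u. 0 \<le> u \<Longrightarrow> \<psi> u = u powr q"
  shows "AE \<omega> in M. \<forall>t\<ge>0. 0 < f (gap x y i t \<omega>) \<longrightarrow> (q - 1) * clock i t \<omega> \<le> f (gap x y i t \<omega>) powr (1 - q)"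
proof (rule AE_along_paths, intro impI)
  fix \<omega> t K assume path: "contracting_path x y i t K \<omega>" and pos: "0 < f (gap x y i t \<omega>)"
  from dissipative_path.contraction_power[OF path q \<psi> pos]
  show "(q - 1) * clock i t \<omega> \<le> f (gap x y i t \<omega>) powr (1 - q)"
    by (simp add: occupation_def)
qed

lemma AE_contraction_linear:
  assumes \<kappa>: "0 < \<kappa>" and \<psi>: "\<And>u. 0 \<le> u \<Longrightarrow> \<psi> u = \<kappa> * u"
  shows "AE \<omega> in M. \<forall>t\<ge>0. f (gap x y i t \<omega>) \<le> R * exp (- \<kappa> * clock i t \<omega>)"
proof (rule AE_along_paths)
  fix \<omega> t K assume path: "contracting_path x y i t K \<omega>"
  from dissipative_path.contraction_linear[OF path \<kappa> \<psi>]
  have "f (gap x y i t \<omega>) \<le> f (gap x y i 0 \<omega>) * exp (- \<kappa> * clock i t \<omega>)"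
    by (simp add: occupation_def)
  also have "\<dots> \<le> R * exp (- \<kappa> * clock i t \<omega>)"
    using f_le by (intro mult_right_mono) auto
  finally show "f (gap x y i t \<omega>) \<le> R * exp (- \<kappa> * clock i t \<omega>)" .
qed

end

section \<open>The synchronous coupling as a measurable kernel\<close>

context contractive_diffusion
begin

text \<open>Each solution is determined only up to a null set depending on its starting point, so
  joint measurability is not automatic. Replacing \<open>x\<close> by simple functions
  \<open>s n x\<close> gives jointly measurable maps, and \<open>AE_nonexpansive\<close> makes them
  converge almost surely to the solution from \<open>x\<close>.\<close>

lemma measurable_version:
  assumes t: "0 \<le> t"
  shows "\<exists>V. case_prod V \<in> borel \<Otimes>\<^sub>M M \<rightarrow>\<^sub>M (borel :: (real ^ 'd) measure) \<and> (\<forall>x. AE \<omega> in M. V x \<omega> = X x i t \<omega>)"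
proof -
  have "(\<lambda>x. x) \<in> borel_measurable (borel :: (real ^ 'd) measure)" by simp
  from borel_measurable_implies_sequence_metric[OF this, of 0]
  obtain s :: "nat \<Rightarrow> real ^ 'd \<Rightarrow> real ^ 'd" where s: "\<And>n. simple_function borel (s n)" "\<And>x. (\<lambda>n. s n x) \<longlonglongrightarrow> x"
    by auto
  define V where "V x \<omega> = lim (\<lambda>n. X (s n x) i t \<omega>)" for x \<omega>
  have "(\<lambda>q. X (s n (fst q)) i t (snd q)) \<in> borel \<Otimes>\<^sub>M M \<rightarrow>\<^sub>M borel" for n
  proof (rule measurable_compose_countable'[where f="\<lambda>z q. X z i t (snd q)" and g="\<lambda>q. s n (fst q)" and I="range (s n)"])
    show "(\<lambda>q. X z i t (snd q)) \<in> borel \<Otimes>\<^sub>M M \<rightarrow>\<^sub>M borel" for z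
      by (rule measurable_compose[OF measurable_snd measurable_X[OF t]])
    have fin: "finite (range (s n))"
      using s(1)[of n] by (simp add: simple_function_def)
    then show "countable (range (s n))" by (rule countable_finite)
    have "s n \<in> borel \<rightarrow>\<^sub>M count_space (range (s n))"
      using s(1)[of n] fin by (simp add: measurable_count_space_eq2 simple_function_def)
    then show "(\<lambda>q. s n (fst q)) \<in> borel \<Otimes>\<^sub>M M \<rightarrow>\<^sub>M count_space (range (s n))"
      by (rule measurable_compose[OF measurable_fst])
  qed
  then have "(\<lambda>q. lim (\<lambda>n. X (s n (fst q)) i t (snd q))) \<in> borel \<Otimes>\<^sub>M M \<rightarrow>\<^sub>M borel"
    by (rule borel_measurable_lim_metric)
  then have "case_prod V \<in> borel \<Otimes>\<^sub>M M \<rightarrow>\<^sub>M borel"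
    by (simp add: V_def split_beta')
  moreover have "AE \<omega> in M. V x \<omega> = X x i t \<omega>" for x
  proof -
    have "AE \<omega> in M. \<forall>n. norm (X (s n x) i t \<omega> - X x i t \<omega>) \<le> norm (s n x - x)"
      unfolding AE_all_countable
    proof
      fix n
      show "AE \<omega> in M. norm (X (s n x) i t \<omega> - X x i t \<omega>) \<le> norm (s n x - x)"
        using AE_nonexpansive[of "s n x" i x] by eventually_elim (use t in auto)
    qed
    then show ?thesis
    proof eventually_elim
      case (elim \<omega>)
      have "(\<lambda>n. s n x - x) \<longlonglongrightarrow> 0"
        using s(2)[of x] by (rule LIM_zero)
      then have "(\<lambda>n. norm (s n x - x)) \<longlonglongrightarrow> 0"
        by (rule tendsto_norm_zero)
      from Lim_null_comparison[OF always_eventually[OF elim] this]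
      have "(\<lambda>n. X (s n x) i t \<omega>) \<longlonglongrightarrow> X x i t \<omega>"
        by (rule LIM_zero_cancel)
      then show ?case unfolding V_def by (rule limI)
    qed
  qed
  ultimately show ?thesis by blast
qed

abbreviation state_space :: "((real ^ 'd) \<times> 's) measure" where
  "state_space \<equiv> borel \<Otimes>\<^sub>M count_space UNIV"

abbreviation "\<K> \<equiv> trans_kernel M X \<Lambda>"

abbreviation "pair_space \<equiv> state_space \<Otimes>\<^sub>M state_space"

lemma measurable_state: "0 \<le> t \<Longrightarrow> (\<lambda>\<omega>. (X x i t \<omega>, \<Lambda>\<^sub>0 i t \<omega>)) \<in> M \<rightarrow>\<^sub>M state_space"
  by (intro measurable_Pair measurable_X measurable_\<Lambda>\<^sub>0)

lemma trans_kernel_eq: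
  "0 \<le> t \<Longrightarrow> \<K> t (x, i) = distr M state_space (\<lambda>\<omega>. (X x i t \<omega>, \<Lambda>\<^sub>0 i t \<omega>))"
  unfolding trans_kernel_def by (auto intro!: distr_cong simp: \<Lambda>_indep)

lemma kernel_measurable: "0 \<le> t \<Longrightarrow> \<K> t \<in> state_space \<rightarrow>\<^sub>M prob_algebra state_space"
  using A3 by (simp add: strong_markov_def)

text \<open>The strong Markov property at the constant stopping time \<open>s\<close>, integrated
  over the sample space.\<close>

lemma kernel_chapman_kolmogorov:
  assumes s: "0 \<le> s" and t: "0 \<le> t"
  shows "\<K> (s + t) z = \<K> s z \<bind> \<K> t"
proof -
  obtain x i where z: "z = (x, i)" by (cases z)
  have Ks: "\<K> s z \<in> space (prob_algebra state_space)"
    using measurable_space[OF kernel_measurable[OF s], of z] by (simp add: space_pair_measure)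
  then have sets_s: "sets (\<K> s z) = sets state_space" by (simp add: space_prob_algebra)
  have st: "0 \<le> s + t" using s t by simp
  show ?thesis
  proof (rule measure_eqI)
    show "sets (\<K> (s + t) z) = sets (\<K> s z \<bind> \<K> t)"
      using sets_bind'[OF Ks kernel_measurable[OF t]] by (simp add: z trans_kernel_def)
    fix A assume "A \<in> sets (\<K> (s + t) z)"
    then have A: "A \<in> sets state_space" by (simp add: z trans_kernel_def)
    define P where "P = filtration.pre_sigma (space M) F (\<lambda>_. s)"
    have st_time: "stopping_time F (\<lambda>_. s)"
      by (intro stopping_timeI) simp
    interpret finite_measure_subalgebra M P
    proof unfold_locales
      have "sets P \<subseteq> sets M"
      proof
        fix C assume "C \<in> sets P"
        from sets_pre_sigmaD[OF st_time this[unfolded P_def], of s]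
        have "C \<in> sets (F s)" by simp
        then show "C \<in> sets M" using subalg[of s] by (auto simp: subalgebra_def)
      qed
      then show "subalgebra M P"
        by (simp add: subalgebra_def P_def space_pre_sigma)
    qed
    define Z where "Z u \<omega> = (X x i u \<omega>, \<Lambda>\<^sub>0 i u \<omega>)" for u \<omega>
    have Z[measurable]: "Z u \<in> M \<rightarrow>\<^sub>M state_space" if "0 \<le> u" for u
      unfolding Z_def using measurable_state[OF that] .
    have meas_t: "(\<lambda>w. measure (\<K> t w) A) \<in> borel_measurable state_space"
      using A by (intro measurable_compose[OF kernel_measurable[OF t] measurable_measure_prob_algebra])
    have prob_t: "prob_space (\<K> t w)" for w
      using measurable_space[OF kernel_measurable[OF t], of w] by (auto simp: space_pair_measure space_prob_algebra)
    have AE: "AE \<omega> in M. real_cond_exp M P (\<lambda>\<omega>. indicator A (X x i (s + t) \<omega>, \<Lambda> x i (s + t) \<omega>)) \<omega>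
        = measure (\<K> t (X x i s \<omega>, \<Lambda> x i s \<omega>)) A"
      using A3 st_time s t A unfolding strong_markov_def P_def by blast
    have int: "integrable M (\<lambda>\<omega>. indicator A (X x i (s + t) \<omega>, \<Lambda> x i (s + t) \<omega>) :: real)"
    proof -
      have "(\<lambda>\<omega>. (X x i (s + t) \<omega>, \<Lambda> x i (s + t) \<omega>)) \<in> M \<rightarrow>\<^sub>M state_space"
        using st by (intro measurable_Pair measurable_X measurable_\<Lambda>)
      then have "(\<lambda>\<omega>. indicator A (X x i (s + t) \<omega>, \<Lambda> x i (s + t) \<omega>) :: real) \<in> borel_measurable M"
        using A by (rule measurable_compose[OF _ borel_measurable_indicator])
      then show ?thesis by (intro integrable_const_bound[of _ 1]) auto
    qed
    have "measure (\<K> (s + t) z) A = (\<integral>\<omega>. indicator A (Z (s + t) \<omega>) \<partial>M)"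
    proof -
      have "measure (\<K> (s + t) z) A = measure M (Z (s + t) -` A \<inter> space M)"
        unfolding z trans_kernel_eq[OF st] Z_def[symmetric] by (rule measure_distr[OF Z[OF st] A])
      also have "\<dots> = (\<integral>\<omega>. indicator (Z (s + t) -` A \<inter> space M) \<omega> \<partial>M)" by simp
      also have "\<dots> = (\<integral>\<omega>. indicator A (Z (s + t) \<omega>) \<partial>M)"
        by (intro Bochner_Integration.integral_cong) (auto simp: indicator_def)
      finally show ?thesis .
    qed
    also have "\<dots> = (\<integral>\<omega>. indicator A (X x i (s + t) \<omega>, \<Lambda> x i (s + t) \<omega>) \<partial>M)"
      using st by (intro Bochner_Integration.integral_cong) (auto simp: Z_def \<Lambda>_indep)
    also have "\<dots> = (\<integral>\<omega>. real_cond_exp M P (\<lambda>\<omega>. indicator A (X x i (s + t) \<omega>, \<Lambda> x i (s + t) \<omega>)) \<omega> \<partial>M)"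
      by (rule real_cond_exp_int(2)[OF int, symmetric])
    also have "\<dots> = (\<integral>\<omega>. measure (\<K> t (Z s \<omega>)) A \<partial>M)"
    proof (rule integral_cong_AE)
      show "AE \<omega> in M. real_cond_exp M P (\<lambda>\<omega>. indicator A (X x i (s + t) \<omega>, \<Lambda> x i (s + t) \<omega>)) \<omega>
          = measure (\<K> t (Z s \<omega>)) A"
        using AE AE_space by eventually_elim (use s in \<open>simp add: Z_def \<Lambda>_indep\<close>)
    qed (use measurable_compose[OF Z[OF s] meas_t] in auto)
    finally have eq: "measure (\<K> (s + t) z) A = (\<integral>\<omega>. measure (\<K> t (Z s \<omega>)) A \<partial>M)" .
    have "emeasure (\<K> s z \<bind> \<K> t) A
        = (\<integral>\<^sup>+w. emeasure (\<K> t w) A \<partial>\<K> s z)"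
      by (rule emeasure_bind_prob_algebra[OF Ks kernel_measurable[OF t] A])
    also have "\<dots> = (\<integral>\<^sup>+w. ennreal (measure (\<K> t w) A) \<partial>\<K> s z)"
      using prob_t by (intro nn_integral_cong) (simp add: finite_measure.emeasure_eq_measure prob_space.finite_measure)
    also have "\<dots> = (\<integral>\<^sup>+\<omega>. ennreal (measure (\<K> t (Z s \<omega>)) A) \<partial>M)"
      unfolding z trans_kernel_eq[OF s] Z_def[symmetric]
      using meas_t by (intro nn_integral_distr Z s) auto
    also have "\<dots> = ennreal (\<integral>\<omega>. measure (\<K> t (Z s \<omega>)) A \<partial>M)"
      using measurable_compose[OF Z[OF s] meas_t] prob_t
      by (intro nn_integral_eq_integral integrable_const_bound[of _ 1]) (auto simp: prob_space.prob_le_1)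
    also have "\<dots> = emeasure (\<K> (s + t) z) A"
    proof -
      have "prob_space (\<K> (s + t) z)"
        using measurable_space[OF kernel_measurable[OF st], of z] by (auto simp: space_pair_measure space_prob_algebra)
      then show ?thesis
        unfolding eq[symmetric] by (simp add: finite_measure.emeasure_eq_measure prob_space.finite_measure)
    qed
    finally show "emeasure (\<K> (s + t) z) A = emeasure (\<K> s z \<bind> \<K> t) A"
      by simp
  qed
qed

text \<open>Both solutions are read at the same sample point and so share the Brownian motion; from
  a pair in \<open>diagonal\<close> they share the chain as well. It has the right marginals from
  every pair.\<close>

definition sync :: "real \<Rightarrow> ((real ^ 'd) \<times> 's) \<times> ((real ^ 'd) \<times> 's) \<Rightarrow> (((real ^ 'd) \<times> 's) \<times> ((real ^ 'd) \<times> 's)) measure" where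
  "sync t q = distr M pair_space (\<lambda>\<omega>.
     ((X (fst (fst q)) (snd (fst q)) t \<omega>, \<Lambda>\<^sub>0 (snd (fst q)) t \<omega>),
      (X (fst (snd q)) (snd (snd q)) t \<omega>, \<Lambda>\<^sub>0 (snd (snd q)) t \<omega>)))"

text \<open>For a fixed pair of regimes the jointly measurable versions \<open>V\<close> give the
  same law as the solutions, and finitely many pairs of regimes are pieced together.\<close>

lemma measurable_sync:
  assumes t: "0 \<le> t"
  shows "sync t \<in> pair_space \<rightarrow>\<^sub>M prob_algebra pair_space"
proof -
  have "\<forall>i. \<exists>V. case_prod V \<in> borel \<Otimes>\<^sub>M M \<rightarrow>\<^sub>M (borel :: (real ^ 'd) measure) \<and> (\<forall>x. AE \<omega> in M. V x \<omega> = X x i t \<omega>)"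
    by (intro allI measurable_version[OF t])
  from choice[OF this] obtain V where V': "\<forall>i. case_prod (V i) \<in> borel \<Otimes>\<^sub>M M \<rightarrow>\<^sub>M (borel :: (real ^ 'd) measure) \<and> (\<forall>x. AE \<omega> in M. V i x \<omega> = X x i t \<omega>)"
    by (elim exE) (rule that)
  have V: "case_prod (V i) \<in> borel \<Otimes>\<^sub>M M \<rightarrow>\<^sub>M (borel :: (real ^ 'd) measure)"
    "AE \<omega> in M. V i x \<omega> = X x i t \<omega>" for i x
    using V' by blast+
  define W where "W i p = (V i (fst p) (snd p), \<Lambda>\<^sub>0 i t (snd p))" for i p
  have W: "W i \<in> borel \<Otimes>\<^sub>M M \<rightarrow>\<^sub>M state_space" for i
    unfolding W_def using V(1)[of i] measurable_compose[OF measurable_snd measurable_\<Lambda>\<^sub>0[OF t]]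
    by (intro measurable_Pair) (auto simp: split_beta')
  define J where "J k q = distr M pair_space (\<lambda>\<omega>. (W (fst k) (fst (fst q), \<omega>), W (snd k) (fst (snd q), \<omega>)))"
    for k and q :: "((real ^ 'd) \<times> 's) \<times> ((real ^ 'd) \<times> 's)"
  have J: "J k \<in> pair_space \<rightarrow>\<^sub>M prob_algebra pair_space" for k
    unfolding J_def
  proof (rule measurable_distr_prob_space2)
    have "M \<in> space (prob_algebra M)" by (simp add: space_prob_algebra) unfold_locales
    then show "(\<lambda>_. M) \<in> pair_space \<rightarrow>\<^sub>M prob_algebra M" by simp
    have "(\<lambda>p. (W (fst k) (fst (fst (fst p)), snd p), W (snd k) (fst (snd (fst p)), snd p)))
        \<in> pair_space \<Otimes>\<^sub>M M \<rightarrow>\<^sub>M pair_space"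
      by (intro measurable_Pair measurable_compose[OF _ W]) measurable
    then show "(\<lambda>(q, \<omega>). (W (fst k) (fst (fst q), \<omega>), W (snd k) (fst (snd q), \<omega>)))
        \<in> pair_space \<Otimes>\<^sub>M M \<rightarrow>\<^sub>M pair_space"
      by (simp add: split_beta')
  qed
  have "(\<lambda>q. J (snd (fst q), snd (snd q)) q) \<in> pair_space \<rightarrow>\<^sub>M prob_algebra pair_space"
  proof (rule measurable_compose_countable'[where f=J and I=UNIV, OF J])
    have "(\<lambda>q. (snd (fst q), snd (snd q))) \<in> pair_space \<rightarrow>\<^sub>M count_space (UNIV :: 's set) \<Otimes>\<^sub>M count_space (UNIV :: 's set)"
      by measurable
    then show "(\<lambda>q. (snd (fst q), snd (snd q))) \<in> pair_space \<rightarrow>\<^sub>M count_space (UNIV :: ('s \<times> 's) set)"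
      by (simp add: pair_measure_count_space)
  qed (auto intro: countable_finite)
  moreover have "J (snd (fst q), snd (snd q)) q = sync t q" for q
    unfolding J_def sync_def
  proof (rule distr_cong_AE)
    show "AE \<omega> in M. (W (fst (snd (fst q), snd (snd q))) (fst (fst q), \<omega>), W (snd (snd (fst q), snd (snd q))) (fst (snd q), \<omega>)) =
       ((X (fst (fst q)) (snd (fst q)) t \<omega>, \<Lambda>\<^sub>0 (snd (fst q)) t \<omega>), (X (fst (snd q)) (snd (snd q)) t \<omega>, \<Lambda>\<^sub>0 (snd (snd q)) t \<omega>))"
      using V(2)[of "snd (fst q)" "fst (fst q)"] V(2)[of "snd (snd q)" "fst (snd q)"]
      by eventually_elim (simp add: W_def)
    show "(\<lambda>\<omega>. (W (fst (snd (fst q), snd (snd q))) (fst (fst q), \<omega>), W (snd (snd (fst q), snd (snd q))) (fst (snd q), \<omega>)))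
      \<in> M \<rightarrow>\<^sub>M pair_space"
      by (intro measurable_Pair measurable_compose[OF _ W]) measurable
    show "(\<lambda>\<omega>. ((X (fst (fst q)) (snd (fst q)) t \<omega>, \<Lambda>\<^sub>0 (snd (fst q)) t \<omega>), (X (fst (snd q)) (snd (snd q)) t \<omega>, \<Lambda>\<^sub>0 (snd (snd q)) t \<omega>)))
      \<in> M \<rightarrow>\<^sub>M pair_space"
      using t by (intro measurable_Pair[OF measurable_state measurable_state])
  qed simp_all
  ultimately show ?thesis by (simp cong: measurable_cong)
qed

definition diagonal :: "(((real ^ 'd) \<times> 's) \<times> ((real ^ 'd) \<times> 's)) set" where
  "diagonal = {q. snd (fst q) = snd (snd q)}"

lemma diagonal_eq: "diagonal = (\<Union>k\<in>UNIV. (UNIV \<times> {k}) \<times> (UNIV \<times> {k}))"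
  by (auto simp: diagonal_def)

lemma sets_regime: "UNIV \<times> {k} \<in> sets state_space"
  by (intro pair_measureI) auto

sublocale coupled_kernels state_space \<K> diagonal sync
proof
  fix t :: real and q :: "((real ^ 'd) \<times> 's) \<times> ((real ^ 'd) \<times> 's)"
  assume t: "0 \<le> t"
  show "\<K> t \<in> state_space \<rightarrow>\<^sub>M prob_algebra state_space"
    by (rule kernel_measurable[OF t])
  show "sync t \<in> pair_space \<rightarrow>\<^sub>M prob_algebra pair_space"
    by (rule measurable_sync[OF t])
  have m: "(\<lambda>\<omega>. ((X (fst (fst q)) (snd (fst q)) t \<omega>, \<Lambda>\<^sub>0 (snd (fst q)) t \<omega>), (X (fst (snd q)) (snd (snd q)) t \<omega>, \<Lambda>\<^sub>0 (snd (snd q)) t \<omega>)))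
      \<in> M \<rightarrow>\<^sub>M pair_space"
    using t by (intro measurable_Pair[OF measurable_state measurable_state])
  have k: "\<K> t z = distr M state_space (\<lambda>\<omega>. (X (fst z) (snd z) t \<omega>, \<Lambda>\<^sub>0 (snd z) t \<omega>))" for z
    using trans_kernel_eq[OF t, of "fst z" "snd z"] by simp
  show "distr (sync t q) state_space fst = \<K> t (fst q)"
    unfolding sync_def k by (subst distr_distr[OF measurable_fst m]) (simp add: o_def)
  show "distr (sync t q) state_space snd = \<K> t (snd q)"
    unfolding sync_def k by (subst distr_distr[OF measurable_snd m]) (simp add: o_def)
next
  show "diagonal \<in> sets pair_space"
    unfolding diagonal_eq using sets_regime by (intro sets.finite_UN pair_measureI) auto
qed (rule kernel_chapman_kolmogorov)

lemma measure_kernel_regime: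
  assumes "0 \<le> t"
  shows "measure (\<K> t z) (UNIV \<times> {k}) = trans_prob M \<Lambda>\<^sub>0 t (snd z) k"
proof -
  have "measure (\<K> t z) (UNIV \<times> {k}) = measure M {\<omega> \<in> space M. \<Lambda>\<^sub>0 (snd z) t \<omega> = k}"
    using trans_kernel_eq[OF assms, of "fst z" "snd z"] measurable_state[OF assms, of "fst z" "snd z"]
    by (auto simp: measure_distr sets_regime intro!: arg_cong[where f="measure M"])
  then show ?thesis by (simp add: trans_prob_def)
qed

text \<open>Two independent copies agree at time 1 with the sum over \<open>k\<close> of two
  transition probabilities; bounding the second factor by \<open>\<zeta>\<close> leaves a row sum,
  which is 1.\<close>

lemma meeting_probability:
  assumes \<zeta>: "\<And>i j. \<zeta> \<le> trans_prob M \<Lambda>\<^sub>0 1 i j"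
  shows "\<zeta> \<le> measure (product 1 q) diagonal"
proof -
  have row: "(\<Sum>k\<in>UNIV. trans_prob M \<Lambda>\<^sub>0 1 i k * \<zeta>) = \<zeta>" for i
    using expectation_fun_L[OF chain, of 1 "\<lambda>_. \<zeta>" i] by (simp add: prob_space)
  have q: "fst q \<in> space state_space" "snd q \<in> space state_space" by (auto simp: space_pair_measure)
  have s: "sets (\<K> 1 z) = sets state_space" for z
    using prob_space_kernel[of 1 z] by (simp add: space_pair_measure)
  interpret P1: prob_space "\<K> 1 (fst q)" using prob_space_kernel[OF _ q(1)] by simp
  interpret P2: prob_space "\<K> 1 (snd q)" using prob_space_kernel[OF _ q(2)] by simp
  interpret pair_prob_space "\<K> 1 (fst q)" "\<K> 1 (snd q)" ..
  define A :: "'s \<Rightarrow> (((real ^ 'd) \<times> 's) \<times> ((real ^ 'd) \<times> 's)) set" where "A k = (UNIV \<times> {k}) \<times> (UNIV \<times> {k})" for k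
  have A: "A k \<in> sets (product 1 q)" for k
    unfolding A_def product_def using sets_regime s by (intro pair_measureI) auto
  have "measure (product 1 q) diagonal = (\<Sum>k\<in>UNIV. measure (product 1 q) (A k))"
    unfolding diagonal_eq A_def[symmetric]
    using A unfolding product_def
    by (intro P.finite_measure_finite_Union) (auto simp: disjoint_family_on_def A_def)
  also have "\<dots> = (\<Sum>k\<in>UNIV. trans_prob M \<Lambda>\<^sub>0 1 (snd (fst q)) k * trans_prob M \<Lambda>\<^sub>0 1 (snd (snd q)) k)"
    unfolding product_def A_def using sets_regime s
    by (intro sum.cong refl) (simp add: measure_kernel_regime[symmetric] measure_def P2.emeasure_pair_measure_Times enn2real_mult)
  also have "\<dots> \<ge> (\<Sum>k\<in>UNIV. trans_prob M \<Lambda>\<^sub>0 1 (snd (fst q)) k * \<zeta>)"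
    using \<zeta> by (intro sum_mono mult_left_mono) (auto simp: trans_prob_def)
  also have "(\<Sum>k\<in>UNIV. trans_prob M \<Lambda>\<^sub>0 1 (snd (fst q)) k * \<zeta>) = \<zeta>"
    by (rule row)
  finally show ?thesis .
qed

section \<open>Wasserstein bounds from the coupling\<close>

lemma measurable_f_norm[measurable]: "(\<lambda>v. f (norm v)) \<in> borel_measurable (borel :: (real ^ 'd) measure)"
proof -
  have n: "(\<lambda>v. norm v) \<in> borel_measurable (borel :: (real ^ 'd) measure)" by measurable
  \<comment> \<open>Monotone functions are Borel; composing with \<open>max u 0\<close> extends the
    monotonicity from \<open>{0..}\<close> to the whole line.\<close>
  have "mono (\<lambda>u. f (max u 0))"
    using mono by (auto simp: mono_def mono_on_def)
  from measurable_compose[OF n borel_measurable_mono[OF this]] show ?thesis by simp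
qed

lemma rho_eq: "rho f z w = of_bool (snd z \<noteq> snd w) + f (norm (fst z - fst w))" for z w :: "(real ^ 'd) \<times> 's"
  by (simp add: rho_def split_beta)

lemma rho_bounds: "0 \<le> rho f z w" "rho f z w \<le> 1 + R" for z w :: "(real ^ 'd) \<times> 's"
  using f_nonneg[of "norm (fst z - fst w)"] f_le[of "norm (fst z - fst w)"] by (auto simp: rho_eq of_bool_def)

lemma measurable_rho: "(\<lambda>q. rho f (fst q) (snd q)) \<in> borel_measurable pair_space"
proof -
  have "(\<lambda>q. 1 - indicator diagonal q + f (norm (fst (fst q) - fst (snd q)))) \<in> borel_measurable pair_space"
    using measurable_compose[OF _ measurable_f_norm, of "\<lambda>q. fst (fst q) - fst (snd q)"] D
    by (intro borel_measurable_add borel_measurable_diff borel_measurable_indicator) auto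
  moreover have "1 - indicator diagonal q + f (norm (fst (fst q) - fst (snd q))) = rho f (fst q) (snd q)" for q
    by (auto simp: rho_eq diagonal_def indicator_def)
  ultimately show ?thesis by simp
qed

lemma coupling_in_couplings:
  assumes T: "0 \<le> T"
  shows "coupling T n (z, w) \<in> couplings (\<K> (T + real n) z) (\<K> (T + real n) w)"
proof -
  have q: "(z, w) \<in> space pair_space" by (simp add: space_pair_measure)
  have t: "0 \<le> T + real n" using T by simp
  have s: "sets (\<K> (T + real n) v) = sets state_space" for v
    using prob_space_kernel[OF t, of v] by (simp add: space_pair_measure)
  show ?thesis
    unfolding couplings_def
  proof (intro CollectI conjI)
    have "sets (coupling T n (z, w)) = sets pair_space"
      using measurable_space[OF coupling[OF T] q] by (simp add: space_prob_algebra del: coupling.simps)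
    also have "\<dots> = sets (\<K> (T + real n) z \<Otimes>\<^sub>M \<K> (T + real n) w)"
      by (rule sets_pair_measure_cong[OF s s, symmetric])
    finally show "sets (coupling T n (z, w)) = sets (\<K> (T + real n) z \<Otimes>\<^sub>M \<K> (T + real n) w)" .
    show "distr (coupling T n (z, w)) (\<K> (T + real n) z) fst = \<K> (T + real n) z"
      by (rule trans[OF distr_cong[OF refl s refl] coupling_marginals[OF T q, THEN conjunct1, unfolded fst_conv]])
    show "distr (coupling T n (z, w)) (\<K> (T + real n) w) snd = \<K> (T + real n) w"
      by (rule trans[OF distr_cong[OF refl s refl] coupling_marginals[OF T q, THEN conjunct2, unfolded snd_conv]])
  qed
qed

text \<open>The infimum over an empty set of reals is unspecified, so a coupling must exist.\<close>

lemma wasserstein_nonneg: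
  fixes \<mu> \<nu> :: "((real ^ 'd) \<times> 's) measure"
  assumes "couplings \<mu> \<nu> \<noteq> {}"
  shows "0 \<le> wasserstein f p \<mu> \<nu>"
  unfolding wasserstein_def using assms by (intro cINF_greatest) auto

text \<open>In the synchronous phase the regimes stay equal, so the cost is \<open>f\<close> of the
  gap alone and \<open>s\<close> controls it. Before the meeting nothing better than
  \<open>(1 + R) powr p\<close> is known, which is the start of the recursion for
  \<open>d\<close>.\<close>

lemma wasserstein_bound:
  assumes T: "0 \<le> T" and p: "1 \<le> p" and \<zeta>: "\<And>i j. \<zeta> \<le> trans_prob M \<Lambda>\<^sub>0 1 i j"
    and s: "\<And>x y i n. (\<integral>\<omega>. f (gap x y i (T + real n) \<omega>) powr p \<partial>M) \<le> s n"
    and s_nonneg: "\<And>n. 0 \<le> s n" and sd: "\<And>n. s n \<le> d n"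
    and rec: "\<And>n. \<zeta> * s n + (1 - \<zeta>) * d n \<le> d (Suc n)"
    and d0: "(1 + R) powr p \<le> d 0"
  shows "0 \<le> wasserstein f p (\<K> (T + real n) z) (\<K> (T + real n) w)"
    and "wasserstein f p (\<K> (T + real n) z) (\<K> (T + real n) w) \<le> d n powr (1 / p)"
proof -
  define r where "r q = rho f (fst q) (snd q) powr p" for q :: "((real ^ 'd) \<times> 's) \<times> ((real ^ 'd) \<times> 's)"
  have r[measurable]: "r \<in> borel_measurable pair_space"
    unfolding r_def using measurable_rho by measurable
  have q: "(z, w) \<in> space pair_space" by (simp add: space_pair_measure)
  have cost: "(\<integral>\<^sup>+q. ennreal (r q) \<partial>coupling T n (z, w)) \<le> ennreal (d n)"
  proof (rule coupling_cost[where s=s and \<zeta>=\<zeta>, OF T])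
    show "\<zeta> \<le> measure (product 1 q) diagonal" for q by (rule meeting_probability[OF \<zeta>])
    show "(\<lambda>q. ennreal (r q)) \<in> borel_measurable pair_space" by measurable
    show "ennreal (r q) \<le> ennreal (d 0)" for q
      using rho_bounds[of "fst q" "snd q"] p d0
      unfolding r_def by (intro ennreal_leI order_trans[OF powr_mono2 d0]) auto
    fix q and n assume "q \<in> diagonal"
    then obtain x y i where q: "q = ((x, i), (y, i))" by (cases q) (auto simp: diagonal_def)
    define t where "t = T + real n"
    have t: "0 \<le> t" using T by (simp add: t_def)
    define h where "h \<omega> = f (gap x y i t \<omega>) powr p" for \<omega>
    have h[measurable]: "h \<in> borel_measurable M"
    proof -
      have [measurable]: "(\<lambda>\<omega>. f (gap x y i t \<omega>)) \<in> borel_measurable M"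
        using measurable_compose[OF borel_measurable_diff[OF measurable_X[OF t] measurable_X[OF t]] measurable_f_norm] .
      show ?thesis unfolding h_def by measurable
    qed
    have h_bound: "0 \<le> h \<omega>" "h \<omega> \<le> R powr p" for \<omega>
      unfolding h_def using p f_nonneg f_le by (auto intro!: powr_mono2)
    have m: "(\<lambda>\<omega>. ((X x i t \<omega>, \<Lambda>\<^sub>0 i t \<omega>), (X y i t \<omega>, \<Lambda>\<^sub>0 i t \<omega>))) \<in> M \<rightarrow>\<^sub>M pair_space"
      using t by (intro measurable_Pair[OF measurable_state measurable_state])
    have "(\<integral>\<^sup>+v. ennreal (r v) \<partial>sync t q) = (\<integral>\<^sup>+\<omega>. ennreal (h \<omega>) \<partial>M)"
      unfolding sync_def q fst_conv snd_conv
      by (subst nn_integral_distr[OF m]) (auto simp: r_def h_def rho_eq)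
    also have "\<dots> = ennreal (\<integral>\<omega>. h \<omega> \<partial>M)"
      using h_bound by (intro nn_integral_eq_integral integrable_const_bound[of _ "R powr p"]) auto
    also have "\<dots> \<le> ennreal (s n)"
      using s[of x i n y] unfolding h_def t_def by (rule ennreal_leI)
    finally show "(\<integral>\<^sup>+v. ennreal (r v) \<partial>sync (T + real n) q) \<le> ennreal (s n)" by (simp add: t_def)
  qed (use s_nonneg sd rec q in auto)
  have d: "0 \<le> d n" using s_nonneg sd order_trans by blast
  have "sets (coupling T n (z, w)) = sets pair_space"
    using measurable_space[OF coupling[OF T] q] by (simp add: space_prob_algebra del: coupling.simps)
  then have rM: "r \<in> borel_measurable (coupling T n (z, w))"
    using r by (simp cong: measurable_cong_sets del: coupling.simps)
  have "(\<integral>q. r q \<partial>coupling T n (z, w)) = enn2real (\<integral>\<^sup>+q. ennreal (r q) \<partial>coupling T n (z, w))"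
    by (rule integral_eq_nn_integral[OF rM]) (simp add: r_def)
  also have "\<dots> \<le> d n"
    using cost d by (intro enn2real_leI)
  finally have int: "(\<integral>(z, w). rho f z w powr p \<partial>coupling T n (z, w)) \<le> d n"
    by (simp add: r_def split_beta' del: coupling.simps)
  have in_c: "coupling T n (z, w) \<in> couplings (\<K> (T + real n) z) (\<K> (T + real n) w)"
    by (rule coupling_in_couplings[OF T])
  then show "0 \<le> wasserstein f p (\<K> (T + real n) z) (\<K> (T + real n) w)"
    by (intro wasserstein_nonneg) blast
  have "wasserstein f p (\<K> (T + real n) z) (\<K> (T + real n) w)
      \<le> (\<integral>(z, w). rho f z w powr p \<partial>coupling T n (z, w)) powr (1 / p)"
    unfolding wasserstein_def by (intro cINF_lower[OF bdd_belowI2[of _ 0] in_c]) auto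
  also have "\<dots> \<le> d n powr (1 / p)"
    using int p by (intro powr_mono2) (auto simp: split_beta' intro!: Bochner_Integration.integral_nonneg)
  finally show "wasserstein f p (\<K> (T + real n) z) (\<K> (T + real n) w) \<le> d n powr (1 / p)" .
qed

end

section \<open>Rates of convergence\<close>

lemma powr_times_exp_tendsto_0:
  fixes a r :: real
  assumes r: "0 < r"
  shows "((\<lambda>t. t powr a * exp (- r * t)) \<longlongrightarrow> 0) at_top"
proof -
  obtain k :: nat where k: "a \<le> real k" using real_arch_simple by blast
  have "filterlim (\<lambda>t. r * t) at_top at_top"
    using r by (intro filterlim_tendsto_pos_mult_at_top[OF tendsto_const]) (auto simp: filterlim_ident)
  from filterlim_compose[OF tendsto_power_div_exp_0[of k] this]
  have "((\<lambda>t. (1 / r ^ k) * ((r * t) ^ k / exp (r * t))) \<longlongrightarrow> (1 / r ^ k) * 0) at_top"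
    by (intro tendsto_intros)
  then have lim: "((\<lambda>t. (1 / r ^ k) * ((r * t) ^ k / exp (r * t))) \<longlongrightarrow> 0) at_top" by simp
  have "\<forall>\<^sub>F t in at_top. norm (t powr a * exp (- r * t)) \<le> (1 / r ^ k) * ((r * t) ^ k / exp (r * t))"
    using eventually_ge_at_top[of 1]
  proof eventually_elim
    case (elim t)
    have "t powr a \<le> t powr real k" using elim k by (intro powr_mono) auto
    also have "\<dots> = t ^ k" using elim by (simp add: powr_realpow)
    finally have "t powr a * exp (- r * t) \<le> t ^ k * exp (- r * t)" by (intro mult_right_mono) auto
    then show ?case using r by (simp add: power_mult_distrib exp_minus field_simps)
  qed
  from Lim_null_comparison[OF this lim] show ?thesis .
qed

context contractive_diffusion
begin

context
  fixes lam :: "'s \<Rightarrow> real"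
  assumes irreducible: "irreducible_rates (rate M \<Lambda>\<^sub>0)"
    and invariant: "invariant_prob M \<Lambda>\<^sub>0 lam"
begin

lemma fc: "finite_chain (trans_prob M \<Lambda>\<^sub>0) (rate M \<Lambda>\<^sub>0) lam"
  by (rule finite_chain_trans_prob[OF chain irreducible invariant])

lemma zeta_le: "zeta M \<Lambda>\<^sub>0 \<le> trans_prob M \<Lambda>\<^sub>0 1 i j"
  unfolding zeta_def
  using cINF_lower[of "\<lambda>(i, j). trans_prob M \<Lambda>\<^sub>0 1 i j" UNIV "(i, j)"] by (simp add: bdd_below_finite)

lemma zeta_pos: "0 < zeta M \<Lambda>\<^sub>0"
proof -
  have "zeta M \<Lambda>\<^sub>0 \<in> range (\<lambda>(i, j). trans_prob M \<Lambda>\<^sub>0 1 i j)"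
    unfolding zeta_def by (subst cInf_eq_Min) (auto intro!: Min_in)
  then show ?thesis
    using finite_chain.P_pos[OF fc, of 1] by auto
qed

lemma zeta_le_1: "zeta M \<Lambda>\<^sub>0 \<le> 1"
  using zeta_le[of undefined undefined] finite_chain.P_le_1[OF fc, of 1 undefined undefined] by simp

definition mean_rate :: real where
  "mean_rate = (\<Sum>j\<in>UNIV. lam j * - \<Gamma> j)"

lemma mean_rate_eq: "mean_rate = - (\<Sum>i\<in>UNIV. \<Gamma> i * lam i)"
  by (simp add: mean_rate_def sum_negf mult.commute)

text \<open>One strictly dissipative regime suffices, because irreducibility gives every regime
  positive invariant weight.\<close>

lemma mean_rate_pos: "0 < mean_rate"
proof -
  obtain k where k: "\<Gamma> k < 0" using \<Gamma>_neg by blast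
  have "0 < lam k * - \<Gamma> k" using k finite_chain.lam_pos[OF fc] by (intro mult_pos_pos) auto
  also have "\<dots> \<le> mean_rate"
    unfolding mean_rate_def using finite_chain.lam_nonneg[OF fc] \<Gamma>_nonpos
    by (intro member_le_sum[of k UNIV "\<lambda>j. lam j * - \<Gamma> j"]) (auto simp: mult_nonneg_nonpos)
  finally show ?thesis .
qed

section \<open>Moments of the gap and the three convergence statements\<close>

definition moment :: "real \<Rightarrow> real ^ 'd \<Rightarrow> real ^ 'd \<Rightarrow> 's \<Rightarrow> real \<Rightarrow> real" where
  "moment p x y i t = (\<integral>\<omega>. f (gap x y i t \<omega>) powr p \<partial>M)"

lemma moment_le:
  assumes t: "0 \<le> t" and p: "1 \<le> p" and h: "integrable M h"
    and le: "AE \<omega> in M. f (gap x y i t \<omega>) powr p \<le> h \<omega>"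
  shows "moment p x y i t \<le> (\<integral>\<omega>. h \<omega> \<partial>M)"
  unfolding moment_def
proof (rule integral_mono_AE[OF _ h le])
  have [measurable]: "(\<lambda>\<omega>. f (gap x y i t \<omega>)) \<in> borel_measurable M"
    using measurable_compose[OF borel_measurable_diff[OF measurable_X[OF t] measurable_X[OF t]] measurable_f_norm] .
  have "f (norm v) powr p \<le> R powr p" for v :: "real ^ 'd"
    using p f_nonneg f_le by (auto intro!: powr_mono2)
  then show "integrable M (\<lambda>\<omega>. f (gap x y i t \<omega>) powr p)"
    by (intro integrable_const_bound[of _ "R powr p"]) auto
qed

text \<open>On the event that the clock has passed \<open>c\<close> the contraction gives
  \<open>a\<close>; on its complement only the bound \<open>R\<close> is left, weighted with the
  small probability of a slow clock.\<close>

lemma moment_le_split: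
  assumes t: "0 \<le> t" and p: "1 \<le> p" and a: "0 \<le> a"
    and le: "AE \<omega> in M. c < clock i t \<omega> \<longrightarrow> f (gap x y i t \<omega>) \<le> a"
  shows "moment p x y i t \<le> a powr p + R powr p * measure M {\<omega>\<in>space M. clock i t \<omega> \<le> c}"
proof -
  define A where "A = {\<omega>\<in>space M. clock i t \<omega> \<le> c}"
  have [measurable]: "clock i t \<in> borel_measurable M" using measurable_occupation[OF chain t] .
  have A[measurable]: "A \<in> sets M" unfolding A_def by measurable
  have int: "integrable M (\<lambda>\<omega>. a powr p + R powr p * indicator A \<omega>)"
    by (auto simp: emeasure_eq_measure intro!: integrable_real_indicator)
  have "moment p x y i t \<le> (\<integral>\<omega>. a powr p + R powr p * indicator A \<omega> \<partial>M)"
  proof (rule moment_le[OF t p int])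
    show "AE \<omega> in M. f (gap x y i t \<omega>) powr p \<le> a powr p + R powr p * indicator A \<omega>"
      using le AE_space
    proof eventually_elim
      case (elim \<omega>)
      show ?case
      proof (cases "c < clock i t \<omega>")
        case True
        then have "f (gap x y i t \<omega>) powr p \<le> a powr p"
          using elim p f_nonneg by (intro powr_mono2) auto
        then show ?thesis by (simp add: add_increasing2)
      next
        case False
        then have "\<omega> \<in> A" using elim by (auto simp: A_def)
        moreover have "f (gap x y i t \<omega>) powr p \<le> R powr p"
          using p f_nonneg f_le by (intro powr_mono2) auto
        ultimately show ?thesis by (simp add: add_increasing)
      qed
    qed
  qed
  also have "\<dots> = a powr p + R powr p * measure M A"
    using int by (subst Bochner_Integration.integral_add) (auto simp: prob_space emeasure_eq_measure intro!: integrable_real_indicator)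
  finally show ?thesis by (simp add: A_def)
qed

abbreviation "W p x i y j t \<equiv> wasserstein f p (\<K> t (x, i)) (\<K> t (y, j))"

lemma W_nonneg:
  assumes "0 \<le> t"
  shows "0 \<le> W p x i y j t"
  using coupling_in_couplings[OF assms, of 0 "(x, i)" "(y, j)"]
  by (intro wasserstein_nonneg) (auto simp del: coupling.simps)

text \<open>The bound \<open>s\<close> must be uniform in \<open>x\<close> and \<open>y\<close>,
  since the positions at the meeting are unknown. For constant \<open>s\<close> the recursion is
  solved by \<open>s\<close> plus a multiple of \<open>(1 - \<zeta>) ^ n\<close>; the passage to
  \<open>exp (- \<zeta> * real n)\<close> also covers \<open>\<zeta> = 1\<close>.\<close>

lemma W_le_meeting:
  assumes T: "0 \<le> T" and p: "1 \<le> p" and s: "\<And>x y i t. T \<le> t \<Longrightarrow> moment p x y i t \<le> s" and s0: "0 \<le> s"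
  shows "W p x i y j (T + real n) \<le> (s + (1 + R) powr p * exp (- zeta M \<Lambda>\<^sub>0 * real n)) powr (1 / p)"
proof -
  define \<zeta> where "\<zeta> = zeta M \<Lambda>\<^sub>0"
  have \<zeta>: "0 < \<zeta>" "\<zeta> \<le> 1" using zeta_pos zeta_le_1 by (auto simp: \<zeta>_def)
  have "W p x i y j (T + real n) \<le> (s + (1 + R) powr p * (1 - \<zeta>) ^ n) powr (1 / p)"
  proof (rule wasserstein_bound(2)[where s="\<lambda>_. s" and \<zeta>=\<zeta> and d="\<lambda>n. s + (1 + R) powr p * (1 - \<zeta>) ^ n", OF T p])
    show "\<zeta> \<le> trans_prob M \<Lambda>\<^sub>0 1 i j" for i j by (simp add: \<zeta>_def zeta_le)
    show "(\<integral>\<omega>. f (gap x y i (T + real n) \<omega>) powr p \<partial>M) \<le> s" for x y i n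
      using s[of "T + real n" x y i] by (simp add: moment_def)
    show "\<zeta> * s + (1 - \<zeta>) * (s + (1 + R) powr p * (1 - \<zeta>) ^ n) \<le> s + (1 + R) powr p * (1 - \<zeta>) ^ Suc n" for n
      by (simp add: algebra_simps)
  qed (use s0 \<zeta> in auto)
  also have "\<dots> \<le> (s + (1 + R) powr p * exp (- \<zeta> * real n)) powr (1 / p)"
  proof -
    have "(1 - \<zeta>) ^ n \<le> exp (- \<zeta>) ^ n"
      using \<zeta> exp_ge_add_one_self[of "- \<zeta>"] by (intro power_mono) auto
    also have "\<dots> = exp (- \<zeta> * real n)" by (simp add: exp_of_nat_mult[symmetric] mult.commute)
    finally show ?thesis
      using s0 \<zeta> p by (intro powr_mono2 add_left_mono mult_left_mono add_nonneg_nonneg mult_nonneg_nonneg) auto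
  qed
  finally show ?thesis by (simp add: \<zeta>_def)
qed

lemma clock_deviation:
  assumes "0 < \<delta>" "\<delta> < 1"
  shows "\<exists>C r. 0 \<le> C \<and> 0 < r \<and> (\<forall>i. \<forall>t\<ge>0. measure M {\<omega>\<in>space M. clock i t \<omega> \<le> (1 - \<delta>) * mean_rate * t} \<le> C * exp (- r * t))"
proof -
  have "0 < (\<Sum>j\<in>UNIV. lam j * - \<Gamma> j)" using mean_rate_pos by (simp add: mean_rate_def)
  from occupation_deviation[OF chain fc _ this assms]
  obtain C r where C: "0 < r" "\<forall>i. \<forall>t\<ge>0. measure M {\<omega>\<in>space M. clock i t \<omega> \<le> (1 - \<delta>) * mean_rate * t} \<le> C * exp (- r * t)"
    unfolding mean_rate_def using \<Gamma>_nonpos by auto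
  moreover have "0 \<le> C"
    using C(2)[rule_format, of 0 undefined] measure_nonneg[of M] by (smt (verit) mult_zero_right exp_zero mult_cancel_left2)
  ultimately show ?thesis by blast
qed

lemma W_tendsto_0:
  assumes p: "1 \<le> p"
  shows "(W p x i y j \<longlongrightarrow> 0) at_top"
proof (rule tendstoI)
  fix e :: real assume e: "0 < e"
  \<comment> \<open>Chosen so that \<open>(s + s) powr (1 / p) = e / 2\<close>: one \<open>s\<close>
    for the moment after the meeting, one for the failure to meet.\<close>
  define s where "s = (e / 2) powr p / 2"
  have s: "0 < s" using e by (simp add: s_def)
  define \<epsilon> where "\<epsilon> = (s / 2) powr (1 / p)"
  have \<epsilon>: "0 < \<epsilon>" "\<epsilon> powr p = s / 2" using s p by (auto simp: \<epsilon>_def powr_powr)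
  have \<psi>\<epsilon>: "0 < \<psi> \<epsilon>" using \<psi>_pos \<epsilon> by simp
  obtain C r where C: "0 \<le> C" "0 < r"
    "\<And>i t. 0 \<le> t \<Longrightarrow> measure M {\<omega>\<in>space M. clock i t \<omega> \<le> (1 - 1 / 2) * mean_rate * t} \<le> C * exp (- r * t)"
    using clock_deviation[of "1 / 2"] by auto
  have "((\<lambda>t. R powr p * C * (t powr 0 * exp (- r * t))) \<longlongrightarrow> R powr p * C * 0) at_top"
    by (intro tendsto_intros powr_times_exp_tendsto_0 C)
  then have "\<forall>\<^sub>F t in at_top. R powr p * C * (t powr 0 * exp (- r * t)) < s / 2"
    using s by (intro order_tendstoD) auto
  then obtain T1 where T1: "\<And>t. T1 \<le> t \<Longrightarrow> R powr p * C * (t powr 0 * exp (- r * t)) < s / 2"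
    unfolding eventually_at_top_linorder by blast
  \<comment> \<open>Beyond \<open>T\<close> a clock above half its mean violates
    \<open>AE_contraction_general\<close> unless \<open>f\<close> of the gap is at most
    \<open>\<epsilon>\<close>.\<close>
  define T where "T = max 1 (max T1 (2 * R / (\<psi> \<epsilon> * mean_rate)))"
  have T: "1 \<le> T" "T1 \<le> T" "2 * R / (\<psi> \<epsilon> * mean_rate) \<le> T" by (auto simp: T_def)
  have moment: "moment p x y i t \<le> s" if t: "T \<le> t" for x y i t
  proof -
    have t1: "1 \<le> t" using t T by simp
    have "2 * R / (\<psi> \<epsilon> * mean_rate) \<le> t" using t T by simp
    then have Rt: "R \<le> \<psi> \<epsilon> * ((1 - 1 / 2) * mean_rate * t)"
      using \<psi>\<epsilon> mean_rate_pos by (simp add: field_simps)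
    have "moment p x y i t \<le> \<epsilon> powr p + R powr p * measure M {\<omega>\<in>space M. clock i t \<omega> \<le> (1 - 1 / 2) * mean_rate * t}"
    proof (rule moment_le_split[OF _ p])
      show "AE \<omega> in M. (1 - 1 / 2) * mean_rate * t < clock i t \<omega> \<longrightarrow> f (gap x y i t \<omega>) \<le> \<epsilon>"
        using AE_contraction_general[of x i y]
      proof eventually_elim
        case (elim \<omega>)
        show ?case
        proof (intro impI, rule ccontr)
          assume clock: "(1 - 1 / 2) * mean_rate * t < clock i t \<omega>" and "\<not> f (gap x y i t \<omega>) \<le> \<epsilon>"
          then have "\<psi> \<epsilon> * clock i t \<omega> \<le> R" using elim \<epsilon> t1 by auto
          moreover have "\<psi> \<epsilon> * ((1 - 1 / 2) * mean_rate * t) < \<psi> \<epsilon> * clock i t \<omega>"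
            using clock \<psi>\<epsilon> by (rule mult_strict_left_mono)
          ultimately show False using Rt by linarith
        qed
      qed
    qed (use t1 \<epsilon> in auto)
    also have "\<dots> \<le> s / 2 + R powr p * (C * exp (- r * t))"
      using C(3)[of t i] t1 \<epsilon> by (intro add_mono mult_left_mono) auto
    also have "\<dots> \<le> s"
      using T1[of t] t T t1 by (simp add: mult.assoc)
    finally show ?thesis .
  qed
  define D where "D = (1 + R) powr p"
  have "((\<lambda>t. D * (t powr 0 * exp (- zeta M \<Lambda>\<^sub>0 * t))) \<longlongrightarrow> D * 0) at_top"
    by (intro tendsto_intros powr_times_exp_tendsto_0 zeta_pos)
  then have "\<forall>\<^sub>F t in at_top. D * (t powr 0 * exp (- zeta M \<Lambda>\<^sub>0 * t)) < s"
    using s by (intro order_tendstoD) auto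
  then obtain T2 where T2: "\<And>t. T2 \<le> t \<Longrightarrow> D * (t powr 0 * exp (- zeta M \<Lambda>\<^sub>0 * t)) < s"
    unfolding eventually_at_top_linorder by blast
  show "\<forall>\<^sub>F t in at_top. dist (W p x i y j t) 0 < e"
    using eventually_ge_at_top[of "T + max 1 T2 + 1"]
  proof eventually_elim
    case (elim t)
    \<comment> \<open>The fractional part of \<open>t - T\<close> is added to the last phase, so
      that the number of unit steps is an integer.\<close>
    define n where "n = nat \<lfloor>t - T\<rfloor>"
    have "0 \<le> t - T" using elim by linarith
    then have n: "real n \<le> t - T" "t - T < real n + 1" unfolding n_def by linarith+
    have n2: "T2 \<le> real n" "1 \<le> real n" using n elim by linarith+
    have T': "T \<le> t - real n" using n by linarith
    have "W p x i y j ((t - real n) + real n) \<le> (s + (1 + R) powr p * exp (- zeta M \<Lambda>\<^sub>0 * real n)) powr (1 / p)"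
      using T T' s by (intro W_le_meeting p moment) auto
    also have "\<dots> \<le> (s + s) powr (1 / p)"
      using T2[OF n2(1)] n2 s p by (intro powr_mono2 add_left_mono) (auto simp: D_def)
    also have "\<dots> = e / 2"
      using e p by (simp add: s_def powr_powr)
    finally show ?case
      using W_nonneg[of t p x i y j] elim T e by simp
  qed
qed

text \<open>At most a quarter of the time goes into waiting and a quarter of the mean clock into
  deviations, and \<open>(3/4)^2 = 9/16\<close> still exceeds the factor 1/2 of the claim. Failure
  to meet and a slow clock are exponentially unlikely, hence negligible at a polynomial
  rate.\<close>

lemma W_power_rate:
  assumes p: "1 \<le> p" and q: "1 < q" and \<psi>: "\<And>u. 0 \<le> u \<Longrightarrow> \<psi> u = u powr q"
  shows "Limsup at_top (\<lambda>t. ereal (t powr (1 / (q - 1)) * W p x i y j t))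
    \<le> ereal (((1 - q) / 2 * (\<Sum>i\<in>UNIV. \<Gamma> i * lam i)) powr (1 / (1 - q)))"
proof -
  define \<beta> where "\<beta> = 1 / (q - 1)"
  have \<beta>: "0 < \<beta>" "(1 - q) * \<beta> = - 1" "1 / (1 - q) = - \<beta>" using q by (auto simp: \<beta>_def field_simps)
  define A where "A = (q - 1) * mean_rate"
  have A: "0 < A" using q mean_rate_pos by (simp add: A_def)
  have target: "((1 - q) / 2 * (\<Sum>i\<in>UNIV. \<Gamma> i * lam i)) powr (1 / (1 - q)) = (A / 2) powr (- \<beta>)"
    unfolding \<beta>(3) A_def mean_rate_eq by (simp add: algebra_simps)
  obtain C r where C: "0 \<le> C" "0 < r"
    "\<And>i t. 0 \<le> t \<Longrightarrow> measure M {\<omega>\<in>space M. clock i t \<omega> \<le> (1 - 1 / 4) * mean_rate * t} \<le> C * exp (- r * t)"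
    using clock_deviation[of "1 / 4"] by auto
  define S where "S t = (3 / 4 * A * t) powr (- \<beta> * p) + R powr p * (C * exp (- r * t))" for t
  have moment: "moment p x y i t \<le> S t" if t: "0 < t" for x y i t
  proof -
    have "moment p x y i t \<le> ((3 / 4 * A * t) powr (- \<beta>)) powr p
        + R powr p * measure M {\<omega>\<in>space M. clock i t \<omega> \<le> (1 - 1 / 4) * mean_rate * t}"
    proof (rule moment_le_split[OF _ p])
      show "AE \<omega> in M. (1 - 1 / 4) * mean_rate * t < clock i t \<omega> \<longrightarrow>
          f (gap x y i t \<omega>) \<le> (3 / 4 * A * t) powr (- \<beta>)"
      proof -
        have "AE \<omega> in M. \<forall>t\<ge>0. 0 < f (gap x y i t \<omega>) \<longrightarrow>
            (q - 1) * clock i t \<omega> \<le> f (gap x y i t \<omega>) powr (1 - q)"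
          by (rule AE_contraction_power[OF q \<psi>])
        then show ?thesis
        proof eventually_elim
          case (elim \<omega>)
          show ?case
          proof
            assume clock: "(1 - 1 / 4) * mean_rate * t < clock i t \<omega>"
            define v where "v = f (gap x y i t \<omega>)"
            show "f (gap x y i t \<omega>) \<le> (3 / 4 * A * t) powr (- \<beta>)"
            proof (cases "v = 0")
              case False
              then have v: "0 < v" using f_nonneg[of "gap x y i t \<omega>"] by (simp add: v_def)
              have "3 / 4 * A * t = (q - 1) * ((1 - 1 / 4) * mean_rate * t)" by (simp add: A_def)
              also have "\<dots> \<le> (q - 1) * clock i t \<omega>" using clock q by (intro mult_left_mono) auto
              also have "\<dots> \<le> v powr (1 - q)" using elim v t by (simp add: v_def)
              finally have "(v powr (1 - q)) powr (- \<beta>) \<le> (3 / 4 * A * t) powr (- \<beta>)"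
                using A t \<beta> by (intro powr_mono2') auto
              then show ?thesis using v by (simp add: powr_powr \<beta>(2) v_def)
            qed (simp add: v_def)
          qed
        qed
      qed
    qed (use t in auto)
    also have "\<dots> \<le> S t"
      unfolding S_def powr_powr using C(3)[of t i] t by (intro add_mono mult_left_mono) auto
    finally show ?thesis .
  qed
  have S_anti: "S t \<le> S u" if "0 < u" "u \<le> t" for u t
    unfolding S_def using that A C \<beta> p by (intro add_mono mult_left_mono powr_mono2') (auto simp: mult_nonpos_nonneg)
  have S_nonneg: "0 \<le> S t" for t unfolding S_def using C by auto
  \<comment> \<open>\<open>Y t\<close> is \<open>t powr (\<beta> * p)\<close> times the bound for
    the cost: the powers of \<open>t\<close> cancel in its first term, and the other two vanish as
    \<open>t\<close> grows.\<close>
  define D where "D = (1 + R) powr p"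
  define Y where "Y t = (3 / 4 * A * (3 / 4)) powr (- \<beta> * p) + R powr p * C * (t powr (\<beta> * p) * exp (- (r * 3 / 4) * t))
      + D * exp (zeta M \<Lambda>\<^sub>0) * (t powr (\<beta> * p) * exp (- (zeta M \<Lambda>\<^sub>0 / 4) * t))" for t
  have bound: "t powr \<beta> * W p x i y j t \<le> Y t powr (1 / p)" if t: "1 \<le> t" for t
  proof -
    define n where "n = nat \<lfloor>t / 4\<rfloor>"
    have n: "real n \<le> t / 4" "t / 4 - 1 \<le> real n" using t unfolding n_def by linarith+
    have T: "3 / 4 * t \<le> t - real n" using n by linarith
    have T0: "0 < 3 / 4 * t" using t by simp
    have "W p x i y j ((t - real n) + real n) \<le> (S (3 / 4 * t) + D * exp (- zeta M \<Lambda>\<^sub>0 * real n)) powr (1 / p)"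
      unfolding D_def
    proof (rule W_le_meeting[OF _ p _ S_nonneg])
      fix x y i u assume "t - real n \<le> u"
      then have "3 / 4 * t \<le> u" using T by linarith
      then show "moment p x y i u \<le> S (3 / 4 * t)"
        using moment[of u x y i] S_anti[OF T0, of u] T0 by linarith
    qed (use T T0 in linarith)
    also have "\<dots> \<le> (S (3 / 4 * t) + D * (exp (zeta M \<Lambda>\<^sub>0) * exp (- (zeta M \<Lambda>\<^sub>0 / 4) * t))) powr (1 / p)"
    proof -
      have "zeta M \<Lambda>\<^sub>0 * (t / 4 - 1) \<le> zeta M \<Lambda>\<^sub>0 * real n"
        using n(2) zeta_pos by (intro mult_left_mono) auto
      then have "exp (- zeta M \<Lambda>\<^sub>0 * real n) \<le> exp (zeta M \<Lambda>\<^sub>0 + - (zeta M \<Lambda>\<^sub>0 / 4) * t)"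
        by (simp add: algebra_simps)
      then show ?thesis
        using S_nonneg p unfolding exp_add D_def
        by (intro powr_mono2 add_left_mono mult_left_mono add_nonneg_nonneg) auto
    qed
    finally have "t powr \<beta> * W p x i y j t \<le> (t powr (\<beta> * p)) powr (1 / p)
        * (S (3 / 4 * t) + D * (exp (zeta M \<Lambda>\<^sub>0) * exp (- (zeta M \<Lambda>\<^sub>0 / 4) * t))) powr (1 / p)"
      using p t by (simp add: powr_powr mult_left_mono)
    also have "\<dots> = (t powr (\<beta> * p) * (S (3 / 4 * t) + D * (exp (zeta M \<Lambda>\<^sub>0) * exp (- (zeta M \<Lambda>\<^sub>0 / 4) * t)))) powr (1 / p)"
      by (rule powr_mult[symmetric])
    also have "t powr (\<beta> * p) * (S (3 / 4 * t) + D * (exp (zeta M \<Lambda>\<^sub>0) * exp (- (zeta M \<Lambda>\<^sub>0 / 4) * t))) = Y t"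
    proof -
      have "t powr (\<beta> * p) * (3 / 4 * A * (3 / 4 * t)) powr (- \<beta> * p) = (3 / 4 * A * (3 / 4)) powr (- \<beta> * p)"
      proof -
        have "(3 / 4 * A * (3 / 4 * t)) powr (- \<beta> * p) = (3 / 4 * A * (3 / 4)) powr (- \<beta> * p) * t powr (- \<beta> * p)"
          using A t by (subst powr_mult[symmetric]) (auto simp: mult_ac)
        moreover have "t powr (\<beta> * p) * t powr (- \<beta> * p) = 1"
          using t by (simp add: powr_add[symmetric])
        ultimately show ?thesis by (simp add: mult_ac)
      qed
      then show ?thesis unfolding S_def Y_def by (simp add: distrib_left mult_ac)
    qed
    finally show ?thesis .
  qed
  have "((\<lambda>t. Y t powr (1 / p)) \<longlongrightarrow> ((3 / 4 * A * (3 / 4)) powr (- \<beta> * p) + R powr p * C * 0 + D * exp (zeta M \<Lambda>\<^sub>0) * 0) powr (1 / p)) at_top"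
    unfolding Y_def using C zeta_pos A
    by (intro tendsto_intros powr_times_exp_tendsto_0) auto
  moreover have "((3 / 4 * A * (3 / 4)) powr (- \<beta> * p) + R powr p * C * 0 + D * exp (zeta M \<Lambda>\<^sub>0) * 0) powr (1 / p) = (9 / 16 * A) powr (- \<beta>)"
    using p by (simp add: powr_powr mult.commute)
  ultimately have lim: "((\<lambda>t. Y t powr (1 / p)) \<longlongrightarrow> (9 / 16 * A) powr (- \<beta>)) at_top" by simp
  \<comment> \<open>The exponent is negative, so the larger base has the smaller power; strictness
    lets the limit of \<open>Y\<close> pass below the target.\<close>
  have "(9 / 16 * A) powr (- \<beta>) < (A / 2) powr (- \<beta>)"
    using A \<beta> by (intro powr_less_mono2_neg) auto
  from order_tendstoD(2)[OF lim this]
  have "\<forall>\<^sub>F t in at_top. ereal (t powr \<beta> * W p x i y j t) \<le> ereal ((A / 2) powr (- \<beta>))"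
    using eventually_ge_at_top[of 1]
  proof eventually_elim
    case (elim t)
    then show ?case using bound[of t] by simp
  qed
  then show ?thesis
    unfolding target \<beta>_def[symmetric] by (rule Limsup_bounded)
qed

text \<open>
  The rate of the synchronous coupling is \<open>1 / (1 / \<theta> + 1 / \<vartheta>)\<close> with \<open>\<theta> = p \<kappa> |\<Sum> \<Gamma> \<lambda>|\<close>,
  which is at least half the minimum of \<open>\<theta>\<close> and \<open>\<vartheta>\<close>.
\<close>
lemma W_exponential_rate:
  assumes p: "1 \<le> p" and \<kappa>: "0 < \<kappa>" and \<psi>: "\<And>u. 0 \<le> u \<Longrightarrow> \<psi> u = \<kappa> * u"
    and \<alpha>: "0 < \<alpha>" "\<alpha> < vartheta M \<Lambda>\<^sub>0 / p" "\<alpha> < - \<kappa> * (\<Sum>i\<in>UNIV. \<Gamma> i * lam i)"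
  shows "((\<lambda>t. exp (\<alpha> * t / 2) * W p x i y j t) \<longlongrightarrow> 0) at_top"
proof -
  define \<zeta> where "\<zeta> = zeta M \<Lambda>\<^sub>0"
  define v where "v = - ln (1 - \<zeta>)"
  have v_eq: "vartheta M \<Lambda>\<^sub>0 = v" by (simp add: vartheta_def v_def \<zeta>_def)
  have pa: "p * \<alpha> < v" using \<alpha>(2) p by (simp add: v_eq field_simps)
  have v: "0 < v" using pa p \<alpha>(1) by (smt (verit) mult_pos_pos)
  \<comment> \<open>A positive \<open>vartheta\<close> excludes \<open>\<zeta> = 1\<close>, where
    \<open>- ln 0\<close> has the default value 0.\<close>
  have \<zeta>: "0 < \<zeta>" "\<zeta> < 1"
  proof -
    show "0 < \<zeta>" using zeta_pos by (simp add: \<zeta>_def)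
    have "\<zeta> \<noteq> 1" using v by (auto simp: v_def)
    then show "\<zeta> < 1" using zeta_le_1 by (simp add: \<zeta>_def)
  qed
  have exp_v: "exp (- v) = 1 - \<zeta>" using \<zeta> by (simp add: v_def)
  \<comment> \<open>The cost is a \<open>p\<close>-th power of a quantity decaying like
    \<open>exp (- \<kappa> * clock)\<close>, hence the factor \<open>p\<close>.\<close>
  define \<theta> where "\<theta> = p * \<kappa>"
  have \<theta>: "0 < \<theta>" using p \<kappa> by (simp add: \<theta>_def)
  define m where "m = \<theta> * mean_rate"
  have m: "0 < m" using \<theta> mean_rate_pos by (simp add: m_def)
  have "p * \<alpha> < p * (- \<kappa> * (\<Sum>i\<in>UNIV. \<Gamma> i * lam i))"
    using \<alpha>(3) p by (intro mult_strict_left_mono) auto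
  also have "\<dots> = m" by (simp add: m_def \<theta>_def mean_rate_eq)
  finally have pm: "p * \<alpha> < m" .
  have "\<exists>g. \<forall>i. finite_chain.Qv (rate M \<Lambda>\<^sub>0) g i = - \<Gamma> i - mean_rate \<and> 0 \<le> g i \<and> g i \<le> mean_rate / v"
    unfolding mean_rate_def v_def using zeta_le \<Gamma>_nonpos
    by (intro finite_chain.poisson_bounded[OF fc \<zeta>]) (auto simp: \<zeta>_def)
  then obtain g where g: "\<And>i. finite_chain.Qv (rate M \<Lambda>\<^sub>0) g i = - \<Gamma> i - mean_rate" "\<And>i. 0 \<le> g i"
    "\<And>i. g i \<le> mean_rate / v"
    by metis
  define \<mu>\<^sub>0 where "\<mu>\<^sub>0 = m / (1 + \<theta> * (mean_rate / v))"
  have \<mu>\<^sub>0_eq: "\<mu>\<^sub>0 = m * v / (v + m)"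
    using v by (simp add: \<mu>\<^sub>0_def m_def field_simps)
  have "p * \<alpha> / 2 < \<mu>\<^sub>0"
  proof -
    have "p * \<alpha> * v < m * v" "p * \<alpha> * m < v * m" using pa pm m v by auto
    then have "p * \<alpha> * (v + m) < 2 * (m * v)" by (simp add: algebra_simps)
    then show ?thesis unfolding \<mu>\<^sub>0_eq using m v by (simp add: field_simps)
  qed
  then obtain \<mu> where \<mu>: "p * \<alpha> / 2 < \<mu>" "\<mu> < \<mu>\<^sub>0" using dense by blast
  have \<mu>pos: "0 < \<mu>" using \<mu>(1) p \<alpha>(1) by (smt (verit) half_gt_zero mult_pos_pos)
  \<comment> \<open>Keeping \<open>\<mu>\<close> below \<open>v\<close> means that
    \<open>1 - \<zeta> = exp (- v)\<close> is smaller than \<open>exp (- \<mu>)\<close>: the waiting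
    time does not spoil the rate.\<close>
  have "m * v < v * (v + m)" using m v by (simp add: algebra_simps)
  then have "\<mu>\<^sub>0 < v" unfolding \<mu>\<^sub>0_eq using m v by (simp add: pos_divide_less_eq)
  then have "\<mu> < v" using \<mu> by simp
  then have gap: "0 < exp (- \<mu>) - (1 - \<zeta>)" using exp_v by (metis diff_gt_0_iff_gt exp_less_mono neg_less_iff_less)
  define C0 where "C0 = R powr p * (1 + \<theta> * (mean_rate / v))"
  have C0: "0 \<le> C0" using \<theta> mean_rate_pos v by (simp add: C0_def)
  define D where "D = (1 + R) powr p"
  have moment: "moment p x y i t \<le> C0 * exp (- \<mu> * t)" if t: "0 \<le> t" for x y i t
  proof -
    have "integrable M (\<lambda>\<omega>. exp (- occupation \<Lambda>\<^sub>0 (\<lambda>j. \<theta> * - \<Gamma> j) i t \<omega>))"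
      using \<theta> \<Gamma>_nonpos t by (intro integrable_exp_occupation[OF chain]) (auto simp: mult_nonneg_nonpos)
    then have int: "integrable M (\<lambda>\<omega>. exp (- \<theta> * clock i t \<omega>))"
      using occupation_scale[OF chain, of \<theta> "\<lambda>j. - \<Gamma> j" i t] by simp
    have "moment p x y i t \<le> (\<integral>\<omega>. R powr p * exp (- \<theta> * clock i t \<omega>) \<partial>M)"
    proof (rule moment_le[OF t p])
      show "integrable M (\<lambda>\<omega>. R powr p * exp (- \<theta> * clock i t \<omega>))" using int by simp
      show "AE \<omega> in M. f (gap x y i t \<omega>) powr p \<le> R powr p * exp (- \<theta> * clock i t \<omega>)"
      proof -
        have "AE \<omega> in M. \<forall>t\<ge>0. f (gap x y i t \<omega>) \<le> R * exp (- \<kappa> * clock i t \<omega>)"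
          by (rule AE_contraction_linear[OF \<kappa> \<psi>])
        then show ?thesis
        proof eventually_elim
          case (elim \<omega>)
          have "f (gap x y i t \<omega>) powr p \<le> (R * exp (- \<kappa> * clock i t \<omega>)) powr p"
            using elim t p f_nonneg by (intro powr_mono2) auto
          also have "\<dots> = R powr p * exp (- \<kappa> * clock i t \<omega>) powr p"
            by (rule powr_mult)
          also have "exp (- \<kappa> * clock i t \<omega>) powr p = exp (- \<theta> * clock i t \<omega>)"
            by (simp add: powr_def \<theta>_def)
          finally show ?case .
        qed
      qed
    qed
    also have "\<dots> = R powr p * (\<integral>\<omega>. exp (- \<theta> * clock i t \<omega>) \<partial>M)" by simp
    also have "\<dots> \<le> R powr p * ((1 + \<theta> * (mean_rate / v)) * exp (- \<mu> * t))"
      using \<mu>(2) g \<Gamma>_nonpos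
      by (intro mult_left_mono exp_occupation_poisson[OF chain fc, where g=g])
        (auto simp: mean_rate_def \<mu>\<^sub>0_def m_def \<theta> t)
    finally show ?thesis by (simp add: C0_def mult_ac)
  qed
  \<comment> \<open>Large enough for the recursion
    \<open>\<zeta> * C0 + (1 - \<zeta>) * C \<le> C * exp (- \<mu>)\<close>, solved for
    \<open>C\<close>, and for the initial cost \<open>D\<close>.\<close>
  define C where "C = C0 + D + \<zeta> * C0 / (exp (- \<mu>) - (1 - \<zeta>))"
  have C: "C0 \<le> C" "D \<le> C" "\<zeta> * C0 \<le> C * (exp (- \<mu>) - (1 - \<zeta>))"
  proof -
    have D: "0 \<le> D" by (simp add: D_def)
    have "0 \<le> \<zeta> * C0 / (exp (- \<mu>) - (1 - \<zeta>))" using \<zeta> C0 gap by auto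
    then show "C0 \<le> C" "D \<le> C" using C0 D by (auto simp: C_def)
    have "\<zeta> * C0 = \<zeta> * C0 / (exp (- \<mu>) - (1 - \<zeta>)) * (exp (- \<mu>) - (1 - \<zeta>))" using gap by simp
    also have "\<dots> \<le> C * (exp (- \<mu>) - (1 - \<zeta>))"
      using gap C0 D by (intro mult_right_mono) (auto simp: C_def)
    finally show "\<zeta> * C0 \<le> C * (exp (- \<mu>) - (1 - \<zeta>))" .
  qed
  have Cpos: "0 \<le> C" using C C0 by simp
  have bound: "W p x i y j t \<le> (C * exp \<mu>) powr (1 / p) * exp (- \<mu> / p * t)" if t: "0 \<le> t" for t
  proof -
    define n where "n = nat \<lfloor>t\<rfloor>"
    have n: "real n \<le> t" "t - 1 \<le> real n" using t unfolding n_def by linarith+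
    have "W p x i y j ((t - real n) + real n) \<le> (C * exp (- \<mu> * real n)) powr (1 / p)"
    proof (rule wasserstein_bound(2)[where s="\<lambda>n. C0 * exp (- \<mu> * real n)" and \<zeta>=\<zeta> and d="\<lambda>n. C * exp (- \<mu> * real n)", OF _ p])
      show "\<zeta> \<le> trans_prob M \<Lambda>\<^sub>0 1 i j" for i j by (simp add: \<zeta>_def zeta_le)
      show "(\<integral>\<omega>. f (gap x y i ((t - real n) + real k) \<omega>) powr p \<partial>M)
          \<le> C0 * exp (- \<mu> * real k)" for x y i k
      proof -
        have "moment p x y i ((t - real n) + real k) \<le> C0 * exp (- \<mu> * ((t - real n) + real k))"
          using n by (intro moment) auto
        also have "\<dots> \<le> C0 * exp (- \<mu> * real k)"
          using C0 n \<mu>pos by (intro mult_left_mono) auto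
        finally show ?thesis by (simp add: moment_def)
      qed
      show "\<zeta> * (C0 * exp (- \<mu> * real k)) + (1 - \<zeta>) * (C * exp (- \<mu> * real k)) \<le> C * exp (- \<mu> * real (Suc k))" for k
      proof -
        have "\<zeta> * C0 * exp (- \<mu> * real k) \<le> C * (exp (- \<mu>) - (1 - \<zeta>)) * exp (- \<mu> * real k)"
          using C(3) by (intro mult_right_mono) auto
        moreover have "exp (- \<mu> * real (Suc k)) = exp (- \<mu>) * exp (- \<mu> * real k)"
          by (simp add: exp_add[symmetric] algebra_simps)
        ultimately show ?thesis by (simp add: algebra_simps)
      qed
    qed (use n C C0 D_def in \<open>auto intro!: mult_right_mono\<close>)
    also have "\<dots> \<le> (C * exp \<mu> * exp (- \<mu> * t)) powr (1 / p)"
    proof -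
      have "\<mu> * (t - 1) \<le> \<mu> * real n" using n(2) \<mu>pos by (intro mult_left_mono) auto
      then have "exp (- \<mu> * real n) \<le> exp (\<mu> + - \<mu> * t)" by (simp add: algebra_simps)
      then show ?thesis
        unfolding exp_add mult.assoc using p Cpos by (intro powr_mono2 mult_left_mono) auto
    qed
    also have "\<dots> = (C * exp \<mu>) powr (1 / p) * exp (- \<mu> * t) powr (1 / p)"
      by (rule powr_mult)
    also have "exp (- \<mu> * t) powr (1 / p) = exp (- \<mu> / p * t)" by (simp add: powr_def)
    finally show ?thesis by simp
  qed
  \<comment> \<open>The \<open>p\<close>-th root in the Wasserstein distance divides the rate
    \<open>\<mu>\<close> of the cost by \<open>p\<close>; \<open>r\<close> is what remains beyond
    \<open>\<alpha> / 2\<close>.\<close>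
  define r where "r = \<mu> / p - \<alpha> / 2"
  have r: "0 < r" using \<mu>(1) p by (simp add: r_def field_simps)
  have "((\<lambda>t. (C * exp \<mu>) powr (1 / p) * (t powr 0 * exp (- r * t))) \<longlongrightarrow> (C * exp \<mu>) powr (1 / p) * 0) at_top"
    by (intro tendsto_intros powr_times_exp_tendsto_0 r)
  then have lim: "((\<lambda>t. (C * exp \<mu>) powr (1 / p) * (t powr 0 * exp (- r * t))) \<longlongrightarrow> 0) at_top" by simp
  have "\<forall>\<^sub>F t in at_top. norm (exp (\<alpha> * t / 2) * W p x i y j t) \<le> (C * exp \<mu>) powr (1 / p) * (t powr 0 * exp (- r * t))"
    using eventually_ge_at_top[of 1]
  proof eventually_elim
    case (elim t)
    have "norm (exp (\<alpha> * t / 2) * W p x i y j t) = exp (\<alpha> * t / 2) * W p x i y j t"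
      using W_nonneg[of t p x i y j] elim by simp
    also have "\<dots> \<le> exp (\<alpha> * t / 2) * ((C * exp \<mu>) powr (1 / p) * exp (- \<mu> / p * t))"
      using bound[of t] elim by (intro mult_left_mono) auto
    also have "\<dots> = (C * exp \<mu>) powr (1 / p) * exp (- r * t)"
      by (simp add: r_def exp_add[symmetric] algebra_simps)
    finally show ?case using elim by simp
  qed
  from Lim_null_comparison[OF this lim] show ?thesis .
qed

end

end

section \<open>Assembly of the three statements\<close>

theorem theorem1p2:
  fixes M :: "'w measure" and F :: "real \<Rightarrow> 'w measure"
    and B :: "real \<Rightarrow> 'w \<Rightarrow> real ^ 'n"
    and b :: "real ^ 'd \<Rightarrow> 's::finite \<Rightarrow> real ^ 'd"
    and \<sigma> :: "real ^ 'd \<Rightarrow> 's \<Rightarrow> real ^ 'n ^ 'd"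
    and X :: "real ^ 'd \<Rightarrow> 's \<Rightarrow> real \<Rightarrow> 'w \<Rightarrow> real ^ 'd"
    and \<Lambda> :: "real ^ 'd \<Rightarrow> 's \<Rightarrow> real \<Rightarrow> 'w \<Rightarrow> 's"
    and \<sigma>\<^sub>0 :: "'s \<Rightarrow> real ^ 'n ^ 'd"
    and \<Lambda>\<^sub>0 :: "'s \<Rightarrow> real \<Rightarrow> 'w \<Rightarrow> 's"
    and lam \<Gamma> :: "'s \<Rightarrow> real"
    and f \<psi> :: "real \<Rightarrow> real"
  assumes basis: "stochastic_basis M F"
    and bm: "brownian_motion M F B"
    and switching: "\<And>x. switching_process M F (\<Lambda> x)"
    and A1: "locally_bounded_coeffs b \<sigma>"
    and A2: "sde_well_posed M F B b \<sigma> X \<Lambda>"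
    and A3: "strong_markov M F X \<Lambda>"
    and A4: "Cb_feller M X \<Lambda>"
    and A5: "martingale_problem M F b \<sigma> X \<Lambda>"
    and \<Lambda>_indep: "\<And>x i t \<omega>. 0 \<le> t \<Longrightarrow> \<omega> \<in> space M \<Longrightarrow> \<Lambda> x i t \<omega> = \<Lambda>\<^sub>0 i t \<omega>"
    and \<sigma>_indep: "\<And>x i. \<sigma> x i = \<sigma>\<^sub>0 i"
    and chain: "homogeneous_markov_chain M F \<Lambda>\<^sub>0"
    and irreducible: "irreducible_rates (rate M \<Lambda>\<^sub>0)"
    and invariant: "invariant_prob M \<Lambda>\<^sub>0 lam"
    and f_nonneg: "\<And>u. 0 \<le> u \<Longrightarrow> 0 \<le> f u"
    and \<psi>_nonneg: "\<And>u. 0 \<le> u \<Longrightarrow> 0 \<le> \<psi> u"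
    and f_bounded: "bounded (f ` {0..})"
    and f_concave: "concave_on {0..} f"
    and f_mono: "mono_on {0..} f"
    and f_abs_cont: "\<And>u\<^sub>0 u\<^sub>1. 0 < u\<^sub>0 \<Longrightarrow> u\<^sub>0 < u\<^sub>1 \<Longrightarrow> absolutely_continuous_on_interval u\<^sub>0 u\<^sub>1 f"
    and f_zero: "\<And>u. 0 \<le> u \<Longrightarrow> f u = 0 \<longleftrightarrow> u = 0"
    and \<psi>_convex: "convex_on {0..} \<psi>"
    and \<psi>_zero: "\<And>u. 0 \<le> u \<Longrightarrow> \<psi> u = 0 \<longleftrightarrow> u = 0"
    and \<Gamma>_nonpos: "\<And>i. \<Gamma> i \<le> 0"
    and diss: "\<And>i. dissipative f \<psi> (\<Gamma> i) (\<lambda>x. b x i)"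
    and \<Gamma>_mean: "(\<Sum>i\<in>UNIV. \<Gamma> i * lam i) < 0"
  shows "\<forall>p\<ge>1. \<forall>x i y j.
     (let W = (\<lambda>t. wasserstein f p (trans_kernel M X \<Lambda> t (x, i)) (trans_kernel M X \<Lambda> t (y, j)))
      in (W \<longlongrightarrow> 0) at_top \<and>
         (\<forall>q>1. (\<forall>u\<ge>0. \<psi> u = u powr q) \<longrightarrow>
            Limsup at_top (\<lambda>t. ereal (t powr (1 / (q - 1)) * W t))
              \<le> ereal (((1 - q) / 2 * (\<Sum>i\<in>UNIV. \<Gamma> i * lam i)) powr (1 / (1 - q)))) \<and>
         (\<forall>\<kappa>>0. (\<forall>u\<ge>0. \<psi> u = \<kappa> * u) \<longrightarrow>
            (\<forall>\<alpha>. 0 < \<alpha> \<and> \<alpha> < min (vartheta M \<Lambda>\<^sub>0 / p) (- \<kappa> * (\<Sum>i\<in>UNIV. \<Gamma> i * lam i)) \<longrightarrow>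
               ((\<lambda>t. exp (\<alpha> * t / 2) * W t) \<longlongrightarrow> 0) at_top)))"
proof -
  obtain R where R: "\<And>u. 0 \<le> u \<Longrightarrow> f u \<le> R"
    using f_bounded unfolding bounded_iff by (metis abs_le_D1 atLeast_iff imageI real_norm_def)
  have neg: "\<exists>k. \<Gamma> k < 0"
  proof (rule ccontr)
    assume "\<nexists>k. \<Gamma> k < 0"
    then have "\<Gamma> i = 0" for i using \<Gamma>_nonpos[of i] by (simp add: not_less order_antisym)
    then show False using \<Gamma>_mean by simp
  qed
  interpret stochastic_basis M F by (rule basis)
  interpret contractive_diffusion M F B b \<sigma> X \<Lambda> \<sigma>\<^sub>0 \<Lambda>\<^sub>0 f \<psi> \<Gamma> R
  proof unfold_locales
    show "f 0 = 0" "\<psi> 0 = 0" using f_zero[of 0] \<psi>_zero[of 0] by auto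
    show "0 < f u" "0 < \<psi> u" if "0 < u" for u
      using that f_zero[of u] f_nonneg[of u] \<psi>_zero[of u] \<psi>_nonneg[of u] by auto
  qed (fact bm A1 A2 A3 \<Lambda>_indep \<sigma>_indep chain f_concave f_mono R \<psi>_convex \<Gamma>_nonpos neg diss)+
  show ?thesis
    unfolding Let_def
    using W_tendsto_0[OF irreducible invariant] W_power_rate[OF irreducible invariant]
      W_exponential_rate[OF irreducible invariant]
    by auto
qed

end
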